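(* Assume that $\mu>0$ and that for some $a,b\ge0$ with $a+b>0$ and some $\varepsilon>0$ we have, for $t=1,2,\dots$, $$\mathbf P(X_1=t)=a t^{-3}(1+r(t)),\qquad \mathbf P(X_1=-t)=b t^{-3}(1+r(-t)),$$ where $r(s)=O\bigl((\ln\ln|s|)^{-1-\varepsilon}\bigr)$ as $|s|\to+\infty$. Then, as $t\to+\infty$ through the integers: (i) Suppose that conditions (R1) and (R2) of the context hold. Then $\mathbf E N<\infty$ implies $$\mathbf P(S_N=t)=(\mathbf E N)\,\mathbf P(X_1=t)(1+o(1))+\mu^{-1}\,\mathbf P\bigl(N=\lfloor t/\mu\rfloor\bigr)(1+o(1)).$$ Furthermore, if in addition $\mathbf P(X_1=t)=o\bigl(\mathbf P(N=t)\bigr)$ as $t\to+\infty$, then either of the conditions $\mathbf E N<\infty$ or (P) implies $$\mathbf P(S_N=t)\sim\mu^{-1}\,\mathbf P\bigl(N=\lfloor t/\mu\rfloor\bigr).$$ (ii) Suppose that $\mathbf E N<\infty$. If $\mathbf P(N=t)=o\bigl(\mathbf P(X_1=t)\bigr)$ as $t\to+\infty$, then $\mathbf P(S_N=t)\sim(\mathbf E N)\,\mathbf P(X_1=t)$.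
   Context: $X_1,X_2,\dots$ are i.i.d. integer valued random variables; $N$ is a non-negative integer valued random variable independent of $\{X_i\}$; $S_N=X_1+\dots+X_N$ (with $S_0=0$). $\mu=\mathbf E X_1$. $f(t)\sim g(t)$ means $f(t)/g(t)\to1$ as $t\to+\infty$. Conditions on $N$ (with $t,s,t_1,t_2$ positive integers): (R1) There exist $c_1>1$ and $c_2,c_3>0$ such that $c_2\le\mathbf P(N=t_2)/\mathbf P(N=t_1)\le c_3$ for any $t_1,t_2$ with $1\le t_2/t_1\le c_1$. (R2) There exists $\varkappa>0.5$ such that $\displaystyle\lim_{t\to+\infty}\ \sup_{s:\,|t-s|\le t^{\varkappa}}\frac{\mathbf P(N=t)}{\mathbf P(N=s)}=1$. (P) For some $\gamma>1$, $\mathbf P(N=t)=t^{-\gamma}L_2(t)$ for $t=1,2,\dots$, where $L_2$ is slowly varying at infinity. *)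

theory Defs
  imports "HOL-Probability.Probability" "HOL-Library.Landau_Symbols"
begin

definition mass :: "'a measure \<Rightarrow> ('a \<Rightarrow> 'b) \<Rightarrow> 'b \<Rightarrow> real" where
  "mass M Y y = \<P>(\<omega> in M. Y \<omega> = y)"

text \<open>The sequence of summands is indexed from \<open>0\<close>, so \<open>X 0\<close> is the first summand.\<close>

definition random_sum :: "(nat \<Rightarrow> 'a \<Rightarrow> int) \<Rightarrow> ('a \<Rightarrow> nat) \<Rightarrow> 'a \<Rightarrow> int" where
  "random_sum X N \<omega> = (\<Sum>i<N \<omega>. X i \<omega>)"

definition iid :: "'a measure \<Rightarrow> (nat \<Rightarrow> 'a \<Rightarrow> int) \<Rightarrow> bool" where
  "iid M X \<longleftrightarrow> prob_space.indep_vars M (\<lambda>_. count_space UNIV) X UNIV \<and>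
     (\<forall>i. distr M (count_space UNIV) (X i) = distr M (count_space UNIV) (X 0))"

text \<open>
  Independence of the \<open>\<sigma>\<close>-algebras generated by \<open>N\<close> and by the whole family \<open>X\<close>; the
  library's \<open>indep_var\<close> does not apply because the two random elements have different types.
\<close>

definition indep_of_seq :: "'a measure \<Rightarrow> ('a \<Rightarrow> nat) \<Rightarrow> (nat \<Rightarrow> 'a \<Rightarrow> int) \<Rightarrow> bool" where
  "indep_of_seq M N X \<longleftrightarrow>
     N \<in> measurable M (count_space UNIV) \<and>
     prob_space.indep_set M
       (sets (vimage_algebra (space M) N (count_space UNIV)))
       (sets (vimage_algebra (space M) (\<lambda>\<omega> i. X i \<omega>) (PiM UNIV (\<lambda>_. count_space UNIV))))"

text \<open>
  The next three conditions concern the function \<open>p t = P(N = t)\<close>. In \<open>R1\<close>, taking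
  \<open>t\<^sub>1 = t\<^sub>2\<close> forces \<open>p t > 0\<close> for all \<open>t > 0\<close>, since division by zero yields zero;
  hence in the presence of \<open>R1\<close> all quotients below are genuine ones. The supremum in \<open>R2\<close>
  is over a finite set that contains \<open>s = t\<close>.
\<close>

definition R1 :: "(nat \<Rightarrow> real) \<Rightarrow> bool" where
  "R1 p \<longleftrightarrow> (\<exists>c\<^sub>1>1. \<exists>c\<^sub>2>0. \<exists>c\<^sub>3>0. \<forall>t\<^sub>1>0. \<forall>t\<^sub>2>0.
     1 \<le> real t\<^sub>2 / real t\<^sub>1 \<longrightarrow> real t\<^sub>2 / real t\<^sub>1 \<le> c\<^sub>1 \<longrightarrow>
     c\<^sub>2 \<le> p t\<^sub>2 / p t\<^sub>1 \<and> p t\<^sub>2 / p t\<^sub>1 \<le> c\<^sub>3)"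

definition R2 :: "(nat \<Rightarrow> real) \<Rightarrow> bool" where
  "R2 p \<longleftrightarrow> (\<exists>\<kappa>>1/2.
     (\<lambda>t. SUP s\<in>{s. 0 < s \<and> \<bar>real t - real s\<bar> \<le> real t powr \<kappa>}. p t / p s) \<longlonglongrightarrow> 1)"

definition slowly_varying :: "(real \<Rightarrow> real) \<Rightarrow> bool" where
  "slowly_varying L \<longleftrightarrow>
     (\<exists>A. set_borel_measurable borel {A..} L \<and> (\<forall>x\<ge>A. L x > 0)) \<and>
     (\<forall>c>0. ((\<lambda>x. L (c * x) / L x) \<longlongrightarrow> 1) at_top)"

definition regularly_varying_mass :: "(nat \<Rightarrow> real) \<Rightarrow> bool" where
  "regularly_varying_mass p \<longleftrightarrow> (\<exists>\<gamma>>1. \<exists>L. slowly_varying L \<and>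
     (\<forall>t>0. p t = real t powr - \<gamma> * L (real t)))"

end

(*
  Let u n t = P(S_n = t), so that P(S_N = t) = sum_n P(N = n) u n t. Truncating the summands at a
  multiple of x = |t - n mu| and an exponential Chebyshev bound give u n t = O(n x^-3) whenever
  x >= n^kappa with kappa > 1/2; moreover t^3 u n t -> n a for fixed n (one big jump).
  For n outside the band t / (2 mu) < n < 2 t / mu dominated convergence yields the term
  (E N) P(X_1 = t). Inside the band only |t - n mu| <= t^kappa matters, where R2 makes P(N = n)
  asymptotically constant, and the sum of u n t over this range tends to 1 / mu by the renewal theorem
  U t = sum_n u n t -> 1 / mu. The latter holds because U (T - j) is close to limsup U for every
  possible jump j when U T is, because U is the average of its shifts, and because
  E (sum of U over (t - X_1, t]) = 1 for t >= 0.
  If N has infinite mean, Potter's bounds replace dominated convergence.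
*)
theory Submission
  imports Defs "HOL-Real_Asymp.Real_Asymp"
begin

text \<open>Under these tails the summand has infinite variance. A local limit theorem for each
  single n would therefore need a truncated normalisation. It is avoided because only sums over n
  enter near the mean, and the renewal theorem supplies those without describing any individual
  \<open>walk F n\<close> there. About a single n only a bound away from the mean is required, and
  moments of every order below 2 suffice for it. The fluctuations of the walk exceed the order sqrt
  n by less than any power of n. This is the origin of \<open>\<kappa> > 1/2\<close>: a window of
  width t^\<kappa> around t captures all but a vanishing part of the renewal mass. Since jumps may
  be negative, U lives on all integers, and both its finiteness and its decay at minus infinity have
  to be extracted from the positive drift. Aperiodicity is a consequence of \<mu> > 0, which forces
  a > 0 and so makes every large positive jump possible. All estimates are made for mass functions
  on the integers; independence of random variables is used only to identify the laws.\<close>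

section \<open>The law of the walk and truncated exponential Chebyshev bounds\<close>

primrec walk :: "int pmf \<Rightarrow> nat \<Rightarrow> int pmf" where
  "walk F 0 = return_pmf 0"
| "walk F (Suc n) = bind_pmf F (\<lambda>k. map_pmf ((+) k) (walk F n))"

lemma pmf_walk_0: "pmf (walk F 0) t = (if t = 0 then 1 else 0)"
  by (simp add: pmf_return)

lemma pmf_walk_Suc: "pmf (walk F (Suc n)) t = (\<integral>k. pmf (walk F n) (t - k) \<partial>F)"
proof -
  have "pmf (map_pmf ((+) k) W) t = pmf W (t - k)" for k and W :: "int pmf"
    using pmf_map_inj'[of "(+) k" W "t - k"] by (simp add: inj_def)
  then show ?thesis by (simp add: pmf_bind)
qed

declare walk.simps [simp del]

text \<open>Commutativity of convolution with a weight on the jump. It turns an average over the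
  jump \<open>k\<close> into an average over the rest \<open>j\<close>, so that a pointwise bound on
  \<open>pmf F\<close> can be used when the jump is large.\<close>

lemma integral_pmf_reflect:
  fixes F W :: "int pmf" and g :: "int \<Rightarrow> real"
  shows "(\<integral>k. g k * pmf W (t - k) \<partial>F) = (\<integral>j. g (t - j) * pmf F (t - j) \<partial>W)"
proof -
  have bij: "bij_betw (\<lambda>j. t - j) UNIV (UNIV :: int set)"
    by (rule bij_betw_byWitness[where f' = "\<lambda>j. t - j"]) auto
  have "(\<integral>k. g k * pmf W (t - k) \<partial>F)
      = (\<integral>k. pmf F k * (g k * pmf W (t - k)) \<partial>count_space UNIV)"
    by (subst measure_pmf_eq_density, subst integral_density) auto
  also have "\<dots> = (\<integral>j. pmf F (t - j) * (g (t - j) * pmf W (t - (t - j))) \<partial>count_space UNIV)"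
    by (rule integral_bij_count_space[OF bij, symmetric])
  also have "\<dots> = (\<integral>j. pmf W j * (g (t - j) * pmf F (t - j)) \<partial>count_space UNIV)"
    by (simp add: mult_ac)
  also have "\<dots> = (\<integral>j. g (t - j) * pmf F (t - j) \<partial>W)"
    by (subst measure_pmf_eq_density, subst integral_density) auto
  finally show ?thesis .
qed

lemma integrable_pmf_bounded:
  fixes g :: "'a \<Rightarrow> real"
  assumes "\<And>k. \<bar>g k\<bar> \<le> B"
  shows "integrable (measure_pmf F) g"
  by (rule measure_pmf.integrable_const_bound[where B = B]) (use assms in auto)

lemma integral_pmf_le_const:
  fixes g :: "'a \<Rightarrow> real"
  assumes "\<And>k. \<bar>g k\<bar> \<le> B"
  shows "\<bar>\<integral>k. g k \<partial>measure_pmf F\<bar> \<le> B"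
proof -
  have "\<bar>\<integral>k. g k \<partial>measure_pmf F\<bar> \<le> (\<integral>k. \<bar>g k\<bar> \<partial>measure_pmf F)"
    by (rule integral_abs_bound)
  also have "\<dots> \<le> (\<integral>k. B \<partial>measure_pmf F)"
    by (rule integral_mono) (use assms integrable_pmf_bounded[of "\<lambda>k. \<bar>g k\<bar>" B] in auto)
  finally show ?thesis by simp
qed

text \<open>Induction on \<open>n\<close>, conditioning on one jump. An oversized jump costs at most
  \<open>s\<close> at each of the \<open>n\<close> steps; a moderate one multiplies the tilted bound
  for the remaining walk by its own exponential factor, which averages to
  \<open>\<Phi>\<close>.\<close>

lemma pmf_walk_truncation:
  fixes F :: "int pmf" and \<mu> y s h :: real
  assumes s: "s \<ge> 0" and tail: "\<And>k. \<bar>real_of_int k - \<mu>\<bar> > y \<Longrightarrow> pmf F k \<le> s"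
  defines "\<Phi> \<equiv> (\<integral>k. (if \<bar>real_of_int k - \<mu>\<bar> \<le> y then exp (h * (real_of_int k - \<mu>)) else 0) \<partial>F)"
  shows "pmf (walk F n) t \<le> real n * s + exp (- h * (real_of_int t - real n * \<mu>)) * \<Phi> ^ n"
proof (induction n arbitrary: t)
  case 0
  then show ?case by (simp add: pmf_walk_0)
next
  case (Suc n)
  define W where "W = walk F n"
  define G where "G k = (if \<bar>real_of_int k - \<mu>\<bar> \<le> y then exp (h * (real_of_int k - \<mu>)) else 0)" for k :: int
  have Gb: "\<bar>G k\<bar> \<le> exp (\<bar>h\<bar> * \<bar>y\<bar>)" for k
  proof -
    have "\<bar>real_of_int k - \<mu>\<bar> \<le> y \<Longrightarrow> h * (real_of_int k - \<mu>) \<le> \<bar>h\<bar> * \<bar>y\<bar>"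
      by (rule order_trans[OF abs_ge_self]) (auto simp: abs_mult intro!: mult_left_mono)
    then show ?thesis by (auto simp: G_def)
  qed
  have intG: "integrable F G" by (rule integrable_pmf_bounded[OF Gb])
  define c where "c = exp (- h * (real_of_int t - real (Suc n) * \<mu>)) * \<Phi> ^ n"
  have "pmf (walk F (Suc n)) t
      = (\<integral>k. indicator {k. \<bar>real_of_int k - \<mu>\<bar> > y} k * pmf W (t - k)
             + indicator {k. \<bar>real_of_int k - \<mu>\<bar> \<le> y} k * pmf W (t - k) \<partial>F)"
    unfolding pmf_walk_Suc W_def by (rule Bochner_Integration.integral_cong) (auto simp: indicator_def)
  also have "\<dots> = (\<integral>k. indicator {k. \<bar>real_of_int k - \<mu>\<bar> > y} k * pmf W (t - k) \<partial>F)
             + (\<integral>k. indicator {k. \<bar>real_of_int k - \<mu>\<bar> \<le> y} k * pmf W (t - k) \<partial>F)"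
    by (rule Bochner_Integration.integral_add; rule integrable_pmf_bounded[where B = 1])
       (auto simp: indicator_def pmf_le_1)
  also have "(\<integral>k. indicator {k. \<bar>real_of_int k - \<mu>\<bar> > y} k * pmf W (t - k) \<partial>F)
      = (\<integral>j. indicator {k. \<bar>real_of_int k - \<mu>\<bar> > y} (t - j) * pmf F (t - j) \<partial>W)"
    by (rule integral_pmf_reflect)
  \<comment> \<open>Given the value \<open>j\<close> of the rest, an oversized jump has to equal
    \<open>t - j\<close>, a single point of mass at most \<open>s\<close>.\<close>
  also have "\<dots> \<le> s"
    by (rule order_trans[OF abs_ge_self], rule integral_pmf_le_const)
       (use s tail in \<open>auto simp: indicator_def\<close>)
  also have "(\<integral>k. indicator {k. \<bar>real_of_int k - \<mu>\<bar> \<le> y} k * pmf W (t - k) \<partial>F)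
      \<le> (\<integral>k. real n * s + c * G k \<partial>F)"
  proof (rule integral_mono)
    fix k
    show "indicator {k. \<bar>real_of_int k - \<mu>\<bar> \<le> y} k * pmf W (t - k) \<le> real n * s + c * G k"
    proof (cases "\<bar>real_of_int k - \<mu>\<bar> \<le> y")
      case True
      have "pmf W (t - k) \<le> real n * s + exp (- h * (real_of_int (t - k) - real n * \<mu>)) * \<Phi> ^ n"
        unfolding W_def by (rule Suc.IH)
      also have "exp (- h * (real_of_int (t - k) - real n * \<mu>)) * \<Phi> ^ n = c * G k"
        using True by (simp add: c_def G_def exp_add[symmetric] algebra_simps)
      finally show ?thesis using True by simp
    qed (use s in \<open>auto simp: G_def\<close>)
  next
    show "integrable F (\<lambda>k. real n * s + c * G k)" using intG by simp
  qed (auto intro!: integrable_pmf_bounded[where B = 1] simp: indicator_def pmf_le_1)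
  also have "(\<integral>k. real n * s + c * G k \<partial>F) = real n * s + c * \<Phi>"
    using intG by (simp add: \<Phi>_def G_def[abs_def])
  finally show ?case by (simp add: c_def algebra_simps)
qed

lemma exp_le_quadratic: "exp z \<le> 1 + z + z\<^sup>2 * exp \<bar>z\<bar>" for z :: real
proof -
  have "\<exists>\<xi>. \<bar>\<xi>\<bar> \<le> \<bar>z\<bar> \<and> exp z = (\<Sum>m<2. z ^ m / fact m) + exp \<xi> / fact 2 * z ^ 2"
    using Maclaurin_exp_le[of z 2] by blast
  then obtain \<xi> where \<xi>: "\<bar>\<xi>\<bar> \<le> \<bar>z\<bar>" "exp z = (\<Sum>m<2. z ^ m / fact m) + exp \<xi> / fact 2 * z ^ 2"
    by blast
  have "exp \<xi> / 2 * z\<^sup>2 \<le> exp \<bar>z\<bar> * z\<^sup>2"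
  proof (rule mult_right_mono)
    have "exp \<xi> \<le> exp \<bar>z\<bar>" using \<xi>(1) by simp
    then show "exp \<xi> / 2 \<le> exp \<bar>z\<bar>" using exp_gt_zero[of \<xi>] by linarith
  qed simp
  with \<xi>(2) show ?thesis by (simp add: eval_nat_numeral algebra_simps)
qed

text \<open>The truncated exponential is dominated pointwise by a function whose linear term has
  mean zero. The order \<open>\<beta> < 2\<close> stands in for the second moment, which is infinite
  in the application. Where |z| <= y, the square is at most y^(2-\<beta>) |z|^\<beta>; beyond
  \<open>y\<close> the truncated function is 0, but 1 + h z may be negative and is compensated by
  the term with y^(1-\<beta>).\<close>

lemma truncated_mgf_le:
  fixes F :: "int pmf" and \<mu> y h \<beta> :: real
  assumes \<mu>: "\<mu> = (\<integral>k. real_of_int k \<partial>F)" and int: "integrable F real_of_int"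
    and \<beta>: "1 < \<beta>" "\<beta> < 2" and M: "integrable F (\<lambda>k. \<bar>real_of_int k - \<mu>\<bar> powr \<beta>)"
    and y: "y > 0"
  shows "(\<integral>k. (if \<bar>real_of_int k - \<mu>\<bar> \<le> y then exp (h * (real_of_int k - \<mu>)) else 0) \<partial>F)
    \<le> 1 + (\<bar>h\<bar> * y powr (1 - \<beta>) + h\<^sup>2 * y powr (2 - \<beta>) * exp (\<bar>h\<bar> * y))
          * (\<integral>k. \<bar>real_of_int k - \<mu>\<bar> powr \<beta> \<partial>F)" (is "?L \<le> 1 + ?c * ?M")
proof -
  have ineq: "(if \<bar>z\<bar> \<le> y then exp (h * z) else 0) \<le> 1 + h * z + ?c * \<bar>z\<bar> powr \<beta>" for z :: real
  proof (cases "\<bar>z\<bar> \<le> y")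
    case True
    have "z\<^sup>2 \<le> y powr (2 - \<beta>) * \<bar>z\<bar> powr \<beta>"
    proof (cases "z = 0")
      case False
      have "z\<^sup>2 = \<bar>z\<bar> powr (2 - \<beta>) * \<bar>z\<bar> powr \<beta>"
        using False by (simp add: powr_add[symmetric])
      also have "\<dots> \<le> y powr (2 - \<beta>) * \<bar>z\<bar> powr \<beta>"
        by (rule mult_right_mono) (use True \<beta> in \<open>auto intro: powr_mono2\<close>)
      finally show ?thesis .
    qed auto
    moreover have "exp \<bar>h * z\<bar> \<le> exp (\<bar>h\<bar> * y)"
      using True by (auto simp: abs_mult intro: mult_left_mono)
    ultimately have "z\<^sup>2 * exp \<bar>h * z\<bar> \<le> (y powr (2 - \<beta>) * \<bar>z\<bar> powr \<beta>) * exp (\<bar>h\<bar> * y)"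
      by (intro mult_mono) auto
    then have "h\<^sup>2 * (z\<^sup>2 * exp \<bar>h * z\<bar>) \<le> h\<^sup>2 * ((y powr (2 - \<beta>) * \<bar>z\<bar> powr \<beta>) * exp (\<bar>h\<bar> * y))"
      by (rule mult_left_mono) simp
    moreover have "0 \<le> \<bar>h\<bar> * y powr (1 - \<beta>) * \<bar>z\<bar> powr \<beta>" by simp
    moreover have "exp (h * z) \<le> 1 + h * z + h\<^sup>2 * (z\<^sup>2 * exp \<bar>h * z\<bar>)"
      using exp_le_quadratic[of "h * z"] by (simp only: power_mult_distrib mult.assoc)
    moreover have "?c * \<bar>z\<bar> powr \<beta> = \<bar>h\<bar> * y powr (1 - \<beta>) * \<bar>z\<bar> powr \<beta>
        + h\<^sup>2 * ((y powr (2 - \<beta>) * \<bar>z\<bar> powr \<beta>) * exp (\<bar>h\<bar> * y))"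
      by (simp add: algebra_simps)
    ultimately have "exp (h * z) \<le> 1 + h * z + ?c * \<bar>z\<bar> powr \<beta>" by linarith
    then show ?thesis using True by simp
  next
    case False
    have "\<bar>z\<bar> = \<bar>z\<bar> powr (1 - \<beta>) * \<bar>z\<bar> powr \<beta>"
      using False y by (simp add: powr_add[symmetric])
    also have "\<dots> \<le> y powr (1 - \<beta>) * \<bar>z\<bar> powr \<beta>"
      by (rule mult_right_mono) (use False \<beta> y in \<open>auto intro: powr_mono2'\<close>)
    finally have "\<bar>h\<bar> * \<bar>z\<bar> \<le> \<bar>h\<bar> * (y powr (1 - \<beta>) * \<bar>z\<bar> powr \<beta>)"
      by (intro mult_left_mono) auto
    moreover have "- (h * z) \<le> \<bar>h\<bar> * \<bar>z\<bar>" by (simp add: abs_mult[symmetric])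
    moreover have "0 \<le> h\<^sup>2 * y powr (2 - \<beta>) * exp (\<bar>h\<bar> * y) * \<bar>z\<bar> powr \<beta>" by simp
    moreover have "?c * \<bar>z\<bar> powr \<beta> = \<bar>h\<bar> * (y powr (1 - \<beta>) * \<bar>z\<bar> powr \<beta>)
        + h\<^sup>2 * y powr (2 - \<beta>) * exp (\<bar>h\<bar> * y) * \<bar>z\<bar> powr \<beta>"
      by (simp add: algebra_simps)
    ultimately have "0 \<le> 1 + h * z + ?c * \<bar>z\<bar> powr \<beta>" by linarith
    then show ?thesis using False by simp
  qed
  have intL: "integrable F (\<lambda>k. if \<bar>real_of_int k - \<mu>\<bar> \<le> y then exp (h * (real_of_int k - \<mu>)) else 0)"
  proof (rule integrable_pmf_bounded[where B = "exp (\<bar>h\<bar> * y)"])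
    fix k :: int
    have "\<bar>real_of_int k - \<mu>\<bar> \<le> y \<Longrightarrow> h * (real_of_int k - \<mu>) \<le> \<bar>h\<bar> * y"
      by (rule order_trans[OF abs_ge_self]) (auto simp: abs_mult intro!: mult_left_mono)
    then show "\<bar>if \<bar>real_of_int k - \<mu>\<bar> \<le> y then exp (h * (real_of_int k - \<mu>)) else 0\<bar> \<le> exp (\<bar>h\<bar> * y)"
      by auto
  qed
  have "?L \<le> (\<integral>k. 1 + h * (real_of_int k - \<mu>) + ?c * \<bar>real_of_int k - \<mu>\<bar> powr \<beta> \<partial>F)"
    by (rule integral_mono[OF intL]) (use int M ineq in auto)
  also have "\<dots> = 1 + ?c * ?M"
    using int M by (simp add: \<mu>)
  finally show ?thesis .
qed

text \<open>Two copies of the naturals cover the integers; that 0 is covered twice does not affect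
  absolute summability.\<close>

lemma integrable_pmf_int_iff:
  fixes F :: "int pmf" and g :: "int \<Rightarrow> real"
  assumes "summable (\<lambda>n. pmf F (int n) * \<bar>g (int n)\<bar>)" "summable (\<lambda>n. pmf F (- int n) * \<bar>g (- int n)\<bar>)"
  shows "integrable F g"
proof -
  define q where "q k = pmf F k * g k" for k
  have "Infinite_Set_Sum.abs_summable_on (\<lambda>n. q (int n)) UNIV" "Infinite_Set_Sum.abs_summable_on (\<lambda>n. q (- int n)) UNIV"
    using assms by (auto simp: abs_summable_on_nat_iff' q_def abs_mult)
  then have "Infinite_Set_Sum.abs_summable_on q (range int)" "Infinite_Set_Sum.abs_summable_on q (range (\<lambda>n. - int n))"
    by (auto simp: abs_summable_on_reindex_iff[of int UNIV q, symmetric]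
        abs_summable_on_reindex_iff[of "\<lambda>n. - int n" UNIV q, symmetric] inj_def)
  then have "Infinite_Set_Sum.abs_summable_on q (range int \<union> range (\<lambda>n. - int n))"
    by (rule abs_summable_on_union)
  also have "range int \<union> range (\<lambda>n. - int n) = UNIV"
  proof -
    have "k \<in> range int \<union> range (\<lambda>n. - int n)" for k
      by (cases k rule: int_cases2) auto
    then show ?thesis by auto
  qed
  finally have "integrable (count_space UNIV) q" by (simp add: Infinite_Set_Sum.abs_summable_on_def)
  then show ?thesis
    by (subst measure_pmf_eq_density, subst integrable_density) (auto simp: q_def[abs_def])
qed

section \<open>Moments and large deviations of a heavy-tailed walk with positive drift\<close>

text \<open>The law of the summand as the analysis sees it: \<open>tail_bound\<close> yields moments
  of order below 2 on both sides, \<open>tail_limit\<close> gives the probability of one big jump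
  upwards, and \<open>a_pos\<close> makes all large jumps possible, which takes the place of
  aperiodicity in the renewal theorem.\<close>

locale heavy_tailed_walk =
  fixes F :: "int pmf" and a \<mu> :: real
  assumes tail_bound: "\<exists>C. \<forall>k. pmf F k * \<bar>real_of_int k\<bar> ^ 3 \<le> C"
    and tail_limit: "(\<lambda>t. real t ^ 3 * pmf F (int t)) \<longlonglongrightarrow> a"
    and mean: "\<mu> = (\<integral>k. real_of_int k \<partial>F)"
    and mean_pos: "\<mu> > 0" and a_pos: "a > 0"
begin

lemma integrable_moment:
  assumes "0 \<le> \<beta>" "\<beta> < 2"
  shows "integrable F (\<lambda>k. \<bar>real_of_int k\<bar> powr \<beta>)"
proof -
  obtain C where C: "\<And>k. pmf F k * \<bar>real_of_int k\<bar> ^ 3 \<le> C" using tail_bound by blast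
  have s: "summable (\<lambda>n. C * real n powr (\<beta> - 3))"
    using assms by (intro summable_mult) (simp add: summable_real_powr_iff)
  have b: "pmf F k * \<bar>real_of_int k\<bar> powr \<beta> \<le> C * \<bar>real_of_int k\<bar> powr (\<beta> - 3)" if "k \<noteq> 0" for k
  proof -
    have "\<bar>real_of_int k\<bar> powr \<beta> = \<bar>real_of_int k\<bar> ^ 3 * \<bar>real_of_int k\<bar> powr (\<beta> - 3)"
      using that by (simp add: powr_diff powr_numeral)
    then show ?thesis using mult_right_mono[OF C[of k], of "\<bar>real_of_int k\<bar> powr (\<beta> - 3)"]
      by (simp add: mult_ac)
  qed
  show ?thesis
  proof (rule integrable_pmf_int_iff)
    show "summable (\<lambda>n. pmf F (int n) * \<bar>\<bar>real_of_int (int n)\<bar> powr \<beta>\<bar>)"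
    proof (rule summable_comparison_test'[OF s, of 1])
      fix n :: nat assume "1 \<le> n"
      then show "norm (pmf F (int n) * \<bar>\<bar>real_of_int (int n)\<bar> powr \<beta>\<bar>) \<le> C * real n powr (\<beta> - 3)"
        using b[of "int n"] by (simp add: abs_mult)
    qed
    show "summable (\<lambda>n. pmf F (- int n) * \<bar>\<bar>real_of_int (- int n)\<bar> powr \<beta>\<bar>)"
    proof (rule summable_comparison_test'[OF s, of 1])
      fix n :: nat assume "1 \<le> n"
      then show "norm (pmf F (- int n) * \<bar>\<bar>real_of_int (- int n)\<bar> powr \<beta>\<bar>) \<le> C * real n powr (\<beta> - 3)"
        using b[of "- int n"] by (simp add: abs_mult)
    qed
  qed
qed

lemma integrable_id: "integrable F real_of_int"
  by (rule Bochner_Integration.integrable_bound[OF integrable_moment[of 1]]) auto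

lemma integrable_centred_moment:
  assumes "0 \<le> \<beta>" "\<beta> < 2"
  shows "integrable F (\<lambda>k. \<bar>real_of_int k - \<mu>\<bar> powr \<beta>)"
proof (rule Bochner_Integration.integrable_bound)
  show "integrable F (\<lambda>k. 2 powr \<beta> * (\<bar>real_of_int k\<bar> powr \<beta> + \<mu> powr \<beta>))"
    using integrable_moment[OF assms] by auto
  have "\<bar>real_of_int k - \<mu>\<bar> powr \<beta> \<le> 2 powr \<beta> * (\<bar>real_of_int k\<bar> powr \<beta> + \<mu> powr \<beta>)" for k :: int
  proof -
    define m where "m = max \<bar>real_of_int k\<bar> \<mu>"
    have "\<bar>real_of_int k - \<mu>\<bar> powr \<beta> \<le> (2 * m) powr \<beta>"
      using assms mean_pos by (intro powr_mono2) (auto simp: m_def)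
    also have "\<dots> = 2 powr \<beta> * m powr \<beta>" using mean_pos by (simp add: powr_mult m_def)
    also have "m powr \<beta> \<le> \<bar>real_of_int k\<bar> powr \<beta> + \<mu> powr \<beta>" by (auto simp: m_def max_def)
    finally show ?thesis by simp
  qed
  then show "AE k in F. norm (\<bar>real_of_int k - \<mu>\<bar> powr \<beta>) \<le> norm (2 powr \<beta> * (\<bar>real_of_int k\<bar> powr \<beta> + \<mu> powr \<beta>))"
    by (intro AE_I2) simp
qed simp

text \<open>The tilt \<open>h = 3 ln x / x\<close> turns the Chebyshev factor \<open>exp (- h x)\<close> into \<open>x\<^sup>-\<^sup>3\<close>, and truncation
  at \<open>x / K\<close> costs only a factor \<open>x powr (3 / K)\<close>, which \<open>\<kappa> > 1/2\<close> leaves room for.\<close>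

lemma pmf_walk_large_deviation:
  assumes \<kappa>: "1/2 < \<kappa>" "\<kappa> < 1"
  obtains C x\<^sub>0 where "C > 0" "x\<^sub>0 > 0"
    "\<And>n t. \<bar>real_of_int t - real n * \<mu>\<bar> \<ge> x\<^sub>0 \<Longrightarrow> real n powr \<kappa> \<le> \<bar>real_of_int t - real n * \<mu>\<bar>
       \<Longrightarrow> pmf (walk F n) t \<le> C * real n / \<bar>real_of_int t - real n * \<mu>\<bar> ^ 3"
proof -
  \<comment> \<open>The hypothesis on \<open>n\<close> reads n <= x^g with g < 2, and
    \<open>\<delta>\<close> is the room left below 2. A quarter of it is given up in the moment
    order \<open>\<beta>\<close>, another quarter in the truncation factor, since 3 / K = \<delta> /
    4. What remains are the negative exponents -3\<delta>/4 and -\<delta>/2 below, which beat the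
    logarithms.\<close>
  define g where "g = 1 / \<kappa>"
  define \<delta> where "\<delta> = 2 - g"
  define \<beta> where "\<beta> = 2 - \<delta> / 4"
  define K where "K = 12 / \<delta>"
  have g: "1 < g" "g < 2" using \<kappa> by (auto simp: g_def field_simps)
  then have \<delta>: "0 < \<delta>" "\<delta> < 1" by (auto simp: \<delta>_def)
  then have \<beta>: "1 < \<beta>" "\<beta> < 2" and K: "K > 0" by (auto simp: \<beta>_def K_def)
  define M where "M = (\<integral>k. \<bar>real_of_int k - \<mu>\<bar> powr \<beta> \<partial>F)"
  have M0: "M \<ge> 0" unfolding M_def by (rule integral_nonneg_AE) simp
  obtain C0 where C0: "\<And>k. pmf F k * \<bar>real_of_int k\<bar> ^ 3 \<le> C0" using tail_bound by blast
  have C00: "C0 \<ge> 0" using C0[of 0] by simp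
  define H where "H x = 3 * ln x / x" for x :: real
  \<comment> \<open>The coefficient of the moment in \<open>truncated_mgf_le\<close> for truncation
    level x / K and tilt \<open>H x\<close>. Once x^g c(x) < 1, the n-th power of the truncated
    transform is at most exp (n c(x) M) <= exp M.\<close>
  define c where "c x = H x * (x / K) powr (1 - \<beta>) + (H x)\<^sup>2 * (x / K) powr (2 - \<beta>) * exp (H x * (x / K))" for x
  have "((\<lambda>x. x powr g * c x) \<longlongrightarrow> 0) at_top"
  proof -
    have "((\<lambda>x. 3 * K powr (\<beta> - 1) * (ln x * x powr (- (3 * \<delta> / 4)))
             + 9 * K powr (\<beta> - 2) * ((ln x)\<^sup>2 * x powr (- (\<delta> / 2)))) \<longlongrightarrow> 3 * K powr (\<beta> - 1) * 0 + 9 * K powr (\<beta> - 2) * 0) at_top"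
      by (intro tendsto_intros) (use \<delta> in \<open>real_asymp+\<close>)
    moreover have "\<forall>\<^sub>F x in at_top. 3 * K powr (\<beta> - 1) * (ln x * x powr (- (3 * \<delta> / 4)))
             + 9 * K powr (\<beta> - 2) * ((ln x)\<^sup>2 * x powr (- (\<delta> / 2))) = x powr g * c x"
    proof (rule eventually_mono[OF eventually_gt_at_top[of "1::real"]])
      fix x :: real assume x: "x > 1"
      have 1: "exp (H x * (x / K)) = x powr (\<delta> / 4)"
        using x by (simp add: H_def K_def powr_def field_simps)
      have 2: "(x / K) powr (1 - \<beta>) = x powr (1 - \<beta>) * K powr (\<beta> - 1)"
        "(x / K) powr (2 - \<beta>) = x powr (2 - \<beta>) * K powr (\<beta> - 2)"
        using x K powr_minus_divide[of K "1 - \<beta>"] powr_minus_divide[of K "2 - \<beta>"]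
        by (simp_all add: powr_divide)
      have 3: "H x = 3 * (ln x * x powr (-1))" "(H x)\<^sup>2 = 9 * ((ln x)\<^sup>2 * x powr (-2))"
        using x by (auto simp: H_def powr_minus_divide power_divide power_mult_distrib)
      have 4: "x powr (- (3 * \<delta> / 4)) = x powr g * x powr (-1) * x powr (1 - \<beta>)"
      proof -
        have "- (3 * \<delta> / 4) = g + (-1) + (1 - \<beta>)" using \<beta>_def \<delta>_def by linarith
        then show ?thesis by (simp only: powr_add)
      qed
      have 5: "x powr (- (\<delta> / 2)) = x powr g * x powr (-2) * x powr (2 - \<beta>) * x powr (\<delta> / 4)"
      proof -
        have "- (\<delta> / 2) = g + (-2) + (2 - \<beta>) + \<delta> / 4" using \<beta>_def \<delta>_def by linarith
        then show ?thesis by (simp only: powr_add)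
      qed
      show "3 * K powr (\<beta> - 1) * (ln x * x powr (- (3 * \<delta> / 4)))
             + 9 * K powr (\<beta> - 2) * ((ln x)\<^sup>2 * x powr (- (\<delta> / 2))) = x powr g * c x"
        unfolding c_def 1 2 4 5 3(2) unfolding 3(1) by (simp only: distrib_left mult_ac)
    qed
    ultimately show ?thesis by (auto dest: Lim_transform_eventually)
  qed
  then have "\<forall>\<^sub>F x in at_top. x powr g * c x < 1" by (rule order_tendstoD) simp
  moreover have "\<forall>\<^sub>F x in at_top. x / K \<ge> 2 * \<mu>" using K by real_asymp
  ultimately have "\<forall>\<^sub>F x in at_top. x powr g * c x < 1 \<and> x / K \<ge> 2 * \<mu> \<and> x > 1"
    using eventually_gt_at_top[of "1::real"] by eventually_elim auto
  then obtain x\<^sub>0 where x0: "\<And>x. x \<ge> x\<^sub>0 \<Longrightarrow> x powr g * c x < 1 \<and> x / K \<ge> 2 * \<mu> \<and> x > 1"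
    by (auto simp: eventually_at_top_linorder)
  \<comment> \<open>One oversized jump accounts for the first summand, the Chebyshev factor for the
    second.\<close>
  define C where "C = C0 * (2 * K) ^ 3 + exp M"
  have C: "C > 0" using C00 K by (auto simp: C_def intro: add_nonneg_pos)
  show thesis
  proof (rule that[of C "max x\<^sub>0 1"])
    fix n t
    define x where "x = \<bar>real_of_int t - real n * \<mu>\<bar>"
    assume "\<bar>real_of_int t - real n * \<mu>\<bar> \<ge> max x\<^sub>0 1" "real n powr \<kappa> \<le> \<bar>real_of_int t - real n * \<mu>\<bar>"
    then have x: "x \<ge> x\<^sub>0" "x \<ge> 1" "real n powr \<kappa> \<le> x" by (auto simp: x_def)
    have xx: "x powr g * c x < 1" "x / K \<ge> 2 * \<mu>" "x > 1" using x0[OF x(1)] by auto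
    show "pmf (walk F n) t \<le> C * real n / \<bar>real_of_int t - real n * \<mu>\<bar> ^ 3"
    proof (cases "n = 0")
      case True
      \<comment> \<open>For \<open>n = 0\<close> the distance \<open>x\<close> is |t|, so x >= 1
        excludes t = 0 and the mass vanishes.\<close>
      then show ?thesis using x by (auto simp: pmf_walk_0 x_def)
    next
      case False
      \<comment> \<open>The sign directs the tilt towards \<open>t\<close>, so upper and lower
        deviations are treated together.\<close>
      define h where "h = sgn (real_of_int t - real n * \<mu>) * H x"
      have H0: "H x > 0" using xx by (simp add: H_def)
      have habs: "\<bar>h\<bar> = H x" using xx H0 by (auto simp: h_def abs_mult abs_sgn_eq x_def)
      then have h2: "h\<^sup>2 = (H x)\<^sup>2" by (metis power2_abs)
      have hx: "exp (- h * (real_of_int t - real n * \<mu>)) = 1 / x ^ 3"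
      proof -
        have "h * (real_of_int t - real n * \<mu>) = H x * x"
          by (simp add: h_def x_def abs_sgn mult_ac)
        also have "\<dots> = ln (x ^ 3)" using xx by (simp add: H_def ln_realpow)
        finally show ?thesis using xx by (simp add: exp_minus divide_inverse)
      qed
      define \<Phi> where "\<Phi> = (\<integral>k. (if \<bar>real_of_int k - \<mu>\<bar> \<le> x / K then exp (h * (real_of_int k - \<mu>)) else 0) \<partial>F)"
      have \<Phi>0: "\<Phi> \<ge> 0" unfolding \<Phi>_def by (rule integral_nonneg_AE) simp
      have "\<Phi> \<le> 1 + (\<bar>h\<bar> * (x / K) powr (1 - \<beta>) + h\<^sup>2 * (x / K) powr (2 - \<beta>) * exp (\<bar>h\<bar> * (x / K))) * M"
        unfolding \<Phi>_def M_def
        by (rule truncated_mgf_le[OF mean integrable_id \<beta> integrable_centred_moment]) (use \<beta> xx K in auto)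
      then have "\<Phi> \<le> 1 + c x * M" unfolding habs h2 c_def .
      also have "\<dots> \<le> exp (c x * M)" by (rule exp_ge_add_one_self)
      finally have "\<Phi> ^ n \<le> exp (c x * M) ^ n" using \<Phi>0 by (rule power_mono)
      also have "\<dots> = exp (real n * c x * M)" by (simp add: exp_of_nat_mult[symmetric] mult_ac)
      also have "\<dots> \<le> exp M"
      proof -
        have "real n = (real n powr \<kappa>) powr g" using \<kappa> by (simp add: powr_powr g_def)
        also have "\<dots> \<le> x powr g" using x g by (intro powr_mono2) auto
        finally have "real n \<le> x powr g" .
        moreover have "c x \<ge> 0" using H0 by (auto simp: c_def)
        ultimately have "real n * c x \<le> 1" using xx mult_right_mono[of "real n" "x powr g" "c x"] by linarith
        then show ?thesis using M0 mult_right_mono[of "real n * c x" 1 M] by simp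
      qed
      finally have \<Phi>n: "\<Phi> ^ n \<le> exp M" .
      have "pmf (walk F n) t \<le> real n * (C0 * (2 * K) ^ 3 / x ^ 3) + exp (- h * (real_of_int t - real n * \<mu>)) * \<Phi> ^ n"
        unfolding \<Phi>_def
      proof (rule pmf_walk_truncation)
        show "0 \<le> C0 * (2 * K) ^ 3 / x ^ 3" using C00 K xx by auto
        fix k assume "x / K < \<bar>real_of_int k - \<mu>\<bar>"
        \<comment> \<open>Since x / K >= 2 \<mu>, removing the centring at most halves the lower
          bound.\<close>
        then have k: "\<bar>real_of_int k\<bar> \<ge> x / (2 * K)" using xx(2) mean_pos by (simp add: abs_if split: if_splits)
        have x2: "x / (2 * K) > 0" using xx K by simp
        have "pmf F k * (x / (2 * K)) ^ 3 \<le> pmf F k * \<bar>real_of_int k\<bar> ^ 3"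
          using k x2 by (intro mult_left_mono power_mono) auto
        also have "\<dots> \<le> C0" by (rule C0)
        finally show "pmf F k \<le> C0 * (2 * K) ^ 3 / x ^ 3"
          using x2 xx K by (simp add: field_simps)
      qed
      also have "\<dots> \<le> real n * (C0 * (2 * K) ^ 3 / x ^ 3) + real n * exp M / x ^ 3"
      proof -
        have "\<Phi> ^ n / x ^ 3 \<le> real n * exp M / x ^ 3"
        proof (rule divide_right_mono)
          have "exp M \<le> real n * exp M" using False by simp
          then show "\<Phi> ^ n \<le> real n * exp M" using \<Phi>n by linarith
        qed (use xx in simp)
        then show ?thesis unfolding hx by simp
      qed
      also have "\<dots> = C * real n / x ^ 3" by (simp add: C_def distrib_left distrib_right add_divide_distrib mult_ac)
      finally show ?thesis by (simp add: x_def)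
    qed
  qed (use C in auto)
qed
end

section \<open>The renewal function: finiteness, renewal equation and integrated form\<close>

lemma tendsto_integral_pmf_bounded:
  fixes g :: "nat \<Rightarrow> 'a \<Rightarrow> real"
  assumes "\<And>x. (\<lambda>n. g n x) \<longlonglongrightarrow> l x" "\<And>n x. \<bar>g n x\<bar> \<le> B"
  shows "(\<lambda>n. \<integral>x. g n x \<partial>measure_pmf F) \<longlonglongrightarrow> (\<integral>x. l x \<partial>measure_pmf F)"
  by (rule integral_dominated_convergence[where w = "\<lambda>_. B"]) (use assms in auto)

lemma pmf_tendsto_0_at_bot: "(\<lambda>m. pmf W (- int m)) \<longlonglongrightarrow> 0"
proof (rule summable_LIMSEQ_zero, rule summableI_nonneg_bounded)
  fix n
  have "(\<Sum>m<n. pmf W (- int m)) = sum (pmf W) ((\<lambda>m. - int m) ` {..<n})"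
    by (simp add: sum.reindex inj_on_def)
  also have "\<dots> = measure W ((\<lambda>m. - int m) ` {..<n})"
    by (simp add: measure_measure_pmf_finite)
  also have "\<dots> \<le> 1" by simp
  finally show "(\<Sum>m<n. pmf W (- int m)) \<le> 1" .
qed simp

context heavy_tailed_walk
begin

text \<open>The expected number of visits to \<open>t\<close>, the start at time 0 included.
  Convergence of the series is established in \<open>summable_walk\<close>; before that the value
  has no meaning.\<close>

definition renewal :: "int \<Rightarrow> real" where "renewal t = (\<Sum>n. pmf (walk F n) t)"

text \<open>A maximum principle: the partial sums of the renewal series are largest at \<open>t = 0\<close>,
  because for \<open>t \<noteq> 0\<close> they are averages of shorter partial sums.\<close>

lemma renewal_partial_sum_le: "(\<Sum>n<m. pmf (walk F n) t) \<le> (\<Sum>n<m. pmf (walk F n) 0)"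
proof (induction m arbitrary: t)
  case (Suc m)
  show ?case
  proof (cases "t = 0")
    case False
    have "(\<Sum>n<Suc m. pmf (walk F n) t) = (\<Sum>n<m. pmf (walk F (Suc n)) t)"
      using False by (simp add: sum.lessThan_Suc_shift pmf_walk_0 del: sum.lessThan_Suc)
    also have "\<dots> = (\<integral>k. (\<Sum>n<m. pmf (walk F n) (t - k)) \<partial>F)"
      unfolding pmf_walk_Suc
      by (rule Bochner_Integration.integral_sum[symmetric]) (rule integrable_pmf_bounded[where B = 1], simp add: pmf_le_1)
    also have "\<dots> \<le> (\<integral>k. (\<Sum>n<m. pmf (walk F n) 0) \<partial>F)"
    proof (rule integral_mono)
      show "integrable F (\<lambda>k. \<Sum>n<m. pmf (walk F n) (t - k))"
        by (rule Bochner_Integration.integrable_sum) (rule integrable_pmf_bounded[where B = 1], simp add: pmf_le_1)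
    qed (auto intro: Suc.IH)
    also have "\<dots> \<le> (\<Sum>n<Suc m. pmf (walk F n) 0)" by simp
    finally show ?thesis .
  qed simp
qed simp

text \<open>A point -m lies at distance at least n \<mu> from the mean of the n-th sum, so the
  large-deviation bound is of order n^(-2). It is summable over \<open>n\<close> and uniform in
  \<open>m\<close>; this is the transience caused by the drift.\<close>

lemma eventually_pmf_walk_le_at_bot:
  "\<exists>C n\<^sub>0. \<forall>n\<ge>n\<^sub>0. \<forall>m. pmf (walk F n) (- int m) \<le> C * real n powr -2"
proof -
  obtain C x\<^sub>0 where C: "C > 0" "x\<^sub>0 > 0"
    "\<And>n t. \<bar>real_of_int t - real n * \<mu>\<bar> \<ge> x\<^sub>0 \<Longrightarrow> real n powr (3/4) \<le> \<bar>real_of_int t - real n * \<mu>\<bar>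
       \<Longrightarrow> pmf (walk F n) t \<le> C * real n / \<bar>real_of_int t - real n * \<mu>\<bar> ^ 3"
    by (rule pmf_walk_large_deviation[of "3/4"]) auto
  have "\<forall>\<^sub>F n in sequentially. real n powr (3/4) \<le> real n * \<mu>" "\<forall>\<^sub>F n in sequentially. x\<^sub>0 \<le> real n * \<mu>"
    using mean_pos by real_asymp+
  then have "\<forall>\<^sub>F n in sequentially. real n powr (3/4) \<le> real n * \<mu> \<and> x\<^sub>0 \<le> real n * \<mu> \<and> n > 0"
    using eventually_gt_at_top[of "0::nat"] by eventually_elim auto
  then obtain n\<^sub>0 where n0: "\<And>n. n \<ge> n\<^sub>0 \<Longrightarrow> real n powr (3/4) \<le> real n * \<mu> \<and> x\<^sub>0 \<le> real n * \<mu> \<and> n > 0"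
    by (auto simp: eventually_at_top_linorder)
  show ?thesis
  proof (intro exI[of _ "C / \<mu> ^ 3"] exI[of _ n\<^sub>0] allI impI)
    fix n m assume "n \<ge> n\<^sub>0"
    note n = n0[OF this]
    have abs: "\<bar>real_of_int (- int m) - real n * \<mu>\<bar> = real m + real n * \<mu>"
    proof -
      have "0 \<le> real m + real n * \<mu>" using mean_pos by simp
      then show ?thesis by simp
    qed
    have "pmf (walk F n) (- int m) \<le> C * real n / (real m + real n * \<mu>) ^ 3"
      using C(3)[of "- int m" n] n unfolding abs by simp
    also have "\<dots> \<le> C * real n / (real n * \<mu>) ^ 3"
      using C n mean_pos by (intro divide_left_mono power_mono mult_pos_pos zero_less_power add_nonneg_pos) auto
    also have "\<dots> = C / \<mu> ^ 3 * real n powr -2"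
    proof -
      have "real n powr -2 = 1 / real n ^ 2" using n by (simp add: powr_minus_divide)
      then show ?thesis using n by (simp add: power2_eq_square power3_eq_cube)
    qed
    finally show "pmf (walk F n) (- int m) \<le> C / \<mu> ^ 3 * real n powr -2" .
  qed
qed

text \<open>The drift gives convergence at 0, and the maximum principle for partial sums carries it
  over to every other point.\<close>

lemma summable_walk: "summable (\<lambda>n. pmf (walk F n) t)"
proof -
  obtain C n\<^sub>0 where C: "\<And>n m. n \<ge> n\<^sub>0 \<Longrightarrow> pmf (walk F n) (- int m) \<le> C * real n powr -2"
    using eventually_pmf_walk_le_at_bot by blast
  have "summable (\<lambda>n. pmf (walk F n) 0)"
  proof (rule summable_comparison_test')
    show "summable (\<lambda>n. C * real n powr -2)" by (intro summable_mult) (simp add: summable_real_powr_iff)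
    show "norm (pmf (walk F n) 0) \<le> C * real n powr -2" if "n \<ge> n\<^sub>0" for n
      using C[OF that, of 0] by simp
  qed
  then have "(\<Sum>n<m. pmf (walk F n) t) \<le> (\<Sum>n. pmf (walk F n) 0)" for m
    by (rule order_trans[OF renewal_partial_sum_le sum_le_suminf]) auto
  then show ?thesis by (intro summableI_nonneg_bounded) auto
qed

lemma renewal_le: "renewal t \<le> renewal 0"
  unfolding renewal_def
  by (rule suminf_le_const[OF summable_walk], rule order_trans[OF renewal_partial_sum_le sum_le_suminf])
    (auto intro: summable_walk)

lemma renewal_nonneg: "renewal t \<ge> 0"
  unfolding renewal_def by (rule suminf_nonneg[OF summable_walk]) simp

lemma renewal_abs_le: "\<bar>renewal t\<bar> \<le> renewal 0"
  using renewal_le[of t] renewal_nonneg[of t] by simp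

lemma integrable_renewal: "integrable F (\<lambda>k. renewal (g k))"
  by (rule integrable_pmf_bounded[OF renewal_abs_le])

lemma renewal_equation: "renewal t = (if t = 0 then 1 else 0) + (\<integral>k. renewal (t - k) \<partial>F)"
proof -
  have "renewal t = pmf (walk F 0) t + (\<Sum>n. pmf (walk F (Suc n)) t)"
    unfolding renewal_def using suminf_split_head[OF summable_walk[of t]] by simp
  also have "(\<Sum>n. pmf (walk F (Suc n)) t) = (\<integral>k. renewal (t - k) \<partial>F)"
    unfolding renewal_def pmf_walk_Suc
  proof (rule integral_suminf[symmetric])
    show "integrable F (\<lambda>k. pmf (walk F n) (t - k))" for n
      by (rule integrable_pmf_bounded[where B = 1]) (simp add: pmf_le_1)
    show "AE k in F. summable (\<lambda>n. norm (pmf (walk F n) (t - k)))"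
      using summable_walk by simp
    show "summable (\<lambda>n. \<integral>k. norm (pmf (walk F n) (t - k)) \<partial>F)"
      using summable_walk[of t] by (subst (asm) summable_Suc_iff[symmetric]) (simp add: pmf_walk_Suc)
  qed
  finally show ?thesis by (simp add: pmf_walk_0)
qed

text \<open>Each term tends to 0 because a mass function vanishes at infinity; the n^(-2) bound,
  uniform in \<open>m\<close>, permits taking the limit under the sum.\<close>

lemma renewal_tendsto_0_at_bot: "(\<lambda>m. renewal (- int m)) \<longlonglongrightarrow> 0"
proof -
  obtain C n\<^sub>0 where C: "\<And>n m. n \<ge> n\<^sub>0 \<Longrightarrow> pmf (walk F n) (- int m) \<le> C * real n powr -2"
    using eventually_pmf_walk_le_at_bot by blast
  have "\<forall>\<^sub>F (n, m) in sequentially \<times>\<^sub>F sequentially. norm (pmf (walk F n) (- int m)) \<le> C * real n powr -2"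
    unfolding eventually_prod_filter
    by (rule exI[of _ "\<lambda>n. n \<ge> n\<^sub>0"], rule exI[of _ "\<lambda>m. True"]) (auto simp: C eventually_ge_at_top)
  moreover have "summable (\<lambda>n. C * real n powr -2)" by (intro summable_mult) (simp add: summable_real_powr_iff)
  ultimately have "(\<lambda>m. \<Sum>n. pmf (walk F n) (- int m)) \<longlonglongrightarrow> (\<Sum>n. 0)"
    using tannerys_theorem[of "\<lambda>n m. pmf (walk F n) (- int m)" "\<lambda>_. 0" sequentially "\<lambda>n. C * real n powr -2"]
      pmf_tendsto_0_at_bot by simp
  then show ?thesis by (simp add: renewal_def)
qed

text \<open>A discrete antiderivative of \<open>renewal\<close>, zero at 0. With the two signed
  sums, the difference of its values at \<open>t\<close> and \<open>t - k\<close> is the sum of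
  \<open>renewal\<close> over (t - k, t] for k >= 0 and minus the sum over (t, t - k] for k < 0, so
  jumps of either sign are handled by one formula.\<close>

definition cum_renewal :: "int \<Rightarrow> real" where
  "cum_renewal t = (\<Sum>j\<in>{0<..t}. renewal j) - (\<Sum>j\<in>{t<..0}. renewal j)"

lemma cum_renewal_diff: "cum_renewal t - cum_renewal (t - 1) = renewal t"
proof (cases "t > 0")
  case True
  then have "{0<..t} = insert t {0<..t - 1}" "{t<..0} = {}" "{t - 1<..0} = {}" by auto
  then show ?thesis by (simp add: cum_renewal_def)
next
  case False
  then have "{t - 1<..0} = insert t {t<..0}" "{0<..t} = {}" "{0<..t - 1} = {}" by auto
  then show ?thesis by (simp add: cum_renewal_def)
qed

lemma cum_renewal_increment_le:
  assumes "\<And>j. s < j \<Longrightarrow> renewal j \<le> e" "s \<le> t"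
  shows "\<bar>cum_renewal t - cum_renewal s\<bar> \<le> e * real_of_int (t - s)"
  using assms(2)
proof (induction t rule: int_ge_induct)
  case (step i)
  have "cum_renewal (i + 1) - cum_renewal s = cum_renewal i - cum_renewal s + renewal (i + 1)" using cum_renewal_diff[of "i + 1"] by simp
  with step.IH renewal_nonneg[of "i + 1"] assms(1)[of "i + 1"] step.hyps show ?case
    by (simp add: algebra_simps abs_le_iff)
qed simp

lemma cum_renewal_increment_le_below:
  assumes "\<And>j. j \<le> t \<Longrightarrow> renewal j \<le> e" "s \<le> t"
  shows "\<bar>cum_renewal t - cum_renewal s\<bar> \<le> e * real_of_int (t - s)"
  using assms(2)
proof (induction s rule: int_le_induct)
  case (step i)
  have "cum_renewal t - cum_renewal (i - 1) = cum_renewal t - cum_renewal i + renewal i" using cum_renewal_diff[of i] by simp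
  with step.IH renewal_nonneg[of i] assms(1)[of i] step.hyps show ?case
    by (simp add: algebra_simps abs_le_iff)
qed simp

text \<open>Dominates the increment across a jump \<open>k\<close> by a multiple of |k|, which is
  integrable because the mean exists.\<close>

lemma cum_renewal_lipschitz: "\<bar>cum_renewal t - cum_renewal s\<bar> \<le> renewal 0 * \<bar>real_of_int t - real_of_int s\<bar>"
proof (cases "s \<le> t")
  case True
  then show ?thesis using cum_renewal_increment_le[of s "renewal 0" t] renewal_le by simp
next
  case False
  then show ?thesis using cum_renewal_increment_le[of t "renewal 0" s] renewal_le by (simp add: abs_minus_commute)
qed

lemma integrable_cum_renewal_diff: "integrable F (\<lambda>k. cum_renewal t - cum_renewal (t - k))"
proof (rule Bochner_Integration.integrable_bound)
  show "integrable F (\<lambda>k. renewal 0 * real_of_int k)" using integrable_id by simp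
  show "AE k in F. norm (cum_renewal t - cum_renewal (t - k)) \<le> norm (renewal 0 * real_of_int k)"
  proof (rule AE_I2)
    fix k show "norm (cum_renewal t - cum_renewal (t - k)) \<le> norm (renewal 0 * real_of_int k)"
      using cum_renewal_lipschitz[of t "t - k"] renewal_nonneg[of 0] by (simp add: abs_mult)
  qed
qed simp

text \<open>The left-hand side jumps by \<open>1\<close> at \<open>t = 0\<close>, is constant elsewhere
  by the renewal equation, and vanishes at \<open>-\<infinity>\<close>.\<close>

lemma expected_cum_renewal_diff:
  assumes "t \<ge> 0"
  shows "(\<integral>k. cum_renewal t - cum_renewal (t - k) \<partial>F) = 1"
proof -
  define G where "G t = (\<integral>k. cum_renewal t - cum_renewal (t - k) \<partial>F)" for t
  have G_diff: "G t - G (t - 1) = (if t = 0 then 1 else 0)" for t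
  proof -
    have "cum_renewal t - cum_renewal (t - k) - (cum_renewal (t - 1) - cum_renewal (t - 1 - k)) = renewal t - renewal (t - k)" for k
      using cum_renewal_diff[of t] cum_renewal_diff[of "t - k"] by (simp add: algebra_simps)
    then have "G t - G (t - 1) = (\<integral>k. renewal t - renewal (t - k) \<partial>F)"
      unfolding G_def by (subst Bochner_Integration.integral_diff[symmetric]) (simp_all only: integrable_cum_renewal_diff)
    also have "\<dots> = renewal t - (\<integral>k. renewal (t - k) \<partial>F)"
      using integrable_renewal[of "\<lambda>k. t - k"] by simp
    also have "\<dots> = (if t = 0 then 1 else 0)" using renewal_equation[of t] by simp
    finally show ?thesis .
  qed
  have const: "G s = G (-1)" if "s \<le> -1" for s
    using that
  proof (induction s rule: int_le_induct)
    case (step i)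
    then show ?case using G_diff[of i] by simp
  qed simp
  have neg: "G (-1) = G (- int (Suc m))" for m by (rule const[symmetric]) simp
  have "(\<lambda>m. G (- int (Suc m))) \<longlonglongrightarrow> (\<integral>k. 0 \<partial>F)"
    unfolding G_def
  proof (rule integral_dominated_convergence)
    show "integrable F (\<lambda>k. renewal 0 * \<bar>real_of_int k\<bar>)" using integrable_id by simp
    show "AE k in F. norm (cum_renewal (- int (Suc m)) - cum_renewal (- int (Suc m) - k)) \<le> renewal 0 * \<bar>real_of_int k\<bar>" for m
    proof (rule AE_I2)
      fix k show "norm (cum_renewal (- int (Suc m)) - cum_renewal (- int (Suc m) - k)) \<le> renewal 0 * \<bar>real_of_int k\<bar>"
        using cum_renewal_lipschitz[of "- int (Suc m)" "- int (Suc m) - k"] by simp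
    qed
    show "AE k in F. (\<lambda>m. cum_renewal (- int (Suc m)) - cum_renewal (- int (Suc m) - k)) \<longlonglongrightarrow> 0"
    proof (rule AE_I2)
      fix k :: int
      show "(\<lambda>m. cum_renewal (- int (Suc m)) - cum_renewal (- int (Suc m) - k)) \<longlonglongrightarrow> 0"
      proof (rule LIMSEQ_I)
        fix \<epsilon> :: real assume "\<epsilon> > 0"
        \<comment> \<open>The increment is a sum of |k| values, each at most \<open>e\<close>; the
          \<open>+ 1\<close> covers k = 0.\<close>
        define e where "e = \<epsilon> / (\<bar>real_of_int k\<bar> + 1)"
        have e: "e > 0" "e * \<bar>real_of_int k\<bar> < \<epsilon>"
          using \<open>\<epsilon> > 0\<close> by (auto simp: e_def field_simps)
        obtain m0 where m0: "\<And>m. m \<ge> m0 \<Longrightarrow> renewal (- int m) < e"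
          using order_tendstoD(2)[OF renewal_tendsto_0_at_bot e(1)] by (auto simp: eventually_at_top_linorder)
        have renewal_e: "renewal j \<le> e" if "j \<le> - int m0" for j
          using m0[of "nat (- j)"] that by (simp add: nat_le_iff le_nat_iff)
        \<comment> \<open>The extra |k| keeps both ends of the summation range below -m0, whatever
          the sign of \<open>k\<close>.\<close>
        have "norm (cum_renewal (- int (Suc m)) - cum_renewal (- int (Suc m) - k) - 0) < \<epsilon>" if "m \<ge> m0 + nat \<bar>k\<bar>" for m
        proof (cases "k \<ge> 0")
          case True
          have "\<bar>cum_renewal (- int (Suc m)) - cum_renewal (- int (Suc m) - k)\<bar> \<le> e * real_of_int (- int (Suc m) - (- int (Suc m) - k))"
            by (rule cum_renewal_increment_le_below, rule renewal_e) (use True that in auto)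
          then show ?thesis using e True by simp
        next
          case False
          have "\<bar>cum_renewal (- int (Suc m) - k) - cum_renewal (- int (Suc m))\<bar> \<le> e * real_of_int ((- int (Suc m) - k) - (- int (Suc m)))"
            by (rule cum_renewal_increment_le_below, rule renewal_e) (use False that in auto)
          then show ?thesis using e False by (simp add: abs_minus_commute)
        qed
        then show "\<exists>no. \<forall>m\<ge>no. norm (cum_renewal (- int (Suc m)) - cum_renewal (- int (Suc m) - k) - 0) < \<epsilon>" by blast
      qed
    qed
  qed auto
  then have "G (-1) = 0" unfolding neg[symmetric] by (simp add: LIMSEQ_const_iff)
  then have "G 0 = 1" using G_diff[of 0] by simp
  have "G t = 1" using assms
  proof (induction t rule: int_ge_induct)
    case (step i)
    then show ?case using G_diff[of "i + 1"] by simp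
  qed (use \<open>G 0 = 1\<close> in simp)
  then show ?thesis by (simp add: G_def)
qed

end

section \<open>The renewal theorem\<close>

lemma pmf_mult_le_integral:
  fixes g :: "'a \<Rightarrow> real"
  assumes "\<And>x. 0 \<le> g x" "\<And>x. g x \<le> B"
  shows "pmf p x * g x \<le> (\<integral>y. g y \<partial>measure_pmf p)"
proof -
  have "pmf p x * g x = (\<integral>y. indicator {x} y * g x \<partial>measure_pmf p)"
    by (simp add: measure_pmf_single)
  also have "\<dots> \<le> (\<integral>y. g y \<partial>measure_pmf p)"
  proof (rule integral_mono)
    show "integrable (measure_pmf p) g" by (rule integrable_pmf_bounded[where B = B]) (use assms in auto)
    show "integrable (measure_pmf p) (\<lambda>y. indicator {x} y * g x)"
      by (rule integrable_pmf_bounded[where B = "g x"]) (use assms in \<open>auto simp: indicator_def\<close>)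
  qed (use assms in \<open>auto simp: indicator_def\<close>)
  finally show ?thesis .
qed

lemma filterlim_diff_const_at_top_int:
  fixes T :: "'b \<Rightarrow> int"
  assumes "filterlim T at_top G"
  shows "filterlim (\<lambda>n. T n - i) at_top G"
  unfolding filterlim_at_top
proof
  fix Z
  from assms have "\<forall>\<^sub>F n in G. Z + i \<le> T n" by (simp add: filterlim_at_top)
  then show "\<forall>\<^sub>F n in G. Z \<le> T n - i" by eventually_elim simp
qed

context heavy_tailed_walk
begin

text \<open>If \<open>s * renewal\<close> is close to its upper limit at \<open>T n\<close>, then so it is at \<open>T n - j\<close>,
  because \<open>renewal (T n)\<close> is an average of the values \<open>renewal (T n - k)\<close>, in which \<open>k = j\<close>
  has positive weight.\<close>

lemma renewal_shift_tendsto: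
  assumes T: "filterlim T at_top sequentially" and lim: "(\<lambda>n. s * renewal (T n)) \<longlonglongrightarrow> l"
    and upper: "\<And>e. e > 0 \<Longrightarrow> \<forall>\<^sub>F t in at_top. s * renewal t \<le> l + e"
    and j: "pmf F j > 0"
  shows "(\<lambda>n. s * renewal (T n - j)) \<longlonglongrightarrow> l"
proof -
  \<comment> \<open>\<open>P\<close> and \<open>D\<close> are the positive and negative parts of
    \<open>s * renewal t - l\<close>. The upper bound makes \<open>P\<close> vanish in the limit;
    the renewal equation then makes the average of \<open>D\<close> around \<open>T n\<close>
    vanish, and the atom at \<open>j\<close> carries a fixed share of that average.\<close>
  define P where "P t = max 0 (s * renewal t - l)" for t
  define D where "D t = P t - (s * renewal t - l)" for t
  define B where "B = \<bar>s\<bar> * renewal 0 + \<bar>l\<bar>"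
  have sU: "\<bar>s * renewal t - l\<bar> \<le> B" for t
  proof -
    have "\<bar>s * renewal t\<bar> \<le> \<bar>s\<bar> * renewal 0" unfolding abs_mult by (rule mult_left_mono[OF renewal_abs_le]) simp
    then show ?thesis by (simp add: B_def)
  qed
  have P: "0 \<le> P t" "\<bar>P t\<bar> \<le> B" for t using sU[of t] by (auto simp: P_def)
  have D: "0 \<le> D t" "D t \<le> B" for t using sU[of t] by (auto simp: P_def D_def max_def)
  have Plim: "(P \<longlongrightarrow> 0) at_top"
  proof (rule tendstoI)
    fix e :: real assume "e > 0"
    then have "\<forall>\<^sub>F t in at_top. s * renewal t \<le> l + e / 2" by (intro upper) simp
    then show "\<forall>\<^sub>F t in at_top. dist (P t) 0 < e"
      by eventually_elim (use \<open>e > 0\<close> in \<open>auto simp: P_def\<close>)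
  qed
  have Tk: "filterlim (\<lambda>n. T n - k) at_top sequentially" for k
    by (rule filterlim_diff_const_at_top_int[OF T])
  have P0: "(\<lambda>n. P (T n - k)) \<longlonglongrightarrow> 0" for k
    using Plim Tk by (rule filterlim_compose)
  have PI: "(\<lambda>n. \<integral>k. P (T n - k) \<partial>F) \<longlonglongrightarrow> 0"
    using tendsto_integral_pmf_bounded[of "\<lambda>n k. P (T n - k)" "\<lambda>_. 0" B F] P0 P(2) by simp
  have DI: "(\<lambda>n. \<integral>k. D (T n - k) \<partial>F) \<longlonglongrightarrow> 0"
  proof (rule Lim_transform_eventually)
    show "(\<lambda>n. (\<integral>k. P (T n - k) \<partial>F) - (s * renewal (T n) - l)) \<longlonglongrightarrow> 0"
      using tendsto_diff[OF PI tendsto_diff[OF lim tendsto_const[of l]]] by simp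
    have "\<forall>\<^sub>F n in sequentially. 1 \<le> T n" using T by (simp add: filterlim_at_top)
    then show "\<forall>\<^sub>F n in sequentially. (\<integral>k. P (T n - k) \<partial>F) - (s * renewal (T n) - l) = (\<integral>k. D (T n - k) \<partial>F)"
    proof eventually_elim
      case (elim n)
      have "renewal (T n) = (\<integral>k. renewal (T n - k) \<partial>F)" using renewal_equation[of "T n"] elim by simp
      then show ?case unfolding D_def
        using integrable_renewal[of "\<lambda>k. T n - k"] integrable_pmf_bounded[of "\<lambda>k. P (T n - k)" B F] P(2) by simp
    qed
  qed
  have "(\<lambda>n. D (T n - j)) \<longlonglongrightarrow> 0"
  proof (rule tendsto_sandwich[where f = "\<lambda>_. 0" and h = "\<lambda>n. (\<integral>k. D (T n - k) \<partial>F) / pmf F j"])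
    show "\<forall>\<^sub>F n in sequentially. D (T n - j) \<le> (\<integral>k. D (T n - k) \<partial>F) / pmf F j"
      using pmf_mult_le_integral[of "\<lambda>k. D (T _ - k)" B F j] D j by (simp add: field_simps)
    show "(\<lambda>n. (\<integral>k. D (T n - k) \<partial>F) / pmf F j) \<longlonglongrightarrow> 0"
      using tendsto_divide[OF DI tendsto_const[of "pmf F j"]] j by simp
  qed (use D in auto)
  from tendsto_diff[OF P0[of j] this] have "(\<lambda>n. s * renewal (T n - j) - l) \<longlonglongrightarrow> 0"
    by (simp add: D_def)
  then show ?thesis by (simp add: LIM_zero_iff)
qed

text \<open>If \<open>renewal\<close> is nearly \<open>l\<close> at all points far enough to the
  left of \<open>T n\<close> within a bounded range, then the sum across a jump \<open>k\<close> is
  nearly l k. Its expectation is exactly 1 by \<open>expected_cum_renewal_diff\<close>, whence l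
  \<mu> = 1. Convergence holds for each jump separately, so jumps beyond \<open>K\<close> are cut
  off and estimated by the tail of the first absolute moment, and \<open>K\<close> tends to infinity
  afterwards.\<close>

lemma renewal_limit_value:
  assumes T: "filterlim T at_top sequentially" and shift: "\<And>j. j \<ge> j\<^sub>0 \<Longrightarrow> (\<lambda>n. renewal (T n - j)) \<longlonglongrightarrow> l"
  shows "l = 1 / \<mu>"
proof -
  define B where "B = renewal 0 + \<bar>l\<bar>"
  have incr: "(\<lambda>n. cum_renewal (T n - j\<^sub>0) - cum_renewal (T n - j\<^sub>0 - int m)) \<longlonglongrightarrow> l * real m" for m
  proof (induction m)
    case (Suc m)
    have "cum_renewal (T n - j\<^sub>0) - cum_renewal (T n - j\<^sub>0 - int (Suc m)) = cum_renewal (T n - j\<^sub>0) - cum_renewal (T n - j\<^sub>0 - int m) + renewal (T n - (j\<^sub>0 + int m))" for n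
      using cum_renewal_diff[of "T n - j\<^sub>0 - int m"] by (simp add: algebra_simps)
    then show ?case
      using tendsto_add[OF Suc.IH shift[of "j\<^sub>0 + int m"]] by (simp add: algebra_simps)
  qed simp
  have bound: "\<bar>1 - l * \<mu>\<bar> \<le> B * (\<integral>k. \<bar>real_of_int k\<bar> * indicator {k. \<bar>k\<bar> > int K} k \<partial>F)" for K
  proof -
    \<comment> \<open>The offset \<open>K\<close> leaves space for negative jumps:
      \<open>t n - k\<close> stays at or below \<open>T n - j\<^sub>0\<close> for all |k| <= K,
      where \<open>shift\<close> is available.\<close>
    define t where "t n = T n - j\<^sub>0 - int K" for n
    have d: "(\<lambda>n. cum_renewal (t n) - cum_renewal (t n - k)) \<longlonglongrightarrow> l * real_of_int k" if k: "\<bar>k\<bar> \<le> int K" for k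
    proof -
      have "0 \<le> k + int K" using k by simp
      \<comment> \<open>Both increments start at \<open>T n - j\<^sub>0\<close>; their difference is
        the increment between \<open>t n - k\<close> and \<open>t n\<close>.\<close>
      then show ?thesis using tendsto_diff[OF incr[of "nat (int K + k)"] incr[of K]]
        by (simp add: t_def algebra_simps)
    qed
    define g where "g n k = (cum_renewal (t n) - cum_renewal (t n - k) - l * real_of_int k)" for n k
    have gB: "\<bar>g n k\<bar> \<le> B * \<bar>real_of_int k\<bar>" for n k
      using cum_renewal_lipschitz[of "t n" "t n - k"] by (simp add: g_def B_def distrib_right abs_mult[symmetric] abs_le_iff) (smt (verit) abs_ge_self abs_ge_minus_self)
    have intg: "integrable F (g n)" for n
      unfolding g_def using integrable_cum_renewal_diff integrable_id by auto
    have intgi: "integrable F (\<lambda>k. g n k * indicator S k)" for n S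
      by (rule Bochner_Integration.integrable_bound[OF intg[of n]]) (auto simp: indicator_def)
    have intki: "integrable F (\<lambda>k. \<bar>real_of_int k\<bar> * indicator S k)" for S
      by (rule Bochner_Integration.integrable_bound[OF integrable_id]) (auto simp: indicator_def)
    have small: "(\<lambda>n. \<integral>k. g n k * indicator {k. \<bar>k\<bar> \<le> int K} k \<partial>F) \<longlonglongrightarrow> (\<integral>k. 0 \<partial>F)"
    proof (rule tendsto_integral_pmf_bounded[where B = "B * real K"])
      fix k show "(\<lambda>n. g n k * indicator {k. \<bar>k\<bar> \<le> int K} k) \<longlonglongrightarrow> 0"
        using tendsto_diff[OF d[of k] tendsto_const[of "l * real_of_int k"]]
        by (cases "\<bar>k\<bar> \<le> int K") (auto simp: g_def)
      fix n
      have "\<bar>k\<bar> \<le> int K \<Longrightarrow> \<bar>g n k\<bar> \<le> B * real K"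
        by (rule order_trans[OF gB], rule mult_left_mono) (use renewal_nonneg[of 0] in \<open>auto simp: B_def\<close>)
      then show "\<bar>g n k * indicator {k. \<bar>k\<bar> \<le> int K} k\<bar> \<le> B * real K"
        using renewal_nonneg[of 0] by (auto simp: indicator_def B_def)
    qed
    define R where "R = B * (\<integral>k. \<bar>real_of_int k\<bar> * indicator {k. \<bar>k\<bar> > int K} k \<partial>F)"
    have big: "\<bar>\<integral>k. g n k * indicator {k. \<bar>k\<bar> > int K} k \<partial>F\<bar> \<le> R" for n
    proof -
      have "\<bar>\<integral>k. g n k * indicator {k. \<bar>k\<bar> > int K} k \<partial>F\<bar> \<le> (\<integral>k. \<bar>g n k * indicator {k. \<bar>k\<bar> > int K} k\<bar> \<partial>F)"
        by (rule integral_abs_bound)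
      also have "\<dots> \<le> (\<integral>k. B * (\<bar>real_of_int k\<bar> * indicator {k. \<bar>k\<bar> > int K} k) \<partial>F)"
      proof (rule integral_mono)
        show "integrable F (\<lambda>k. \<bar>g n k * indicator {k. \<bar>k\<bar> > int K} k\<bar>)"
          by (rule integrable_abs[OF intgi])
        show "integrable F (\<lambda>k. B * (\<bar>real_of_int k\<bar> * indicator {k. \<bar>k\<bar> > int K} k))"
          by (rule integrable_mult_right[OF intki])
      qed (use gB in \<open>auto simp: indicator_def\<close>)
      also have "\<dots> = R" by (simp add: R_def)
      finally show ?thesis .
    qed
    have tpos: "\<forall>\<^sub>F n in sequentially. 0 \<le> t n"
    proof -
      have "\<forall>\<^sub>F n in sequentially. j\<^sub>0 + int K \<le> T n" using T by (simp add: filterlim_at_top)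
      then show ?thesis by (simp add: t_def algebra_simps)
    qed
    have split: "(\<integral>k. g n k * indicator {k. \<bar>k\<bar> \<le> int K} k \<partial>F) + (\<integral>k. g n k * indicator {k. \<bar>k\<bar> > int K} k \<partial>F) = 1 - l * \<mu>"
      if "0 \<le> t n" for n
    proof -
      have "(\<integral>k. g n k * indicator {k. \<bar>k\<bar> \<le> int K} k \<partial>F) + (\<integral>k. g n k * indicator {k. \<bar>k\<bar> > int K} k \<partial>F) = (\<integral>k. g n k \<partial>F)"
        by (subst Bochner_Integration.integral_add[OF intgi intgi, symmetric],
            rule Bochner_Integration.integral_cong) (auto simp: indicator_def)
      also have "\<dots> = 1 - l * \<mu>"
        unfolding g_def using integrable_cum_renewal_diff integrable_id expected_cum_renewal_diff[OF that] by (simp add: mean)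
      finally show ?thesis .
    qed
    have "\<bar>1 - l * \<mu>\<bar> \<le> 0 + R"
    proof (rule tendsto_le[OF sequentially_bot])
      show "(\<lambda>n. \<bar>\<integral>k. g n k * indicator {k. \<bar>k\<bar> \<le> int K} k \<partial>F\<bar> + R) \<longlonglongrightarrow> 0 + R"
        using tendsto_rabs[OF small] by (intro tendsto_intros) simp
      show "\<forall>\<^sub>F n in sequentially. \<bar>1 - l * \<mu>\<bar> \<le> \<bar>\<integral>k. g n k * indicator {k. \<bar>k\<bar> \<le> int K} k \<partial>F\<bar> + R"
        using tpos
      proof eventually_elim
        case (elim n)
        then show ?case using split[of n] big[of n] by linarith
      qed
    qed (rule tendsto_const)
    then show ?thesis by (simp add: R_def)
  qed
  have "(\<lambda>K. \<integral>k. \<bar>real_of_int k\<bar> * indicator {k. \<bar>k\<bar> > int K} k \<partial>F) \<longlonglongrightarrow> (\<integral>k. 0 \<partial>F)"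
  proof (rule integral_dominated_convergence)
    show "integrable F (\<lambda>k. \<bar>real_of_int k\<bar>)" using integrable_id by simp
    show "AE k in F. (\<lambda>K. \<bar>real_of_int k\<bar> * indicator {k. \<bar>k\<bar> > int K} k) \<longlonglongrightarrow> 0"
    proof (rule AE_I2, rule tendsto_eventually)
      fix k :: int
      show "\<forall>\<^sub>F K in sequentially. \<bar>real_of_int k\<bar> * indicator {k. \<bar>k\<bar> > int K} k = 0"
        using eventually_ge_at_top[of "nat \<bar>k\<bar>"] by eventually_elim (auto simp: indicator_def)
    qed
  qed (auto simp: indicator_def)
  then have "(\<lambda>K. B * (\<integral>k. \<bar>real_of_int k\<bar> * indicator {k. \<bar>k\<bar> > int K} k \<partial>F)) \<longlonglongrightarrow> B * 0"
    by (intro tendsto_intros) simp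
  then have "\<bar>1 - l * \<mu>\<bar> \<le> B * 0"
    by (rule tendsto_lowerbound) (use bound in auto)
  then show ?thesis using mean_pos by (simp add: field_simps)
qed

lemma eventually_pmf_pos: "\<exists>j\<^sub>0. \<forall>j\<ge>j\<^sub>0. pmf F j > 0"
proof -
  have "\<forall>\<^sub>F t in sequentially. real t ^ 3 * pmf F (int t) > 0"
    using order_tendstoD(1)[OF tail_limit a_pos] .
  then obtain t\<^sub>0 where t0: "\<And>t. t \<ge> t\<^sub>0 \<Longrightarrow> real t ^ 3 * pmf F (int t) > 0"
    by (auto simp: eventually_at_top_linorder)
  have "pmf F j > 0" if "j \<ge> int t\<^sub>0" for j
  proof -
    have "real (nat j) ^ 3 * pmf F j > 0"
      using t0[of "nat j"] that by (simp add: le_nat_iff)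
    then show ?thesis by (simp add: zero_less_mult_iff)
  qed
  then show ?thesis by blast
qed

text \<open>The sign \<open>s\<close> serves both halves of the limit: s = 1 bounds the upper limit,
  s = -1 the lower one. Along a subsequence attaining the upper limit \<open>l\<close> of
  \<open>s * renewal\<close>, all shifts by large \<open>j\<close> have the same limit because such
  jumps have positive mass, and \<open>renewal_limit_value\<close> then determines
  \<open>l\<close>.\<close>

lemma limsup_renewal:
  assumes s: "\<bar>s\<bar> = 1" and e: "e > 0"
  shows "\<forall>\<^sub>F t in sequentially. s * renewal (int t) \<le> s / \<mu> + e"
proof -
  define X where "X t = ereal (s * renewal (int t))" for t :: nat
  have XB: "\<bar>s * renewal t\<bar> \<le> renewal 0" for t using s renewal_abs_le[of t] by (simp add: abs_mult)
  have X: "ereal (- renewal 0) \<le> X t" "X t \<le> ereal (renewal 0)" for t using XB[of "int t"] by (auto simp: X_def)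
  have "limsup X \<le> ereal (renewal 0)" by (rule Limsup_bounded) (simp add: X)
  moreover have "ereal (- renewal 0) \<le> liminf X" by (rule Liminf_bounded) (simp add: X)
  then have "ereal (- renewal 0) \<le> limsup X" using Liminf_le_Limsup[of sequentially X] by simp
  ultimately obtain l where l: "limsup X = ereal l" by (cases "limsup X") auto
  obtain r where r: "strict_mono r" "(X \<circ> r) \<longlonglongrightarrow> limsup X" using limsup_subseq_lim by blast
  define T where "T n = int (r n)" for n
  have T: "filterlim T at_top sequentially" unfolding T_def
    using filterlim_compose[OF filterlim_int_sequentially filterlim_subseq[OF r(1)]] .
  have lim: "(\<lambda>n. s * renewal (T n)) \<longlonglongrightarrow> l"
    using r(2) by (simp add: l X_def T_def comp_def)
  have up: "\<forall>\<^sub>F t in sequentially. s * renewal (int t) \<le> l + e" if "e > 0" for e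
  proof -
    have "limsup X < ereal (l + e)" using that by (simp add: l)
    then have "\<forall>\<^sub>F t in sequentially. X t < ereal (l + e)" by (rule Limsup_lessD)
    then show ?thesis by eventually_elim (simp add: X_def)
  qed
  have up': "\<forall>\<^sub>F t in at_top. s * renewal t \<le> l + e" if "e > 0" for e
  proof -
    from up[OF that] obtain t\<^sub>0 where "\<And>t. t \<ge> t\<^sub>0 \<Longrightarrow> s * renewal (int t) \<le> l + e"
      by (auto simp: eventually_at_top_linorder)
    then have "s * renewal t \<le> l + e" if "t \<ge> int t\<^sub>0" for t
      using that by (metis int_nat_eq le_nat_iff of_nat_0_le_iff order_trans)
    then show ?thesis by (auto simp: eventually_at_top_linorder)
  qed
  obtain j\<^sub>0 where j0: "\<And>j. j \<ge> j\<^sub>0 \<Longrightarrow> pmf F j > 0" using eventually_pmf_pos by blast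
  have ss: "s * s = 1" using s by (metis abs_mult_self_eq mult_1)
  have "(\<lambda>n. renewal (T n - j)) \<longlonglongrightarrow> s * l" if "j \<ge> j\<^sub>0" for j
    using tendsto_mult_left[OF renewal_shift_tendsto[OF T lim up' j0[OF that]], of s]
    by (simp add: mult.assoc[symmetric] ss)
  then have "s * l = 1 / \<mu>" by (rule renewal_limit_value[OF T])
  then have "l = s / \<mu>" using ss by (metis mult.assoc mult_1 times_divide_eq_right mult.right_neutral)
  then show ?thesis using up[OF e] by simp
qed

theorem renewal_theorem: "(\<lambda>t. renewal (int t)) \<longlonglongrightarrow> 1 / \<mu>"
proof (rule tendstoI)
  fix e :: real assume "e > 0"
  have "\<forall>\<^sub>F t in sequentially. 1 * renewal (int t) \<le> 1 / \<mu> + e / 2"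
    "\<forall>\<^sub>F t in sequentially. -1 * renewal (int t) \<le> -1 / \<mu> + e / 2"
    using \<open>e > 0\<close> by (intro limsup_renewal; simp)+
  then show "\<forall>\<^sub>F t in sequentially. dist (renewal (int t)) (1 / \<mu>) < e"
    by eventually_elim (use \<open>e > 0\<close> in \<open>simp add: dist_real_def\<close>)
qed

end

section \<open>Splitting series and summing inverse cubes\<close>

lemma suminf_split_finite:
  fixes g :: "nat \<Rightarrow> real"
  assumes "summable g" "finite S"
  shows "suminf g = sum g S + (\<Sum>n. if n \<in> S then 0 else g n)"
proof -
  have "(\<lambda>n. if n \<in> S then g n else 0) sums sum g S"
    by (rule sums_If_finite_set[OF assms(2)])
  then have "(\<lambda>n. g n - (if n \<in> S then g n else 0)) sums (suminf g - sum g S)"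
    using assms(1) by (intro sums_diff summable_sums)
  also have "(\<lambda>n. g n - (if n \<in> S then g n else 0)) = (\<lambda>n. if n \<in> S then 0 else g n)" by auto
  finally show ?thesis by (simp add: sums_iff)
qed

lemma summable_zero_on:
  fixes g :: "nat \<Rightarrow> real"
  assumes "summable g" "\<And>n. g n \<ge> 0"
  shows "summable (\<lambda>n. if n \<in> S then 0 else g n)"
  by (rule summable_comparison_test'[OF assms(1)]) (use assms(2) in auto)

text \<open>Telescoping: as z >= y and z >= \<mu>, the cube z^3 is at least y z (z + \<mu>) / 2, and
  1 / (z (z + \<mu>)) is a difference of consecutive reciprocals divided by \<mu>.\<close>

lemma sum_inverse_cube_arithmetic_le:
  fixes y \<mu> :: real
  assumes "\<mu> > 0" "y \<ge> \<mu>"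
  shows "(\<Sum>j<m. 1 / (y + real j * \<mu>) ^ 3) \<le> 2 / (\<mu> * y\<^sup>2)"
proof -
  have "(\<Sum>j<m. 1 / (y + real j * \<mu>) ^ 3) \<le> 2 / (y * \<mu>) * (1 / y - 1 / (y + real m * \<mu>))"
  proof (induction m)
    case (Suc m)
    define z where "z = y + real m * \<mu>"
    have z: "z \<ge> y" "z > 0" "z \<ge> \<mu>" using assms by (auto simp: z_def add_pos_nonneg intro: order_trans[of _ y])
    have "1 / z ^ 3 \<le> 2 / (y * (z * (z + \<mu>)))"
    proof -
      have "y * (z * (z + \<mu>)) \<le> z * (z * (2 * z))"
        using z assms by (intro mult_mono) auto
      then have "2 / (z * (z * (2 * z))) \<le> 2 / (y * (z * (z + \<mu>)))"
        using z assms by (intro divide_left_mono mult_pos_pos) auto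
      then show ?thesis by (simp add: power3_eq_cube mult_ac)
    qed
    also have "\<dots> = 2 / (y * \<mu>) * (1 / z - 1 / (z + \<mu>))"
      using z assms by (simp add: field_simps)
    finally have "1 / z ^ 3 \<le> 2 / (y * \<mu>) * (1 / z - 1 / (z + \<mu>))" .
    then show ?case using Suc.IH by (simp add: z_def algebra_simps)
  qed (use assms in simp)
  also have "\<dots> \<le> 2 / (y * \<mu>) * (1 / y)"
    using assms by (intro mult_left_mono) auto
  finally show ?thesis by (simp add: power2_eq_square mult_ac)
qed

text \<open>On either side of \<open>t\<close> the points n \<mu> have spacing \<mu>, so counting
  indices from the point of \<open>S\<close> nearest to \<open>t\<close> on that side
  (\<open>Max A1\<close>, \<open>Min A2\<close>) reduces each half to the arithmetic progression
  starting at \<open>y\<close>.\<close>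

lemma sum_inverse_cube_far_le:
  fixes y \<mu> t :: real and S :: "nat set"
  assumes \<mu>: "\<mu> > 0" and y: "y \<ge> \<mu>" and S: "finite S" "\<And>n. n \<in> S \<Longrightarrow> \<bar>t - real n * \<mu>\<bar> \<ge> y"
  shows "(\<Sum>n\<in>S. 1 / \<bar>t - real n * \<mu>\<bar> ^ 3) \<le> 4 / (\<mu> * y\<^sup>2)"
proof -
  have *: "(\<Sum>n\<in>A. 1 / \<bar>t - real n * \<mu>\<bar> ^ 3) \<le> 2 / (\<mu> * y\<^sup>2)"
    if A: "finite A" "inj_on h A" "\<And>n. n \<in> A \<Longrightarrow> \<bar>t - real n * \<mu>\<bar> \<ge> y + real (h n) * \<mu>" for A and h :: "nat \<Rightarrow> nat"
  proof -
    obtain m where m: "h ` A \<subseteq> {..<m}" using finite_nat_iff_bounded A(1) by blast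
    have "(\<Sum>n\<in>A. 1 / \<bar>t - real n * \<mu>\<bar> ^ 3) \<le> (\<Sum>n\<in>A. 1 / (y + real (h n) * \<mu>) ^ 3)"
    proof (rule sum_mono)
      fix n assume "n \<in> A"
      have "0 < y + real (h n) * \<mu>" using \<mu> y by (intro add_pos_nonneg) auto
      then show "1 / \<bar>t - real n * \<mu>\<bar> ^ 3 \<le> 1 / (y + real (h n) * \<mu>) ^ 3"
        using A(3)[OF \<open>n \<in> A\<close>] by (intro frac_le power_mono) auto
    qed
    also have "\<dots> = (\<Sum>j\<in>h ` A. 1 / (y + real j * \<mu>) ^ 3)"
      using A(2) by (simp add: sum.reindex)
    also have "\<dots> \<le> (\<Sum>j<m. 1 / (y + real j * \<mu>) ^ 3)"
      using m \<mu> y by (intro sum_mono2) auto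
    also have "\<dots> \<le> 2 / (\<mu> * y\<^sup>2)" by (rule sum_inverse_cube_arithmetic_le[OF \<mu> y])
    finally show ?thesis .
  qed
  define A1 where "A1 = {n\<in>S. real n * \<mu> \<le> t}"
  define A2 where "A2 = {n\<in>S. \<not> real n * \<mu> \<le> t}"
  have fin: "finite A1" "finite A2" using S by (auto simp: A1_def A2_def)
  have "(\<Sum>n\<in>A1. 1 / \<bar>t - real n * \<mu>\<bar> ^ 3) \<le> 2 / (\<mu> * y\<^sup>2)"
  proof (rule *[OF fin(1), of "\<lambda>n. Max A1 - n"])
    show "inj_on (\<lambda>n. Max A1 - n) A1"
      by (rule inj_onI) (metis Max_ge fin(1) diff_diff_cancel)
    fix n assume n: "n \<in> A1"
    then have M: "Max A1 \<in> A1" "n \<le> Max A1" using fin(1) by (auto intro: Max_in)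
    then have "y \<le> t - real (Max A1) * \<mu>" using S(2)[of "Max A1"] by (auto simp: A1_def)
    then show "y + real (Max A1 - n) * \<mu> \<le> \<bar>t - real n * \<mu>\<bar>"
      using n M by (simp add: A1_def of_nat_diff algebra_simps)
  qed
  moreover have "(\<Sum>n\<in>A2. 1 / \<bar>t - real n * \<mu>\<bar> ^ 3) \<le> 2 / (\<mu> * y\<^sup>2)"
  proof (rule *[OF fin(2), of "\<lambda>n. n - Min A2"])
    show "inj_on (\<lambda>n. n - Min A2) A2"
      by (rule inj_onI) (metis Min_le fin(2) eq_diff_iff)
    fix n assume n: "n \<in> A2"
    then have M: "Min A2 \<in> A2" "Min A2 \<le> n" using fin(2) by (auto intro: Min_in)
    then have "y \<le> real (Min A2) * \<mu> - t" using S(2)[of "Min A2"] by (auto simp: A2_def)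
    then show "y + real (n - Min A2) * \<mu> \<le> \<bar>t - real n * \<mu>\<bar>"
      using n M by (simp add: A2_def of_nat_diff algebra_simps)
  qed
  moreover have "S = A1 \<union> A2" "A1 \<inter> A2 = {}" by (auto simp: A1_def A2_def)
  ultimately show ?thesis using fin by (simp add: sum.union_disjoint)
qed

section \<open>One big jump: tail asymptotics for a fixed number of summands\<close>

lemma tendsto_cube_shift:
  fixes q :: "int \<Rightarrow> real"
  assumes "(\<lambda>t. real t ^ 3 * q (int t)) \<longlonglongrightarrow> c"
  shows "(\<lambda>t. real t ^ 3 * q (int t - k)) \<longlonglongrightarrow> c"
proof -
  have lim: "filterlim (\<lambda>t. nat (int t - k)) at_top sequentially"
    unfolding filterlim_at_top
  proof
    fix Z
    show "\<forall>\<^sub>F t in sequentially. Z \<le> nat (int t - k)"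
      using eventually_ge_at_top[of "nat (int Z + \<bar>k\<bar>)"] by eventually_elim linarith
  qed
  have "((\<lambda>t. real t ^ 3 / (real t - real_of_int k) ^ 3 * (real (nat (int t - k)) ^ 3 * q (int (nat (int t - k))))) \<longlongrightarrow> 1 * c) sequentially"
  proof (rule tendsto_mult)
    show "(\<lambda>t. real t ^ 3 / (real t - real_of_int k) ^ 3) \<longlonglongrightarrow> 1" by real_asymp
    show "(\<lambda>t. real (nat (int t - k)) ^ 3 * q (int (nat (int t - k)))) \<longlonglongrightarrow> c"
      using filterlim_compose[OF assms lim] .
  qed
  moreover have "\<forall>\<^sub>F t in sequentially. real t ^ 3 / (real t - real_of_int k) ^ 3 * (real (nat (int t - k)) ^ 3 * q (int (nat (int t - k))))
      = real t ^ 3 * q (int t - k)"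
    using eventually_gt_at_top[of "nat \<bar>k\<bar>"]
  proof eventually_elim
    case (elim t)
    then have "int t - k > 0" by linarith
    then have "real (nat (int t - k)) = real t - real_of_int k" "int (nat (int t - k)) = int t - k" "real t - real_of_int k > 0"
      by (auto simp: of_nat_nat)
    then show ?case by simp
  qed
  ultimately show ?thesis by (auto dest: Lim_transform_eventually)
qed

text \<open>Dominated convergence over \<open>k\<close>: for 2 k <= t the argument t - k is at least
  t / 2, so t^3 q(t - k) is at most 8 times the bound of the given sequence. The boundary point 2 k
  = t is left free in \<open>A\<close>, so that two complementary half convolutions can be treated
  without counting it twice.\<close>

lemma half_convolution_tendsto:
  fixes q :: "int \<Rightarrow> real" and A :: "nat \<Rightarrow> int set"
  assumes q: "\<And>k. q k \<ge> 0" and lim: "(\<lambda>t. real t ^ 3 * q (int t)) \<longlonglongrightarrow> c"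
    and A: "\<And>t. {k. 2 * k < int t} \<subseteq> A t" "\<And>t. A t \<subseteq> {k. 2 * k \<le> int t}"
  shows "(\<lambda>t. real t ^ 3 * (\<integral>k. indicator (A t) k * q (int t - k) \<partial>measure_pmf W)) \<longlonglongrightarrow> c"
proof -
  have "Bseq (\<lambda>t. real t ^ 3 * q (int t))" using lim by (intro convergent_imp_Bseq convergentI)
  then obtain C where "\<And>t. norm (real t ^ 3 * q (int t)) \<le> C" by (auto simp: Bseq_def)
  then have C: "real t ^ 3 * q (int t) \<le> C" for t using abs_le_D1[of "real t ^ 3 * q (int t)" C] by simp
  have C0: "C \<ge> 0" using C[of 0] by simp
  have "(\<lambda>t. \<integral>k. real t ^ 3 * (indicator (A t) k * q (int t - k)) \<partial>measure_pmf W) \<longlonglongrightarrow> (\<integral>k. c \<partial>measure_pmf W)"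
  proof (rule tendsto_integral_pmf_bounded[where B = "8 * C"])
    fix k
    show "(\<lambda>t. real t ^ 3 * (indicator (A t) k * q (int t - k))) \<longlonglongrightarrow> c"
    proof (rule Lim_transform_eventually[OF tendsto_cube_shift[OF lim, of k]])
      show "\<forall>\<^sub>F t in sequentially. real t ^ 3 * q (int t - k) = real t ^ 3 * (indicator (A t) k * q (int t - k))"
        using eventually_gt_at_top[of "nat (2 * \<bar>k\<bar>)"]
      proof eventually_elim
        case (elim t)
        then have "k \<in> A t" using A(1)[of t] by force
        then show ?case by simp
      qed
    qed
    fix t
    show "\<bar>real t ^ 3 * (indicator (A t) k * q (int t - k))\<bar> \<le> 8 * C"
    proof (cases "k \<in> A t")
      case True
      then have k: "2 * k \<le> int t" using A(2) by auto
      then have nn: "int t - k \<ge> 0" by simp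
      have "real t \<le> 2 * real_of_int (int t - k)" using k by simp
      then have "real t ^ 3 \<le> (2 * real_of_int (int t - k)) ^ 3" by (intro power_mono) auto
      then have "real t ^ 3 * q (int t - k) \<le> 8 * (real_of_int (int t - k) ^ 3 * q (int t - k))"
        using mult_right_mono[of "real t ^ 3" "8 * real_of_int (int t - k) ^ 3" "q (int t - k)"] q[of "int t - k"]
        by (simp only: power_mult_distrib mult.assoc) simp
      also have "\<dots> \<le> 8 * C" using C[of "nat (int t - k)"] nn by simp
      finally show ?thesis using True q[of "int t - k"] by (simp add: abs_mult)
    qed (use C0 in simp)
  qed
  then show ?thesis by simp
qed

text \<open>Interpolates between \<open>n\<^sup>2\<close> and \<open>t\<^sup>3 / n\<close> so as to be summable in \<open>n\<close> and small in \<open>t\<close>.\<close>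

lemma ratio_max_cube_le:
  assumes "t > 0"
  shows "real n / max (real t) (real n) ^ 3 \<le> real t powr (-1/2) * real n powr (-3/2)"
proof (cases "n = 0")
  case False
  define m where "m = max (real t) (real n)"
  have m: "m > 0" using assms by (auto simp: m_def)
  \<comment> \<open>The exponents 1/2 and 5/2 add up to the cube; dividing \<open>n\<close> by this
    product leaves the summable power n^(-3/2) and a decaying power of \<open>t\<close>.\<close>
  have "real t powr (1/2) * real n powr (5/2) \<le> m powr (1/2) * m powr (5/2)"
    by (intro mult_mono powr_mono2) (auto simp: m_def)
  also have "\<dots> = m ^ 3" using m by (simp add: powr_add[symmetric])
  finally have "real n / m ^ 3 \<le> real n / (real t powr (1/2) * real n powr (5/2))"
    using False assms m by (intro divide_left_mono) auto
  also have "\<dots> = real t powr (-1/2) * real n powr (-3/2)"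
  proof -
    have "real n powr (5/2) = real n * real n powr (3/2)"
      using False by (subst powr_mult_base) auto
    moreover have "real t powr (-1/2) = 1 / real t powr (1/2)" "real n powr (-3/2) = 1 / real n powr (3/2)"
      using powr_minus_divide[of "real t" "1/2"] powr_minus_divide[of "real n" "3/2"] by simp_all
    ultimately show ?thesis using False by simp
  qed
  finally show ?thesis by (simp add: m_def)
qed simp

lemma summable_three_halves: "summable (\<lambda>n. real n powr (-3/2))"
  by (simp add: summable_real_powr_iff)

context heavy_tailed_walk
begin

text \<open>One big jump: \<open>S\<^sub>n\<^sub>+\<^sub>1 = t\<close> requires the last summand or the sum of the others to exceed \<open>t / 2\<close>.\<close>

lemma pmf_walk_asymptotics: "(\<lambda>t. real t ^ 3 * pmf (walk F n) (int t)) \<longlonglongrightarrow> real n * a"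
proof (induction n)
  case 0
  have "(\<lambda>t. real t ^ 3 * pmf (walk F 0) (int t)) = (\<lambda>_. 0)" by (auto simp: pmf_walk_0)
  then show ?case by simp
next
  case (Suc n)
  have eq: "real t ^ 3 * pmf (walk F (Suc n)) (int t)
    = real t ^ 3 * (\<integral>k. indicator {k. 2 * k \<le> int t} k * pmf (walk F n) (int t - k) \<partial>F)
    + real t ^ 3 * (\<integral>k. indicator {k. 2 * k < int t} k * pmf F (int t - k) \<partial>walk F n)" for t
  proof -
    have "pmf (walk F (Suc n)) (int t)
      = (\<integral>k. indicator {k. 2 * k \<le> int t} k * pmf (walk F n) (int t - k)
           + indicator {k. int t < 2 * k} k * pmf (walk F n) (int t - k) \<partial>F)"
      unfolding pmf_walk_Suc by (rule Bochner_Integration.integral_cong) (auto simp: indicator_def)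
    also have "\<dots> = (\<integral>k. indicator {k. 2 * k \<le> int t} k * pmf (walk F n) (int t - k) \<partial>F)
       + (\<integral>k. indicator {k. int t < 2 * k} k * pmf (walk F n) (int t - k) \<partial>F)"
      by (rule Bochner_Integration.integral_add; rule integrable_pmf_bounded[where B = 1])
         (auto simp: indicator_def pmf_le_1)
    also have "(\<integral>k. indicator {k. int t < 2 * k} k * pmf (walk F n) (int t - k) \<partial>F)
       = (\<integral>j. indicator {k. int t < 2 * k} (int t - j) * pmf F (int t - j) \<partial>walk F n)"
      by (rule integral_pmf_reflect)
    also have "\<dots> = (\<integral>j. indicator {k. 2 * k < int t} j * pmf F (int t - j) \<partial>walk F n)"
      by (rule Bochner_Integration.integral_cong) (auto simp: indicator_def)
    finally show ?thesis by (simp add: distrib_left)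
  qed
  have "(\<lambda>t. real t ^ 3 * (\<integral>k. indicator {k. 2 * k \<le> int t} k * pmf (walk F n) (int t - k) \<partial>F)) \<longlonglongrightarrow> real n * a"
    by (rule half_convolution_tendsto[OF _ Suc.IH]) auto
  moreover have "(\<lambda>t. real t ^ 3 * (\<integral>k. indicator {k. 2 * k < int t} k * pmf F (int t - k) \<partial>walk F n)) \<longlonglongrightarrow> a"
    by (rule half_convolution_tendsto[OF _ tail_limit]) auto
  ultimately show ?case
    unfolding eq using tendsto_add by (fastforce simp: algebra_simps)
qed

section \<open>Where the renewal mass sits\<close>

text \<open>The factor 2 on either side is a convenient choice: inside, \<open>n\<close> is of the
  order of \<open>t\<close> and \<open>R1\<close> compares probabilities; outside, |t - n \<mu>| is
  at least a constant times the larger of \<open>t\<close> and \<open>n\<close>.\<close>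

definition band :: "nat \<Rightarrow> nat set" where
  "band t = {n. real t / (2 * \<mu>) < real n \<and> real n < 2 * real t / \<mu>}"

lemma finite_band: "finite (band t)"
proof (rule finite_subset)
  show "band t \<subseteq> {..nat \<lceil>2 * real t / \<mu>\<rceil>}"
  proof
    fix n assume "n \<in> band t"
    then have "real n \<le> real (nat \<lceil>2 * real t / \<mu>\<rceil>)" by (simp add: band_def) linarith
    then show "n \<in> {..nat \<lceil>2 * real t / \<mu>\<rceil>}" by simp
  qed
qed simp

text \<open>Because the deviation is linear in max t n, it exceeds n^(3/4) as soon as
  \<open>t\<close> is large, simultaneously for all \<open>n\<close> off the band. This uniformity
  in \<open>n\<close> is what allows summation afterwards.\<close>

lemma pmf_walk_off_band:
  "\<exists>C>0. \<forall>\<^sub>F t in sequentially. \<forall>n. n \<notin> band t \<longrightarrow> pmf (walk F n) (int t) \<le> C * real n / max (real t) (real n) ^ 3"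
proof -
  obtain C x\<^sub>0 where C: "C > 0" "x\<^sub>0 > 0"
    "\<And>n t. \<bar>real_of_int t - real n * \<mu>\<bar> \<ge> x\<^sub>0 \<Longrightarrow> real n powr (3/4) \<le> \<bar>real_of_int t - real n * \<mu>\<bar>
       \<Longrightarrow> pmf (walk F n) t \<le> C * real n / \<bar>real_of_int t - real n * \<mu>\<bar> ^ 3"
    by (rule pmf_walk_large_deviation[of "3/4"]) auto
  \<comment> \<open>If n \<mu> <= t / 2, the distance is at least t / 2 and at least n \<mu>; if n
    \<mu> >= 2 t, it is at least t and at least n \<mu> / 2.\<close>
  define c where "c = min (1/2) (\<mu>/2)"
  have c: "c > 0" "c \<le> 1/2" "c \<le> \<mu>/2" using mean_pos by (auto simp: c_def)
  have "\<forall>\<^sub>F m in at_top. m powr (3/4) \<le> c * m" "\<forall>\<^sub>F m in at_top. x\<^sub>0 \<le> c * m"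
    using c(1) by real_asymp+
  then have "\<forall>\<^sub>F m in at_top. m powr (3/4) \<le> c * m \<and> x\<^sub>0 \<le> c * m" by eventually_elim auto
  then obtain m\<^sub>0 where m0: "\<And>m. m \<ge> m\<^sub>0 \<Longrightarrow> m powr (3/4) \<le> c * m \<and> x\<^sub>0 \<le> c * m"
    by (auto simp: eventually_at_top_linorder)
  have "\<forall>\<^sub>F t in sequentially. real t \<ge> m\<^sub>0 \<and> t > 0"
    using eventually_ge_at_top[of "nat \<lceil>m\<^sub>0\<rceil>"] eventually_gt_at_top[of 0]
    by eventually_elim linarith
  then have "\<forall>\<^sub>F t in sequentially. \<forall>n. n \<notin> band t \<longrightarrow> pmf (walk F n) (int t) \<le> (C / c ^ 3) * real n / max (real t) (real n) ^ 3"
  proof eventually_elim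
    case (elim t)
    show ?case
    proof (intro allI impI)
      fix n assume n: "n \<notin> band t"
      define x where "x = \<bar>real_of_int (int t) - real n * \<mu>\<bar>"
      define m where "m = max (real t) (real n)"
      have m: "m \<ge> m\<^sub>0" "m > 0" "real n \<le> m" using elim by (auto simp: m_def)
      have cm: "c * m = max (c * real t) (c * real n)" using c(1) by (simp add: m_def max_mult_distrib_left)
      have x: "x \<ge> c * m"
      proof (cases "real t / (2 * \<mu>) < real n")
        case False
        then have 1: "2 * (real n * \<mu>) \<le> real t" using mean_pos by (simp add: field_simps)
        have "c * real n \<le> \<mu> * real n" "c * real t \<le> 1/2 * real t"
          using c mean_pos by (intro mult_right_mono; simp)+
        then show ?thesis using 1 by (simp add: cm x_def mult.commute)
      next
        case True
        then have 1: "2 * real t \<le> real n * \<mu>" using n mean_pos by (simp add: band_def field_simps)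
        have "c * real n \<le> \<mu>/2 * real n" "c * real t \<le> 1/2 * real t"
          using c mean_pos by (intro mult_right_mono; simp)+
        then show ?thesis using 1 by (simp add: cm x_def mult.commute)
      qed
      have "real n powr (3/4) \<le> m powr (3/4)" using m by (intro powr_mono2) auto
      then have "real n powr (3/4) \<le> x" "x\<^sub>0 \<le> x" using m0[OF m(1)] x by linarith+
      then have "pmf (walk F n) (int t) \<le> C * real n / x ^ 3" unfolding x_def by (intro C(3))
      also have "\<dots> \<le> C * real n / (c * m) ^ 3"
        using x c(1) m C(1) by (intro divide_left_mono power_mono mult_pos_pos zero_less_power) (auto intro: less_le_trans[of 0 "c * m"])
      finally show "pmf (walk F n) (int t) \<le> (C / c ^ 3) * real n / max (real t) (real n) ^ 3"
        by (simp add: m_def power_mult_distrib)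
    qed
  qed
  then show ?thesis using C(1) c(1) by (intro exI[of _ "C / c ^ 3"]) auto
qed

lemma renewal_off_band: "(\<lambda>t. \<Sum>n. if n \<in> band t then 0 else pmf (walk F n) (int t)) \<longlonglongrightarrow> 0"
proof -
  obtain C where C: "C > 0" "\<forall>\<^sub>F t in sequentially. \<forall>n. n \<notin> band t \<longrightarrow> pmf (walk F n) (int t) \<le> C * real n / max (real t) (real n) ^ 3"
    using pmf_walk_off_band by blast
  define Z where "Z = (\<Sum>n. real n powr (-3/2))"
  show ?thesis
  proof (rule tendsto_sandwich[where f = "\<lambda>_. 0" and h = "\<lambda>t. C * real t powr (-1/2) * Z"])
    show "\<forall>\<^sub>F t in sequentially. 0 \<le> (\<Sum>n. if n \<in> band t then 0 else pmf (walk F n) (int t))"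
      by (intro always_eventually allI suminf_nonneg summable_zero_on summable_walk) auto
    show "\<forall>\<^sub>F t in sequentially. (\<Sum>n. if n \<in> band t then 0 else pmf (walk F n) (int t)) \<le> C * real t powr (-1/2) * Z"
      using C(2) eventually_gt_at_top[of 0]
    proof eventually_elim
      case (elim t)
      have "(\<Sum>n. if n \<in> band t then 0 else pmf (walk F n) (int t)) \<le> (\<Sum>n. C * real t powr (-1/2) * real n powr (-3/2))"
      proof (rule suminf_le)
        fix n
        have "n \<notin> band t \<Longrightarrow> pmf (walk F n) (int t) \<le> C * (real n / max (real t) (real n) ^ 3)" using elim(1) by auto
        also have "C * (real n / max (real t) (real n) ^ 3) \<le> C * (real t powr (-1/2) * real n powr (-3/2))"
          by (rule mult_left_mono[OF ratio_max_cube_le]) (use elim C in auto)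
        finally show "(if n \<in> band t then 0 else pmf (walk F n) (int t)) \<le> C * real t powr (-1/2) * real n powr (-3/2)"
          using C by (auto simp: mult.assoc)
      next
        show "summable (\<lambda>n. C * real t powr (-1/2) * real n powr (-3/2))"
          by (rule summable_mult[OF summable_three_halves])
      qed (simp add: summable_zero_on summable_walk)
      also have "\<dots> = C * real t powr (-1/2) * Z"
        unfolding Z_def by (rule suminf_mult[OF summable_three_halves])
      finally show ?case .
    qed
    show "(\<lambda>t. C * real t powr (-1/2) * Z) \<longlonglongrightarrow> 0" by real_asymp
  qed simp
qed

definition near :: "real \<Rightarrow> nat \<Rightarrow> nat set" where
  "near \<kappa> t = {n. \<bar>real t - real n * \<mu>\<bar> \<le> real t powr \<kappa>}"

text \<open>In the band \<open>n\<close> is at most 2 t / \<mu>, and the inverse cubes beyond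
  distance t^\<kappa> sum to order t^(-2\<kappa>). The total is of order t^(1 - 2\<kappa>), which
  vanishes precisely because \<kappa> > 1/2.\<close>

lemma renewal_far_in_band:
  assumes \<kappa>: "1/2 < \<kappa>" "\<kappa> < 1"
  shows "(\<lambda>t. \<Sum>n\<in>band t - near \<kappa> t. pmf (walk F n) (int t)) \<longlonglongrightarrow> 0"
proof -
  \<comment> \<open>A smaller exponent, still above 1/2, for the deviation bound: n^\<kappa>' may
    reach (2 t / \<mu>)^\<kappa>', and the gap to \<kappa> absorbs the constant.\<close>
  define \<kappa>' where "\<kappa>' = (1/2 + \<kappa>) / 2"
  have \<kappa>': "1/2 < \<kappa>'" "\<kappa>' < 1" "\<kappa>' < \<kappa>" using \<kappa> by (auto simp: \<kappa>'_def)
  obtain C x\<^sub>0 where C: "C > 0" "x\<^sub>0 > 0"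
    "\<And>n t. \<bar>real_of_int t - real n * \<mu>\<bar> \<ge> x\<^sub>0 \<Longrightarrow> real n powr \<kappa>' \<le> \<bar>real_of_int t - real n * \<mu>\<bar>
       \<Longrightarrow> pmf (walk F n) t \<le> C * real n / \<bar>real_of_int t - real n * \<mu>\<bar> ^ 3"
    by (rule pmf_walk_large_deviation[OF \<kappa>'(1,2)]) auto
  have "\<forall>\<^sub>F t in sequentially. (2 / \<mu>) powr \<kappa>' * real t powr \<kappa>' \<le> real t powr \<kappa>"
    "\<forall>\<^sub>F t in sequentially. max x\<^sub>0 \<mu> \<le> real t powr \<kappa>"
    using \<kappa> \<kappa>' mean_pos by real_asymp+
  then have ev: "\<forall>\<^sub>F t in sequentially. (\<Sum>n\<in>band t - near \<kappa> t. pmf (walk F n) (int t)) \<le> 8 * C / \<mu>\<^sup>2 * real t powr (1 - 2 * \<kappa>)"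
    using eventually_gt_at_top[of 0]
  proof eventually_elim
    case (elim t)
    have far: "real t powr \<kappa> < \<bar>real t - real n * \<mu>\<bar>" if "n \<in> band t - near \<kappa> t" for n
      using that by (simp add: near_def)
    have "(\<Sum>n\<in>band t - near \<kappa> t. pmf (walk F n) (int t)) \<le> (\<Sum>n\<in>band t - near \<kappa> t. C * (2 * real t / \<mu>) * (1 / \<bar>real t - real n * \<mu>\<bar> ^ 3))"
    proof (rule sum_mono)
      fix n assume n: "n \<in> band t - near \<kappa> t"
      then have nb: "real n \<le> 2 / \<mu> * real t" by (simp add: band_def)
      then have "real n powr \<kappa>' \<le> (2 / \<mu> * real t) powr \<kappa>'" using \<kappa>' by (intro powr_mono2) auto
      also have "\<dots> = (2 / \<mu>) powr \<kappa>' * real t powr \<kappa>'" by (rule powr_mult)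
      finally have "real n powr \<kappa>' \<le> \<bar>real t - real n * \<mu>\<bar>" using elim far[OF n] by linarith
      then have "pmf (walk F n) (int t) \<le> C * real n / \<bar>real t - real n * \<mu>\<bar> ^ 3"
        using C(3)[of "int t" n] elim far[OF n] by simp
      also have "\<dots> \<le> C * (2 * real t / \<mu>) / \<bar>real t - real n * \<mu>\<bar> ^ 3"
        using nb C by (intro divide_right_mono mult_left_mono) auto
      finally show "pmf (walk F n) (int t) \<le> C * (2 * real t / \<mu>) * (1 / \<bar>real t - real n * \<mu>\<bar> ^ 3)" by simp
    qed
    also have "\<dots> = C * (2 * real t / \<mu>) * (\<Sum>n\<in>band t - near \<kappa> t. 1 / \<bar>real t - real n * \<mu>\<bar> ^ 3)"
      by (simp only: sum_distrib_left)
    also have "\<dots> \<le> C * (2 * real t / \<mu>) * (4 / (\<mu> * (real t powr \<kappa>)\<^sup>2))"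
      using C mean_pos elim far finite_band
      by (intro mult_left_mono sum_inverse_cube_far_le) (auto intro: less_imp_le)
    also have "\<dots> = 8 * C / \<mu>\<^sup>2 * (real t / (real t powr \<kappa>)\<^sup>2)"
      by (simp add: power2_eq_square)
    also have "real t / (real t powr \<kappa>)\<^sup>2 = real t powr (1 - 2 * \<kappa>)"
    proof -
      have "(real t powr \<kappa>)\<^sup>2 = real t powr (2 * \<kappa>)" by (simp add: power2_eq_square powr_add[symmetric])
      then show ?thesis using elim by (simp add: powr_diff)
    qed
    finally show ?case .
  qed
  show ?thesis
  proof (rule tendsto_sandwich[where f = "\<lambda>_. 0", OF _ ev])
    show "(\<lambda>t. 8 * C / \<mu>\<^sup>2 * real t powr (1 - 2 * \<kappa>)) \<longlonglongrightarrow> 0" using \<kappa> by real_asymp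
  qed (auto intro!: always_eventually sum_nonneg)
qed

lemma near_subset_band:
  assumes "\<kappa> < 1"
  shows "\<forall>\<^sub>F t in sequentially. near \<kappa> t \<subseteq> band t"
proof -
  have "\<forall>\<^sub>F t in sequentially. real t powr \<kappa> < real t / 2" using assms by real_asymp
  then show ?thesis
  proof eventually_elim
    case (elim t)
    show ?case
    proof
      fix n assume "n \<in> near \<kappa> t"
      then have "\<bar>real t - real n * \<mu>\<bar> < real t / 2" using elim by (simp add: near_def)
      then have "real t / 2 < real n * \<mu>" "real n * \<mu> < 2 * real t" by linarith+
      then show "n \<in> band t" using mean_pos by (simp add: band_def field_simps)
    qed
  qed
qed

lemma renewal_near:
  assumes \<kappa>: "1/2 < \<kappa>" "\<kappa> < 1"
  shows "(\<lambda>t. \<Sum>n\<in>near \<kappa> t. pmf (walk F n) (int t)) \<longlonglongrightarrow> 1 / \<mu>"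
proof (rule Lim_transform_eventually)
  show "(\<lambda>t. renewal (int t) - (\<Sum>n. if n \<in> band t then 0 else pmf (walk F n) (int t)) - (\<Sum>n\<in>band t - near \<kappa> t. pmf (walk F n) (int t))) \<longlonglongrightarrow> 1 / \<mu>"
    using tendsto_diff[OF tendsto_diff[OF renewal_theorem renewal_off_band] renewal_far_in_band[OF \<kappa>]] by simp
  show "\<forall>\<^sub>F t in sequentially. renewal (int t) - (\<Sum>n. if n \<in> band t then 0 else pmf (walk F n) (int t)) - (\<Sum>n\<in>band t - near \<kappa> t. pmf (walk F n) (int t))
      = (\<Sum>n\<in>near \<kappa> t. pmf (walk F n) (int t))"
    using near_subset_band[OF \<kappa>(2)]
  proof eventually_elim
    case (elim t)
    show ?case unfolding renewal_def
      using suminf_split_finite[OF summable_walk finite_band, of "int t" t]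
        sum.subset_diff[OF elim finite_band, of "\<lambda>n. pmf (walk F n) (int t)"] by simp
  qed
qed

end

section \<open>Regularity of the mass function of N\<close>

lemma R1_pos:
  assumes "R1 p" "\<And>n. p n \<ge> 0" "t > 0"
  shows "p t > 0"
proof -
  from assms(1) obtain c\<^sub>1 c\<^sub>2 c\<^sub>3 where "c\<^sub>1 > 1" "c\<^sub>2 > 0" and c: "\<forall>t\<^sub>1>0. \<forall>t\<^sub>2>0.
      1 \<le> real t\<^sub>2 / real t\<^sub>1 \<longrightarrow> real t\<^sub>2 / real t\<^sub>1 \<le> c\<^sub>1 \<longrightarrow> c\<^sub>2 \<le> p t\<^sub>2 / p t\<^sub>1 \<and> p t\<^sub>2 / p t\<^sub>1 \<le> c\<^sub>3"
    unfolding R1_def by blast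
  have "c\<^sub>2 \<le> p t / p t" using c[rule_format, of t t] assms(3) \<open>c\<^sub>1 > 1\<close> by simp
  with \<open>c\<^sub>2 > 0\<close> have "p t \<noteq> 0" by auto
  with assms(2)[of t] show ?thesis by simp
qed

text \<open>\<open>R1\<close> is chained along a geometric sequence of intermediate points to extend
  it from ratio \<open>c\<^sub>1\<close> to any ratio \<open>R\<close>; the lower bound
  \<open>s\<^sub>0\<close> makes the rounding to integers harmless.\<close>

lemma R1_comparable:
  assumes R1: "R1 p" and p: "\<And>n. p n \<ge> 0"
  shows "\<exists>K\<ge>1. \<exists>s\<^sub>0>0. \<forall>s\<ge>s\<^sub>0. \<forall>t. s \<le> t \<longrightarrow> real t \<le> R * real s \<longrightarrow> p t \<le> K * p s \<and> p s \<le> K * p t"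
proof -
  from R1 obtain c\<^sub>1 c\<^sub>2 c\<^sub>3 where c: "c\<^sub>1 > 1" "c\<^sub>2 > 0" "c\<^sub>3 > 0" and c': "\<forall>t\<^sub>1>0. \<forall>t\<^sub>2>0.
      1 \<le> real t\<^sub>2 / real t\<^sub>1 \<longrightarrow> real t\<^sub>2 / real t\<^sub>1 \<le> c\<^sub>1 \<longrightarrow> c\<^sub>2 \<le> p t\<^sub>2 / p t\<^sub>1 \<and> p t\<^sub>2 / p t\<^sub>1 \<le> c\<^sub>3"
    unfolding R1_def by blast
  define K where "K = max 1 (max c\<^sub>3 (1 / c\<^sub>2))"
  have K: "K \<ge> 1" "K \<ge> c\<^sub>3" "1 / c\<^sub>2 \<le> K" by (auto simp: K_def)
  have step: "p t \<le> K * p s \<and> p s \<le> K * p t" if "s > 0" "s \<le> t" "real t \<le> c\<^sub>1 * real s" for s t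
  proof -
    have ps: "p s > 0" "p t > 0" using R1_pos[OF R1 p] that by auto
    have "c\<^sub>2 \<le> p t / p s \<and> p t / p s \<le> c\<^sub>3" using c'[rule_format, of s t] that by (simp add: field_simps)
    then have 1: "c\<^sub>2 * p s \<le> p t" "p t \<le> c\<^sub>3 * p s" using ps by (simp_all add: field_simps)
    have "p s \<le> 1 / c\<^sub>2 * p t" using 1(1) c by (simp add: field_simps)
    also have "\<dots> \<le> K * p t" using K ps by (intro mult_right_mono) auto
    finally have "p s \<le> K * p t" .
    moreover have "p t \<le> K * p s"
      by (rule order_trans[OF 1(2)], rule mult_right_mono[OF K(2)]) (use ps in simp)
    ultimately show ?thesis by simp
  qed
  \<comment> \<open>Half of the ratio \<open>c\<^sub>1 - 1\<close> is sacrificed to rounding: for s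
    >= \<open>s\<^sub>0\<close> the integer part of \<open>c\<^sub>1 * s\<close> is still at least d
    s, so each link of the chain gains the factor d > 1.\<close>
  define d where "d = (1 + c\<^sub>1) / 2"
  have d: "1 < d" using c by (simp add: d_def)
  obtain s\<^sub>0 :: nat where s0: "s\<^sub>0 > 2 / (c\<^sub>1 - 1)" using reals_Archimedean2 by blast
  have s0pos: "s\<^sub>0 > 0" using s0 c by (metis diff_gt_0_iff_gt divide_pos_pos less_trans of_nat_0_less_iff zero_less_numeral)
  have pw: "p t \<le> K ^ Suc k * p s \<and> p s \<le> K ^ Suc k * p t"
    if "s \<ge> s\<^sub>0" "s \<le> t" "real t \<le> d ^ k * real s" for s t k
    using that
  proof (induction k arbitrary: s)
    case 0
    then have "t = s" by simp
    then show ?case using K p[of s] mult_right_mono[OF K(1), of "p s"] by simp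
  next
    case (Suc k)
    show ?case
    proof (cases "real t \<le> c\<^sub>1 * real s")
      case True
      have "p t \<le> K * p s \<and> p s \<le> K * p t" using step[of s t] Suc.prems s0pos True by simp
      moreover have "K \<le> K ^ Suc (Suc k)" using K(1) power_increasing[of 1 "Suc (Suc k)" K] by simp
      ultimately show ?thesis using p by (meson mult_right_mono order_trans)
    next
      case False
      define s' where "s' = nat \<lfloor>c\<^sub>1 * real s\<rfloor>"
      have s'1: "real s' \<le> c\<^sub>1 * real s" "real s' > c\<^sub>1 * real s - 1" using c by (auto simp: s'_def)
      have "(c\<^sub>1 - 1) / 2 * real s \<ge> 1"
      proof -
        have "real s > 2 / (c\<^sub>1 - 1)" using s0 Suc.prems(1) by simp
        then show ?thesis using c by (simp add: field_simps)
      qed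
      then have s'd: "real s' \<ge> d * real s" using s'1(2) by (simp add: d_def field_simps)
      have "real s \<le> d * real s" using mult_right_mono[of 1 d "real s"] d by simp
      then have ss': "s \<le> s'" using s'd by simp
      have s't: "s' \<le> t" using s'1 False by linarith
      have "real t \<le> d ^ k * real s'"
      proof -
        have "d ^ Suc k * real s = d ^ k * (d * real s)" by simp
        also have "\<dots> \<le> d ^ k * real s'" using s'd d by (intro mult_left_mono) auto
        finally show ?thesis using Suc.prems(3) by linarith
      qed
      then have 1: "p t \<le> K ^ Suc k * p s'" "p s' \<le> K ^ Suc k * p t"
        using Suc.IH[of s'] ss' s't Suc.prems by auto
      have 2: "p s' \<le> K * p s" "p s \<le> K * p s'" using step[of s s'] s0pos Suc.prems ss' s'1 by auto
      have K0: "K \<ge> 0" "K ^ Suc k \<ge> 0" using K by auto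
      have "p t \<le> K ^ Suc k * (K * p s)" using 1(1) mult_left_mono[OF 2(1) K0(2)] by linarith
      moreover have "p s \<le> K * (K ^ Suc k * p t)" using 2(2) mult_left_mono[OF 1(2) K0(1)] by linarith
      ultimately show ?thesis by (simp add: mult_ac)
    qed
  qed
  obtain k where k: "R < d ^ k" using real_arch_pow[OF d] by blast
  show ?thesis
  proof (intro exI[of _ "K ^ Suc k"] exI[of _ s\<^sub>0] conjI)
    show "1 \<le> K ^ Suc k" using K by (intro one_le_power) auto
    show "\<forall>s\<ge>s\<^sub>0. \<forall>t. s \<le> t \<longrightarrow> real t \<le> R * real s \<longrightarrow> p t \<le> K ^ Suc k * p s \<and> p s \<le> K ^ Suc k * p t"
    proof (intro allI impI)
      fix s t assume a: "s\<^sub>0 \<le> s" "s \<le> t" "real t \<le> R * real s"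
      have "R * real s \<le> d ^ k * real s" using k by (intro mult_right_mono) auto
      then show "p t \<le> K ^ Suc k * p s \<and> p s \<le> K ^ Suc k * p t" using pw[of s t k] a by simp
    qed
  qed (use s0pos in simp)
qed

text \<open>The mechanism behind Potter's bounds. One doubles \<open>s\<close> until
  \<open>t\<close> is within a factor 2; doublings do not increase \<open>g\<close>, so
  \<open>K\<close> is paid once, for the last incomplete step, and not at every step.\<close>

lemma bounded_growth_if_doubling_decreasing:
  fixes g :: "nat \<Rightarrow> real"
  assumes comp: "\<And>s t. s \<ge> s\<^sub>0 \<Longrightarrow> s \<le> t \<Longrightarrow> t \<le> 2 * s \<Longrightarrow> g t \<le> K * g s"
    and dec: "\<And>m. m \<ge> s\<^sub>0 \<Longrightarrow> g (2 * m) \<le> g m" and K: "K \<ge> 0" and s: "s > 0" "s \<ge> s\<^sub>0" "s \<le> t"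
  shows "g t \<le> K * g s"
  using s
proof (induction "t - s" arbitrary: s rule: less_induct)
  case less
  show ?case
  proof (cases "t \<le> 2 * s")
    case False
    then have "g t \<le> K * g (2 * s)" using less.prems by (intro less.hyps) auto
    also have "\<dots> \<le> K * g s" using dec less.prems K by (intro mult_left_mono) auto
    finally show ?thesis .
  qed (use comp less.prems in auto)
qed

lemma regularly_varying_doubling:
  assumes "slowly_varying L" "\<And>t. t > 0 \<Longrightarrow> p t = real t powr - \<gamma> * L (real t)"
  shows "(\<lambda>m. p (2 * m) / p m) \<longlonglongrightarrow> 2 powr - \<gamma>"
proof (rule Lim_transform_eventually)
  have "((\<lambda>x. L (2 * x) / L x) \<longlongrightarrow> 1) at_top"
    using assms(1) unfolding slowly_varying_def by auto
  from filterlim_compose[OF this filterlim_real_sequentially]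
  show "(\<lambda>m. 2 powr - \<gamma> * (L (2 * real m) / L (real m))) \<longlonglongrightarrow> 2 powr - \<gamma>"
    using tendsto_mult_left[of "\<lambda>m. L (2 * real m) / L (real m)" 1 sequentially "2 powr - \<gamma>"] by simp
  show "\<forall>\<^sub>F m in sequentially. 2 powr - \<gamma> * (L (2 * real m) / L (real m)) = p (2 * m) / p m"
    using eventually_gt_at_top[of 0]
  proof eventually_elim
    case (elim m)
    then have "p (2 * m) = 2 powr - \<gamma> * real m powr - \<gamma> * L (2 * real m)" "p m = real m powr - \<gamma> * L (real m)"
      using assms(2)[of "2 * m"] assms(2)[of m] by (simp_all add: powr_mult)
    then show ?case using elim by simp
  qed
qed

text \<open>If the mean is infinite, then the exponent \<open>\<gamma>\<close> is at most \<open>2\<close>, and Potter's bounds control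
  the contribution of all \<open>n\<close> by the probability at \<open>t\<close>.\<close>

lemma regularly_varying_mass_weighted_le:
  assumes R1: "R1 p" and p: "\<And>n. p n \<ge> 0" and rv: "regularly_varying_mass p"
    and inf: "\<not> summable (\<lambda>n. real n * p n)"
  shows "\<exists>K>0. \<forall>\<^sub>F t in sequentially. \<forall>n. p n * (real n / max (real t) (real n) ^ 3) \<le> K * p t * real t powr (-1/2) * real n powr (-3/2)"
proof -
  obtain \<gamma> L where \<gamma>: "\<gamma> > 1" and L: "slowly_varying L" "\<And>t. t > 0 \<Longrightarrow> p t = real t powr - \<gamma> * L (real t)"
    using rv unfolding regularly_varying_mass_def by blast
  have ratio: "(\<lambda>m. p (2 * m) / p m) \<longlonglongrightarrow> 2 powr - \<gamma>" by (rule regularly_varying_doubling[OF L])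
  obtain K s\<^sub>0 where K: "K \<ge> 1" and s0: "s\<^sub>0 > 0"
    and comp: "\<And>s t. s \<ge> s\<^sub>0 \<Longrightarrow> s \<le> t \<Longrightarrow> real t \<le> 2 * real s \<Longrightarrow> p t \<le> K * p s \<and> p s \<le> K * p t"
    using R1_comparable[OF R1 p, of 2] by blast
  have comp1: "p t \<le> K * p s" and comp2: "p s \<le> K * p t" if "s \<ge> s\<^sub>0" "s \<le> t" "t \<le> 2 * s" for s t
    using comp[of s t] that by (simp_all add: of_nat_mult[symmetric] del: of_nat_mult)
  have pos: "p n > 0" if "n > 0" for n using R1_pos[OF R1 p that] .
  have \<gamma>2: "\<gamma> \<le> 2"
  proof (rule ccontr)
    assume "\<not> \<gamma> \<le> 2"
    \<comment> \<open>With an exponent strictly between 2 and \<open>\<gamma>\<close>, the product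
      p(t) t^\<sigma> does not increase under doubling. Then p(n) is of order at most n^(-\<sigma>)
      and the mean would be finite.\<close>
    define \<sigma> where "\<sigma> = (2 + \<gamma>) / 2"
    have \<sigma>: "2 < \<sigma>" "\<sigma> < \<gamma>" using \<open>\<not> \<gamma> \<le> 2\<close> by (auto simp: \<sigma>_def)
    have "\<forall>\<^sub>F m in sequentially. p (2 * m) / p m < 2 powr - \<sigma>"
      using ratio by (rule order_tendstoD) (use \<sigma> in simp)
    then obtain m\<^sub>0 where m0: "\<And>m. m \<ge> m\<^sub>0 \<Longrightarrow> p (2 * m) / p m < 2 powr - \<sigma>"
      by (auto simp: eventually_at_top_linorder)
    define s where "s = max s\<^sub>0 m\<^sub>0"
    have bnd: "p t * real t powr \<sigma> \<le> K * 2 powr \<sigma> * (p s * real s powr \<sigma>)" if "s \<le> t" for t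
    proof (rule bounded_growth_if_doubling_decreasing[where s\<^sub>0 = s and g = "\<lambda>t. p t * real t powr \<sigma>"])
      fix u v assume uv: "s \<le> u" "u \<le> v" "v \<le> 2 * u"
      have "real v powr \<sigma> \<le> (2 * real u) powr \<sigma>" using uv \<sigma> by (intro powr_mono2) auto
      also have "\<dots> = 2 powr \<sigma> * real u powr \<sigma>" by (rule powr_mult)
      finally have "p v * real v powr \<sigma> \<le> (K * p u) * (2 powr \<sigma> * real u powr \<sigma>)"
        using comp1[of u v] uv K p by (intro mult_mono) (auto simp: s_def)
      then show "p v * real v powr \<sigma> \<le> K * 2 powr \<sigma> * (p u * real u powr \<sigma>)" by (simp add: mult_ac)
    next
      fix m assume m: "s \<le> m"
      then have "p (2 * m) < 2 powr - \<sigma> * p m"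
        using m0[of m] pos[of m] s0 by (simp add: s_def field_simps)
      then have "p (2 * m) * (2 powr \<sigma> * real m powr \<sigma>) \<le> (2 powr - \<sigma> * p m) * (2 powr \<sigma> * real m powr \<sigma>)"
        by (intro mult_right_mono) auto
      also have "\<dots> = p m * real m powr \<sigma>" by (simp add: powr_minus)
      finally show "p (2 * m) * real (2 * m) powr \<sigma> \<le> p m * real m powr \<sigma>"
        by (simp add: powr_mult)
    qed (use K s0 that in \<open>auto simp: s_def\<close>)
    define D where "D = K * 2 powr \<sigma> * (p s * real s powr \<sigma>)"
    have "summable (\<lambda>n. real n * p n)"
    proof (rule summable_comparison_test')
      show "summable (\<lambda>n. D * real n powr (1 - \<sigma>))"
        using \<sigma> by (intro summable_mult) (simp add: summable_real_powr_iff)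
      fix n assume n: "n \<ge> s"
      then have n0: "n > 0" using s0 by (simp add: s_def)
      have "p n * real n powr \<sigma> * real n powr (1 - \<sigma>) \<le> D * real n powr (1 - \<sigma>)"
        using bnd[OF n] by (intro mult_right_mono) (auto simp: D_def)
      also have "p n * real n powr \<sigma> * real n powr (1 - \<sigma>) = p n * real n"
        using n0 by (simp add: mult.assoc powr_add[symmetric])
      finally show "norm (real n * p n) \<le> D * real n powr (1 - \<sigma>)" using p[of n] by (simp add: mult.commute)
    qed
    with inf show False by contradiction
  qed
  have "\<forall>\<^sub>F m in sequentially. p (2 * m) / p m < 1"
    using ratio by (rule order_tendstoD) (use \<gamma> powr_less_mono[of "- \<gamma>" 0 2] in simp)
  \<comment> \<open>The exponent 5/2 exceeds \<open>\<gamma>\<close>, which is at most 2, so p(n)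
    n^(5/2) increases under doubling. It is also the power of \<open>n\<close> in the proof of
    \<open>ratio_max_cube_le\<close>, so that the ranges n <= t and n > t end with the same
    weight.\<close>
  moreover have "\<forall>\<^sub>F m in sequentially. 2 powr (-5/2) < p (2 * m) / p m"
    using ratio by (rule order_tendstoD) (use \<gamma>2 in simp)
  ultimately have "\<forall>\<^sub>F m in sequentially. p (2 * m) / p m < 1 \<and> 2 powr (-5/2) < p (2 * m) / p m"
    by eventually_elim simp
  then obtain m\<^sub>0 where m0: "\<And>m. m \<ge> m\<^sub>0 \<Longrightarrow> p (2 * m) / p m < 1 \<and> 2 powr (-5/2) < p (2 * m) / p m"
    by (auto simp: eventually_at_top_linorder)
  define s where "s = max s\<^sub>0 m\<^sub>0"
  have s: "s > 0" "s \<ge> s\<^sub>0" "s \<ge> m\<^sub>0" using s0 by (auto simp: s_def)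
  have up: "p v \<le> K * p u" if "s \<le> u" "u \<le> v" for u v
  proof (rule bounded_growth_if_doubling_decreasing[where s\<^sub>0 = s and g = p])
    show "p (2 * m) \<le> p m" if "s \<le> m" for m
      using m0[of m] pos[of m] s that by (simp add: field_simps)
  qed (use comp1 K s that in auto)
  have down: "p u * real u powr (5/2) \<le> K * (p v * real v powr (5/2))" if "s \<le> u" "u \<le> v" for u v
  proof -
    \<comment> \<open>A lower bound on growth is an upper bound for the reciprocal.\<close>
    define g where "g n = inverse (p n * real n powr (5/2))" for n
    have "g v \<le> K * g u"
    proof (rule bounded_growth_if_doubling_decreasing[where s\<^sub>0 = s and g = g])
      fix u v assume uv: "s \<le> u" "u \<le> v" "v \<le> 2 * u"
      have "p u * real u powr (5/2) \<le> (K * p v) * real v powr (5/2)"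
        using comp2[of u v] uv s K p by (intro mult_mono powr_mono2) auto
      moreover have "0 < p u * real u powr (5/2)" "0 < p v * real v powr (5/2)" using uv s pos by auto
      ultimately show "g v \<le> K * g u" by (simp add: g_def field_simps)
    next
      fix m assume m: "s \<le> m"
      have pm: "p m > 0" "p (2 * m) > 0" using pos m s by auto
      have "2 powr (-5/2) * p m \<le> p (2 * m)"
        using m0[of m] m s pm by (simp add: field_simps)
      then have le: "2 powr (-5/2) * p m * (2 powr (5/2) * real m powr (5/2)) \<le> p (2 * m) * (2 powr (5/2) * real m powr (5/2))"
        by (intro mult_right_mono) auto
      have one: "(2::real) powr (-5/2) * 2 powr (5/2) = 1" by (simp add: powr_add[symmetric])
      have lhs: "2 powr (-5/2) * p m * (2 powr (5/2) * real m powr (5/2)) = p m * real m powr (5/2)"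
        by (subst mult.left_neutral[symmetric], subst one[symmetric]) (simp only: mult_ac)
      have rhs: "real (2 * m) powr (5/2) = 2 powr (5/2) * real m powr (5/2)" by (simp add: powr_mult)
      have "p m * real m powr (5/2) \<le> p (2 * m) * real (2 * m) powr (5/2)"
        using le unfolding lhs rhs .
      then show "g (2 * m) \<le> g m" unfolding g_def
        by (rule le_imp_inverse_le) (use pm m s in auto)
    qed (use K s that in auto)
    moreover have "0 < p u * real u powr (5/2)" "0 < p v * real v powr (5/2)" using that s pos by auto
    ultimately show ?thesis by (simp add: g_def field_simps)
  qed
  \<comment> \<open>Indices below \<open>s\<close> escape the bounds by doubling; their masses are
    compared with \<open>p s\<close>, and from there with \<open>p v\<close>.\<close>
  define D where "D = (\<Sum>n<s. p n) / p s"
  have D0: "D \<ge> 0" using p pos[OF s(1)] by (auto simp: D_def intro!: divide_nonneg_pos sum_nonneg)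
  have small: "p u * real u powr (5/2) \<le> (1 + D) * K * (p v * real v powr (5/2))" if "s \<le> v" "u \<le> v" for u v
  proof (cases "s \<le> u")
    case True
    have "0 \<le> D * (K * (p v * real v powr (5/2)))" using D0 K p by auto
    then show ?thesis using down[OF True that(2)] by (simp add: algebra_simps)
  next
    case False
    then have "p u \<le> (\<Sum>n<s. p n)" using p by (intro member_le_sum) auto
    also have "\<dots> = D * p s" using pos[OF s(1)] by (simp add: D_def)
    finally have "p u * real u powr (5/2) \<le> D * p s * real s powr (5/2)"
      using False D0 p by (intro mult_mono powr_mono2) auto
    also have "\<dots> \<le> D * (K * (p v * real v powr (5/2)))"
      using mult_left_mono[OF down[of s v] D0] that by (simp add: mult_ac)
    also have "\<dots> \<le> (1 + D) * (K * (p v * real v powr (5/2)))"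
      using K p by (intro mult_right_mono) auto
    finally show ?thesis by (simp add: mult_ac)
  qed
  show ?thesis
  proof (intro exI[of _ "(1 + D) * K"] conjI)
    show "(1 + D) * K > 0" using D0 K by (intro mult_pos_pos) auto
    show "\<forall>\<^sub>F t in sequentially. \<forall>n. p n * (real n / max (real t) (real n) ^ 3) \<le> (1 + D) * K * p t * real t powr (-1/2) * real n powr (-3/2)"
      using eventually_ge_at_top[of s]
    proof eventually_elim
      case (elim t)
      then have t: "t > 0" using s by simp
      show ?case
      proof
        fix n
        show "p n * (real n / max (real t) (real n) ^ 3) \<le> (1 + D) * K * p t * real t powr (-1/2) * real n powr (-3/2)"
        proof (cases "n \<le> t")
          case False
          have "p n * (real n / max (real t) (real n) ^ 3) \<le> (K * p t) * (real t powr (-1/2) * real n powr (-3/2))"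
            using up[of t n] elim False t K p by (intro mult_mono ratio_max_cube_le) auto
          also have "\<dots> \<le> ((1 + D) * K * p t) * (real t powr (-1/2) * real n powr (-3/2))"
            using K p[of t] D0 by (intro mult_right_mono) (auto simp: algebra_simps)
          finally show ?thesis by (simp add: mult_ac)
        next
          case True
          show ?thesis
          proof (cases "n = 0")
            case False
            have n1: "real n powr (5/2) = real n * real n powr (3/2)" using False by (subst powr_mult_base) auto
            have n2: "real n powr (-3/2) = 1 / real n powr (3/2)" "real t powr (-1/2) = 1 / real t powr (1/2)"
              using powr_minus_divide[of "real t" "1/2"] powr_minus_divide[of "real n" "3/2"] by simp_all
            have n3: "real t ^ 3 = real t powr (5/2) * real t powr (1/2)" using t by (simp add: powr_add[symmetric])
            have "p n * real n * real n powr (3/2) \<le> (1 + D) * K * (p t * real t powr (5/2))"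
              using small[of t n] elim True by (simp add: n1 mult.assoc)
            then have "p n * real n * real n powr (3/2) / (real n powr (3/2) * real t ^ 3) \<le> (1 + D) * K * (p t * real t powr (5/2)) / (real n powr (3/2) * real t ^ 3)"
              by (rule divide_right_mono) simp
            also have "\<dots> = (1 + D) * K * p t * real t powr (-1/2) * real n powr (-3/2)"
              using t False unfolding n2 n3 by (simp add: field_simps)
            finally have "p n * real n * real n powr (3/2) / (real n powr (3/2) * real t ^ 3)
                \<le> (1 + D) * K * p t * real t powr (-1/2) * real n powr (-3/2)" .
            moreover have "max (real t) (real n) = real t" using True by simp
            ultimately show ?thesis using False by simp
          qed simp
        qed
      qed
    qed
  qed
qed

text \<open>Uniformity of \<open>R2\<close> in both arguments: the roles of \<open>s\<close> and \<open>t\<close> can be exchanged.\<close>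

lemma R2_ratio_near:
  assumes R2: "R2 p" and pos: "\<And>n. n > 0 \<Longrightarrow> p n > 0" and \<mu>: "\<mu> > 0"
  shows "\<exists>\<kappa>. 1/2 < \<kappa> \<and> \<kappa> < 1 \<and> (\<forall>e>0. \<forall>\<^sub>F t in sequentially. \<forall>n.
    \<bar>real t - real n * \<mu>\<bar> \<le> real t powr \<kappa> \<longrightarrow> \<bar>p n - p (nat \<lfloor>real t / \<mu>\<rfloor>)\<bar> \<le> e * p (nat \<lfloor>real t / \<mu>\<rfloor>))"
proof -
  obtain \<kappa>\<^sub>0 where \<kappa>0: "\<kappa>\<^sub>0 > 1/2" and lim:
    "(\<lambda>t. SUP s\<in>{s. 0 < s \<and> \<bar>real t - real s\<bar> \<le> real t powr \<kappa>\<^sub>0}. p t / p s) \<longlonglongrightarrow> 1"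
    using R2 unfolding R2_def by blast
  \<comment> \<open>Strictly below \<open>\<kappa>\<^sub>0\<close>, so that division by \<mu>, the
    rounding of t / \<mu> and the change of base point from \<open>t\<close> to \<open>n\<close> or
    \<open>m\<close> are absorbed; below 1, so that the window eventually lies in the band.\<close>
  define \<kappa> where "\<kappa> = (1/2 + min \<kappa>\<^sub>0 1) / 2"
  have \<kappa>: "1/2 < \<kappa>" "\<kappa> < 1" "\<kappa> < \<kappa>\<^sub>0" using \<kappa>0 by (auto simp: \<kappa>_def min_def)
  have "\<forall>\<^sub>F t in sequentially. \<forall>n. \<bar>real t - real n * \<mu>\<bar> \<le> real t powr \<kappa> \<longrightarrow> \<bar>p n - p (nat \<lfloor>real t / \<mu>\<rfloor>)\<bar> \<le> e * p (nat \<lfloor>real t / \<mu>\<rfloor>)"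
    if e: "e > 0" for e
  proof -
    have "\<forall>\<^sub>F t in sequentially. (SUP s\<in>{s. 0 < s \<and> \<bar>real t - real s\<bar> \<le> real t powr \<kappa>\<^sub>0}. p t / p s) < 1 + e"
      using lim by (rule order_tendstoD) (use e in simp)
    then obtain t\<^sub>0 where t0: "\<And>t. t \<ge> t\<^sub>0 \<Longrightarrow> (SUP s\<in>{s. 0 < s \<and> \<bar>real t - real s\<bar> \<le> real t powr \<kappa>\<^sub>0}. p t / p s) < 1 + e"
      by (auto simp: eventually_at_top_linorder)
    have ratio: "p t \<le> (1 + e) * p s" if "t \<ge> t\<^sub>0" "s > 0" "\<bar>real t - real s\<bar> \<le> real t powr \<kappa>\<^sub>0" for s t
    proof -
      define S where "S = {s. 0 < s \<and> \<bar>real t - real s\<bar> \<le> real t powr \<kappa>\<^sub>0}"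
      \<comment> \<open>A supremum of reals bounds its members only over a bounded set, which
        finiteness of \<open>S\<close> provides.\<close>
      have "S \<subseteq> {..nat \<lceil>real t + real t powr \<kappa>\<^sub>0\<rceil>}" unfolding S_def by auto linarith
      then have "finite S" by (rule finite_subset) simp
      then have "p t / p s \<le> (SUP s\<in>S. p t / p s)"
        using that by (intro cSUP_upper bdd_above_finite finite_imageI) (auto simp: S_def)
      also have "\<dots> < 1 + e" using t0[OF that(1)] by (simp add: S_def)
      finally show ?thesis using pos[OF that(2)] by (simp add: field_simps)
    qed
    have "\<forall>\<^sub>F t in sequentially. real t powr \<kappa> / \<mu> + 1 \<le> (1 / (2 * \<mu>)) powr \<kappa>\<^sub>0 * real t powr \<kappa>\<^sub>0"
      using \<kappa> \<mu> by real_asymp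
    moreover have "\<forall>\<^sub>F t in sequentially. real t powr \<kappa> < real t / 2" using \<kappa> by real_asymp
    moreover have "\<forall>\<^sub>F t in sequentially. max 1 (real t\<^sub>0) \<le> real t / (2 * \<mu>)" using \<mu> by real_asymp
    ultimately show ?thesis
    proof eventually_elim
      case (elim t)
      define m where "m = nat \<lfloor>real t / \<mu>\<rfloor>"
      have c: "real t / (2 * \<mu>) \<ge> 1" "real t / \<mu> = 2 * (real t / (2 * \<mu>))" using elim(3) \<mu> by auto
      have m: "real m \<le> real t / \<mu>" "real m > real t / \<mu> - 1" using \<mu> by (auto simp: m_def)
      have m2: "real t / (2 * \<mu>) \<le> real m" using m c by linarith
      show ?case unfolding m_def[symmetric]
      proof (intro allI impI)
        fix n assume n: "\<bar>real t - real n * \<mu>\<bar> \<le> real t powr \<kappa>"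
        then have "real t / 2 \<le> real n * \<mu>" using elim(2) by linarith
        then have n2: "real t / (2 * \<mu>) \<le> real n" using \<mu> by (simp add: field_simps)
        have "real t / \<mu> - real n = (real t - real n * \<mu>) / \<mu>" using \<mu> by (simp add: field_simps)
        then have "\<bar>real t / \<mu> - real n\<bar> \<le> real t powr \<kappa> / \<mu>" using n \<mu> by (simp add: divide_right_mono)
        then have "\<bar>real n - real m\<bar> \<le> real t powr \<kappa> / \<mu> + 1" using m by linarith
        also have "\<dots> \<le> (1 / (2 * \<mu>)) powr \<kappa>\<^sub>0 * real t powr \<kappa>\<^sub>0" by (rule elim(1))
        also have "\<dots> = (real t / (2 * \<mu>)) powr \<kappa>\<^sub>0" using \<mu> by (simp add: powr_mult[symmetric])
        finally have nm: "\<bar>real n - real m\<bar> \<le> (real t / (2 * \<mu>)) powr \<kappa>\<^sub>0" .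
        have 1: "(real t / (2 * \<mu>)) powr \<kappa>\<^sub>0 \<le> real n powr \<kappa>\<^sub>0" "(real t / (2 * \<mu>)) powr \<kappa>\<^sub>0 \<le> real m powr \<kappa>\<^sub>0"
          using n2 m2 c(1) \<kappa>0 by (intro powr_mono2; linarith)+
        have 2: "n > 0" "m > 0" "n \<ge> t\<^sub>0" "m \<ge> t\<^sub>0" using n2 m2 elim(3) by linarith+
        have "p n \<le> (1 + e) * p m" using ratio[of n m] nm 1 2 by linarith
        moreover have "p m \<le> (1 + e) * p n" using ratio[of m n] nm 1 2 by linarith
        \<comment> \<open>The ratio bound for \<open>m\<close> against \<open>n\<close> controls p m
          - p n by e p n; this is converted to e p m in the only case of interest, p n < p
          m.\<close>
        moreover have "(1 + e) * p n - p n \<le> e * p m \<or> p n \<ge> p m"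
        proof (cases "p n \<ge> p m")
          case False
          then have "e * p n \<le> e * p m" using e by (intro mult_left_mono) auto
          then show ?thesis by (simp add: algebra_simps)
        qed simp
        moreover have "0 \<le> e * p m" using e pos[OF 2(2)] by simp
        ultimately show "\<bar>p n - p m\<bar> \<le> e * p m" by (simp add: abs_le_iff algebra_simps) linarith
      qed
    qed
  qed
  with \<kappa> show ?thesis by blast
qed

lemma R1_floor_comparable:
  assumes R1: "R1 p" and p: "\<And>n. p n \<ge> 0" and \<mu>: "\<mu> > 0" and c: "c > 0"
  shows "\<exists>K>0. \<forall>\<^sub>F t in sequentially. \<forall>n. c * real t \<le> real n \<longrightarrow> real n \<le> d * real t \<longrightarrow> p n \<le> K * p (nat \<lfloor>real t / \<mu>\<rfloor>)"
proof -
  \<comment> \<open>With m the integer part of t / \<mu>, one has t / (2 \<mu>) <= m <= t / \<mu>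
    for large \<open>t\<close>. The first entry bounds n / m when m <= n, the second m / n
    otherwise.\<close>
  define R where "R = max (2 * \<mu> * d) (1 / (\<mu> * c))"
  obtain K s\<^sub>0 where K: "K \<ge> 1" and s0: "s\<^sub>0 > 0"
    and comp: "\<And>s t. s \<ge> s\<^sub>0 \<Longrightarrow> s \<le> t \<Longrightarrow> real t \<le> R * real s \<Longrightarrow> p t \<le> K * p s \<and> p s \<le> K * p t"
    using R1_comparable[OF R1 p, of R] by blast
  have "\<forall>\<^sub>F t in sequentially. max 1 (real s\<^sub>0) \<le> real t / (2 * \<mu>)" "\<forall>\<^sub>F t in sequentially. real s\<^sub>0 \<le> c * real t"
    using \<mu> c by real_asymp+
  then have "\<forall>\<^sub>F t in sequentially. \<forall>n. c * real t \<le> real n \<longrightarrow> real n \<le> d * real t \<longrightarrow> p n \<le> K * p (nat \<lfloor>real t / \<mu>\<rfloor>)"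
  proof eventually_elim
    case (elim t)
    define m where "m = nat \<lfloor>real t / \<mu>\<rfloor>"
    have h: "real t / (2 * \<mu>) \<ge> 1" "real t / \<mu> = 2 * (real t / (2 * \<mu>))" using elim(1) \<mu> by auto
    have m: "real m \<le> real t / \<mu>" "real m > real t / \<mu> - 1" using \<mu> by (auto simp: m_def)
    have m2: "real t / (2 * \<mu>) \<le> real m" using m h by linarith
    then have tm: "real t \<le> 2 * \<mu> * real m" using \<mu> by (simp add: field_simps)
    show ?case unfolding m_def[symmetric]
    proof (intro allI impI)
      fix n assume n: "c * real t \<le> real n" "real n \<le> d * real t"
      show "p n \<le> K * p m"
      proof (cases "m \<le> n")
        case True
        have d: "d \<ge> 0"
        proof (rule ccontr)
          assume "\<not> d \<ge> 0"
          moreover have "real t > 0" using h \<mu> by (simp add: field_simps)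
          ultimately have "d * real t < 0" by (simp add: mult_neg_pos)
          then show False using n(2) by linarith
        qed
        have "real n \<le> d * (2 * \<mu> * real m)" using n(2) mult_left_mono[OF tm d] by linarith
        also have "\<dots> \<le> R * real m" unfolding R_def
          using mult_right_mono[OF max.cobounded1[of "2 * \<mu> * d" "1 / (\<mu> * c)"], of "real m"] by (simp add: mult_ac)
        finally show ?thesis using comp[of m n] True m2 elim(1) by simp
      next
        case False
        have "real m \<le> 1 / (\<mu> * c) * (c * real t)" using m(1) c by simp
        also have "\<dots> \<le> 1 / (\<mu> * c) * real n" using n(1) \<mu> c by (intro mult_left_mono) auto
        also have "\<dots> \<le> R * real n" unfolding R_def by (intro mult_right_mono) auto
        finally show ?thesis using comp[of n m] False n elim(2) by simp
      qed
    qed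
  qed
  then show ?thesis using K by (intro exI[of _ K]) auto
qed

section \<open>From random variables to mass functions\<close>

lemma (in prob_space) distr_eq_measure_pmf:
  fixes Y :: "'a \<Rightarrow> 'b::countable"
  assumes Y: "Y \<in> measurable M (count_space UNIV)"
  obtains F where "distr M (count_space UNIV) Y = measure_pmf F" "\<And>y. pmf F y = mass M Y y"
proof -
  define D where "D = distr M (count_space UNIV) Y"
  interpret D: prob_space D unfolding D_def by (rule prob_space_distr[OF Y])
  have [simp]: "sets D = UNIV" by (simp add: D_def)
  have single: "measure D {y} = mass M Y y" for y
    using Y by (simp add: D_def measure_distr mass_def vimage_def Int_def conj_commute)
  have "(\<integral>\<^sup>+y. ennreal (mass M Y y) \<partial>count_space UNIV) = (\<integral>\<^sup>+y. emeasure D {y} \<partial>count_space UNIV)"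
    by (simp add: D.emeasure_eq_measure single)
  also have "\<dots> = emeasure D UNIV"
    by (rule emeasure_countable_singleton[symmetric]) (auto simp: D_def)
  also have "\<dots> = 1" using D.emeasure_space_1 by (simp add: D_def)
  finally have F: "pmf (embed_pmf (mass M Y)) y = mass M Y y" for y
    by (intro pmf_embed_pmf) (auto simp: mass_def)
  have "D = measure_pmf (embed_pmf (mass M Y))"
    by (rule measure_eqI_countable[where A = UNIV])
       (auto simp: D.emeasure_eq_measure single emeasure_pmf_single F)
  then show thesis using that F by (simp add: D_def)
qed

lemma measurable_sum_int:
  fixes f :: "nat \<Rightarrow> 'a \<Rightarrow> int"
  assumes [measurable]: "\<And>i. f i \<in> measurable M (count_space UNIV)"
  shows "(\<lambda>\<omega>. \<Sum>i<n. f i \<omega>) \<in> measurable M (count_space UNIV)"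
proof -
  have "{\<omega>\<in>space M. (\<Sum>i<n. real_of_int (f i \<omega>)) = real_of_int a} \<in> sets M" for a by measurable
  moreover have "(\<lambda>\<omega>. \<Sum>i<n. f i \<omega>) -` {a} \<inter> space M = {\<omega>\<in>space M. (\<Sum>i<n. real_of_int (f i \<omega>)) = real_of_int a}" for a
    by (auto simp: of_int_sum[symmetric] simp del: of_int_sum)
  ultimately show ?thesis by (simp add: measurable_count_space_eq_countable)
qed

lemma walk_Suc_eq_pair: "walk F (Suc n) = map_pmf (\<lambda>(k, s). k + s) (pair_pmf F (walk F n))"
  by (simp add: walk.simps pair_pmf_def map_bind_pmf map_pmf_def bind_assoc_pmf bind_return_pmf)

text \<open>Induction with the newest summand in the role of the jump that \<open>walk\<close> adds
  on the left. Independence of this summand from the preceding sum is obtained for the real-valued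
  copies, whose level sets are those of the integer variables.\<close>

lemma (in prob_space) distr_partial_sum:
  fixes X :: "nat \<Rightarrow> 'a \<Rightarrow> int"
  assumes indep: "indep_vars (\<lambda>_. count_space UNIV) X UNIV"
    and F: "\<And>i. distr M (count_space UNIV) (X i) = measure_pmf F"
  shows "distr M (count_space UNIV) (\<lambda>\<omega>. \<Sum>i<n. X i \<omega>) = measure_pmf (walk F n)"
proof (induction n)
  case 0
  show ?case
    by (rule measure_eqI_countable[where A = UNIV])
       (auto simp: walk.simps emeasure_distr indicator_def emeasure_space_1)
next
  case (Suc n)
  define S where "S \<omega> = (\<Sum>i<n. X i \<omega>)" for \<omega>
  have X [measurable]: "X i \<in> measurable M (count_space UNIV)" for i
    using indep by (auto simp: indep_vars_def)
  have S [measurable]: "S \<in> measurable M (count_space UNIV)"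
    unfolding S_def by (rule measurable_sum_int) (rule X)
  have "indep_vars (\<lambda>_. borel) (\<lambda>i \<omega>. real_of_int (X i \<omega>)) (insert n {..<n})"
    using indep_vars_compose2[OF indep_vars_subset[OF indep], of "insert n {..<n}" "\<lambda>_. real_of_int" "\<lambda>_. borel"] by simp
  then have iv: "indep_var borel (\<lambda>\<omega>. real_of_int (X n \<omega>)) borel (\<lambda>\<omega>. \<Sum>i<n. real_of_int (X i \<omega>))"
    by (intro indep_vars_sum) auto
  have pair: "prob {\<omega>\<in>space M. X n \<omega> = k \<and> S \<omega> = s} = pmf F k * pmf (walk F n) s" for k s
  proof -
    have "prob ((\<lambda>\<omega>. (real_of_int (X n \<omega>), \<Sum>i<n. real_of_int (X i \<omega>))) -` ({real_of_int k} \<times> {real_of_int s}) \<inter> space M)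
      = prob ((\<lambda>\<omega>. real_of_int (X n \<omega>)) -` {real_of_int k} \<inter> space M) * prob ((\<lambda>\<omega>. \<Sum>i<n. real_of_int (X i \<omega>)) -` {real_of_int s} \<inter> space M)"
      by (rule indep_varD[OF iv]) auto
    also have "(\<lambda>\<omega>. (real_of_int (X n \<omega>), \<Sum>i<n. real_of_int (X i \<omega>))) -` ({real_of_int k} \<times> {real_of_int s}) \<inter> space M
       = {\<omega>\<in>space M. X n \<omega> = k \<and> S \<omega> = s}"
      by (auto simp: S_def of_int_sum[symmetric] simp del: of_int_sum)
    also have "prob ((\<lambda>\<omega>. real_of_int (X n \<omega>)) -` {real_of_int k} \<inter> space M) = measure (distr M (count_space UNIV) (X n)) {k}"
      by (subst measure_distr) (auto intro!: arg_cong[where f = prob])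
    also have "\<dots> = pmf F k" by (simp add: F measure_pmf_single)
    also have "prob ((\<lambda>\<omega>. \<Sum>i<n. real_of_int (X i \<omega>)) -` {real_of_int s} \<inter> space M) = measure (distr M (count_space UNIV) S) {s}"
      by (subst measure_distr) (auto intro!: arg_cong[where f = prob] simp: S_def of_int_sum[symmetric] simp del: of_int_sum)
    also have "\<dots> = pmf (walk F n) s" using Suc.IH by (simp add: S_def[abs_def] measure_pmf_single)
    finally show ?thesis .
  qed
  have P [measurable]: "(\<lambda>\<omega>. (X n \<omega>, S \<omega>)) \<in> measurable M (count_space UNIV)"
  proof -
    have "{\<omega>\<in>space M. X n \<omega> = k \<and> S \<omega> = s} \<in> sets M" for k s by measurable
    moreover have "(\<lambda>\<omega>. (X n \<omega>, S \<omega>)) -` {(k, s)} \<inter> space M = {\<omega>\<in>space M. X n \<omega> = k \<and> S \<omega> = s}" for k s by auto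
    ultimately show ?thesis by (simp add: measurable_count_space_eq_countable)
  qed
  have "distr M (count_space UNIV) (\<lambda>\<omega>. (X n \<omega>, S \<omega>)) = measure_pmf (pair_pmf F (walk F n))"
  proof (rule measure_eqI_countable[where A = UNIV])
    fix z :: "int \<times> int"
    obtain k s where z: "z = (k, s)" by (cases z)
    have "emeasure (distr M (count_space UNIV) (\<lambda>\<omega>. (X n \<omega>, S \<omega>))) {z} = emeasure M {\<omega>\<in>space M. X n \<omega> = k \<and> S \<omega> = s}"
      by (subst emeasure_distr) (auto intro!: arg_cong[where f = "emeasure M"] simp: z)
    also have "\<dots> = emeasure (measure_pmf (pair_pmf F (walk F n))) {z}"
      by (simp add: emeasure_eq_measure pair emeasure_pmf_single z pmf_pair)
    finally show "emeasure (distr M (count_space UNIV) (\<lambda>\<omega>. (X n \<omega>, S \<omega>))) {z} = emeasure (measure_pmf (pair_pmf F (walk F n))) {z}" .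
  qed auto
  then have "measure_pmf (walk F (Suc n)) = distr (distr M (count_space UNIV) (\<lambda>\<omega>. (X n \<omega>, S \<omega>))) (count_space UNIV) (\<lambda>(k, s). k + s)"
    by (simp add: walk_Suc_eq_pair map_pmf_rep_eq)
  also have "\<dots> = distr M (count_space UNIV) (\<lambda>\<omega>. X n \<omega> + S \<omega>)"
    by (subst distr_distr) (auto simp: comp_def)
  finally show ?case by (simp add: S_def[abs_def] add.commute)
qed

text \<open>The event is decomposed by the value of \<open>N\<close>. On each piece the number of
  summands is fixed, so the condition on the sum becomes an event \<open>E\<close> of the product
  space of sequences, to which independence of \<open>N\<close> from the whole sequence
  applies.\<close>

lemma (in prob_space) mass_random_sum:
  assumes iid: "iid M X" and N: "indep_of_seq M N X"
    and F: "distr M (count_space UNIV) (X 0) = measure_pmf F"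
  shows "(\<lambda>n. mass M N n * pmf (walk F n) t) sums mass M (random_sum X N) t"
proof -
  have indep: "indep_vars (\<lambda>_. count_space UNIV) X UNIV"
    and FX: "distr M (count_space UNIV) (X i) = measure_pmf F" for i
    using iid F unfolding iid_def by auto
  have X [measurable]: "X i \<in> measurable M (count_space UNIV)" for i
    using indep by (auto simp: indep_vars_def)
  have Nm [measurable]: "N \<in> measurable M (count_space UNIV)"
    and ind: "indep_set (sets (vimage_algebra (space M) N (count_space UNIV)))
       (sets (vimage_algebra (space M) (\<lambda>\<omega> i. X i \<omega>) (PiM UNIV (\<lambda>_. count_space UNIV))))"
    using N by (auto simp: indep_of_seq_def)
  define A where "A n = {\<omega>\<in>space M. N \<omega> = n \<and> (\<Sum>i<n. X i \<omega>) = t}" for n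
  have A: "prob (A n) = mass M N n * pmf (walk F n) t" for n
  proof -
    define E where "E = {x\<in>space (PiM UNIV (\<lambda>_. count_space UNIV)). (\<Sum>i<n. x i) = t}"
    have [measurable]: "(\<lambda>x. \<Sum>i<n. x i) \<in> measurable (PiM UNIV (\<lambda>_::nat. count_space (UNIV::int set))) (count_space UNIV)"
      by (rule measurable_sum_int) (rule measurable_component_singleton, simp)
    have E: "E \<in> sets (PiM UNIV (\<lambda>_::nat. count_space UNIV))" unfolding E_def by measurable
    have "A n = (N -` {n} \<inter> space M) \<inter> ((\<lambda>\<omega> i. X i \<omega>) -` E \<inter> space M)"
      by (auto simp: A_def E_def space_PiM)
    also have "prob \<dots> = prob (N -` {n} \<inter> space M) * prob ((\<lambda>\<omega> i. X i \<omega>) -` E \<inter> space M)"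
      by (rule indep_setD[OF ind]) (auto intro!: in_vimage_algebra E)
    also have "N -` {n} \<inter> space M = {\<omega>\<in>space M. N \<omega> = n}" by auto
    also have "(\<lambda>\<omega> i. X i \<omega>) -` E \<inter> space M = (\<lambda>\<omega>. \<Sum>i<n. X i \<omega>) -` {t} \<inter> space M"
      by (auto simp: E_def space_PiM)
    also have "prob \<dots> = measure (distr M (count_space UNIV) (\<lambda>\<omega>. \<Sum>i<n. X i \<omega>)) {t}"
      by (subst measure_distr) (auto intro: measurable_sum_int X)
    also have "\<dots> = pmf (walk F n) t"
      by (simp add: distr_partial_sum[OF indep FX] measure_pmf_single)
    finally show ?thesis by (simp add: mass_def)
  qed
  have "(\<lambda>n. prob (A n)) sums prob (\<Union>n. A n)"
  proof (rule finite_measure_UNION)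
    have [measurable]: "(\<lambda>\<omega>. \<Sum>i<n. X i \<omega>) \<in> measurable M (count_space UNIV)" for n
      by (rule measurable_sum_int) (rule X)
    have "A n \<in> sets M" for n unfolding A_def by measurable
    then show "range A \<subseteq> sets M" by auto
    show "disjoint_family A" by (auto simp: disjoint_family_on_def A_def)
  qed
  also have "(\<Union>n. A n) = {\<omega>\<in>space M. random_sum X N \<omega> = t}"
    by (auto simp: A_def random_sum_def)
  finally show ?thesis by (simp add: A mass_def)
qed

text \<open>The formula for the mean is conditional because the Bochner integral of a non-integrable
  function is 0 by convention, also when the mean is infinite.\<close>

lemma (in prob_space) nat_expectation:
  fixes N :: "'a \<Rightarrow> nat"
  assumes N: "N \<in> measurable M (count_space UNIV)"
  shows "integrable M (\<lambda>\<omega>. real (N \<omega>)) \<longleftrightarrow> summable (\<lambda>n. real n * mass M N n)"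
    and "summable (\<lambda>n. real n * mass M N n) \<Longrightarrow> (\<integral>\<omega>. real (N \<omega>) \<partial>M) = (\<Sum>n. real n * mass M N n)"
    and "summable (mass M N)"
proof -
  obtain P where P: "distr M (count_space UNIV) N = measure_pmf P" "\<And>n. pmf P n = mass M N n"
    using distr_eq_measure_pmf[OF N] by blast
  have dens: "measure_pmf P = density (count_space UNIV) (pmf P)" by (rule measure_pmf_eq_density)
  have "integrable M (\<lambda>\<omega>. real (N \<omega>)) \<longleftrightarrow> integrable (measure_pmf P) real"
    using integrable_distr_eq[OF N, of real] P(1) by simp
  also have "\<dots> \<longleftrightarrow> integrable (count_space UNIV) (\<lambda>n. pmf P n * real n)"
    unfolding dens by (subst integrable_density) auto
  also have "\<dots> \<longleftrightarrow> summable (\<lambda>n. real n * mass M N n)"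
    by (simp add: integrable_count_space_nat_iff P(2) mass_def mult.commute)
  finally show 1: "integrable M (\<lambda>\<omega>. real (N \<omega>)) \<longleftrightarrow> summable (\<lambda>n. real n * mass M N n)" .
  show "(\<integral>\<omega>. real (N \<omega>) \<partial>M) = (\<Sum>n. real n * mass M N n)" if "summable (\<lambda>n. real n * mass M N n)"
  proof -
    have "(\<integral>\<omega>. real (N \<omega>) \<partial>M) = (\<integral>n. real n \<partial>measure_pmf P)"
      using integral_distr[OF N, of real] P(1) by simp
    also have "\<dots> = (\<integral>n. pmf P n * real n \<partial>count_space UNIV)"
      unfolding dens by (subst integral_density) auto
    also have "\<dots> = (\<Sum>n. pmf P n * real n)"
      using that by (intro integral_count_space_nat) (simp add: integrable_count_space_nat_iff P(2) mass_def mult.commute)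
    finally show ?thesis by (simp add: P(2) mult.commute)
  qed
  have "pmf P = mass M N" using P(2) by auto
  moreover have "integrable (count_space UNIV) (pmf P)" by (rule integrable_pmf)
  then have "summable (pmf P)" by (simp add: integrable_count_space_nat_iff)
  ultimately show "summable (mass M N)" by simp
qed

section \<open>The mixture over N inside and outside the band\<close>

context heavy_tailed_walk
begin

definition on_band :: "(nat \<Rightarrow> real) \<Rightarrow> nat \<Rightarrow> real" where
  "on_band p t = (\<Sum>n\<in>band t. p n * pmf (walk F n) (int t))"

definition off_band :: "(nat \<Rightarrow> real) \<Rightarrow> nat \<Rightarrow> real" where
  "off_band p t = (\<Sum>n. if n \<in> band t then 0 else p n * pmf (walk F n) (int t))"

lemma summable_mixture:
  assumes "summable p" "\<And>n. p n \<ge> 0"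
  shows "summable (\<lambda>n. p n * pmf (walk F n) t)"
  by (rule summable_comparison_test'[OF assms(1)])
    (use assms(2) in \<open>simp add: abs_mult mult_left_le pmf_le_1\<close>)

lemma mixture_split:
  assumes "summable p" "\<And>n. p n \<ge> 0"
  shows "(\<Sum>n. p n * pmf (walk F n) (int t)) = on_band p t + off_band p t"
  unfolding on_band_def off_band_def
  by (rule suminf_split_finite[OF summable_mixture[OF assms] finite_band])

lemma sum_pmf_walk_le_renewal: "(\<Sum>n\<in>S. pmf (walk F n) t) \<le> renewal 0" if "finite S"
proof -
  have "(\<Sum>n\<in>S. pmf (walk F n) t) \<le> renewal t"
    unfolding renewal_def by (rule sum_le_suminf[OF summable_walk that]) simp
  then show ?thesis using renewal_le[of t] by simp
qed

text \<open>After multiplication by t^3 the off-band bound is at most C n, so n p(n) is a summable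
  majorant exactly when the mean is finite. Every fixed \<open>n\<close> eventually lies below the
  band, where the one-big-jump limit n a applies.\<close>

lemma off_band_finite_mean:
  assumes p: "\<And>n. p n \<ge> 0" and mean: "summable (\<lambda>n. real n * p n)"
  shows "(\<lambda>t. real t ^ 3 * off_band p t) \<longlonglongrightarrow> a * (\<Sum>n. real n * p n)"
proof -
  obtain C where C: "C > 0" "\<forall>\<^sub>F t in sequentially. \<forall>n. n \<notin> band t \<longrightarrow> pmf (walk F n) (int t) \<le> C * real n / max (real t) (real n) ^ 3"
    using pmf_walk_off_band by blast
  define g where "g n t = real t ^ 3 * (if n \<in> band t then 0 else p n * pmf (walk F n) (int t))" for n t
  have g0: "g n t \<ge> 0" for n t using p by (simp add: g_def)
  have lim: "g n \<longlonglongrightarrow> p n * (real n * a)" for n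
  proof (rule Lim_transform_eventually)
    show "(\<lambda>t. p n * (real t ^ 3 * pmf (walk F n) (int t))) \<longlonglongrightarrow> p n * (real n * a)"
      by (intro tendsto_mult tendsto_const pmf_walk_asymptotics)
    have "\<forall>\<^sub>F t in sequentially. real n < real t / (2 * \<mu>)" using mean_pos by real_asymp
    then show "\<forall>\<^sub>F t in sequentially. p n * (real t ^ 3 * pmf (walk F n) (int t)) = g n t"
      by eventually_elim (simp add: g_def band_def)
  qed
  have bound: "g n t \<le> C * (real n * p n)"
    if t: "t > 0" "\<forall>n. n \<notin> band t \<longrightarrow> pmf (walk F n) (int t) \<le> C * real n / max (real t) (real n) ^ 3" for n t
  proof (cases "n \<in> band t")
    case False
    have "real t ^ 3 * pmf (walk F n) (int t) \<le> max (real t) (real n) ^ 3 * (C * real n / max (real t) (real n) ^ 3)"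
      using t False by (intro mult_mono power_mono) auto
    also have "\<dots> = C * real n" using t(1) by (simp add: max_def)
    finally have "p n * (real t ^ 3 * pmf (walk F n) (int t)) \<le> p n * (C * real n)"
      using p by (intro mult_left_mono) auto
    then show ?thesis using False by (simp add: g_def mult_ac)
  qed (use C p in \<open>simp add: g_def\<close>)
  have ev: "\<forall>\<^sub>F t in sequentially. \<forall>n. g n t \<le> C * (real n * p n)"
    using C(2) eventually_gt_at_top[of 0] by eventually_elim (use bound in blast)
  have "\<forall>\<^sub>F (n, t) in sequentially \<times>\<^sub>F sequentially. norm (g n t) \<le> C * (real n * p n)"
    unfolding eventually_prod_filter
    by (rule exI[of _ "\<lambda>_. True"], rule exI[of _ "\<lambda>t. \<forall>n. g n t \<le> C * (real n * p n)"]) (use ev g0 in auto)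
  then have "(\<lambda>t. \<Sum>n. g n t) \<longlonglongrightarrow> (\<Sum>n. p n * (real n * a))"
    using tannerys_theorem[of g "\<lambda>n. p n * (real n * a)" sequentially "\<lambda>n. C * (real n * p n)"] lim summable_mult[OF mean, of C]
    by simp
  also have "(\<Sum>n. p n * (real n * a)) = a * (\<Sum>n. real n * p n)"
    by (subst suminf_mult[OF mean, symmetric]) (simp add: mult_ac)
  finally have *: "(\<lambda>t. \<Sum>n. g n t) \<longlonglongrightarrow> a * (\<Sum>n. real n * p n)" .
  show ?thesis
  proof (rule Lim_transform_eventually[OF *])
    show "\<forall>\<^sub>F t in sequentially. (\<Sum>n. g n t) = real t ^ 3 * off_band p t"
      using ev eventually_gt_at_top[of 0]
    proof eventually_elim
      case (elim t)
      have "summable (\<lambda>n. g n t)"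
      proof (rule summable_comparison_test'[OF summable_mult[OF mean, of C]])
        fix n
        have "g n t \<le> C * (real n * p n)" using elim(1) by (rule spec)
        then show "norm (g n t) \<le> C * (real n * p n)" using g0[of n t] by (simp only: real_norm_def abs_of_nonneg)
      qed
      then have "summable (\<lambda>n. inverse (real t ^ 3) * g n t)" by (rule summable_mult)
      moreover have "inverse (real t ^ 3) * g n t = (if n \<in> band t then 0 else p n * pmf (walk F n) (int t))" for n
        using elim(2) by (simp add: g_def)
      ultimately have "summable (\<lambda>n. if n \<in> band t then 0 else p n * pmf (walk F n) (int t))" by simp
      from suminf_mult[OF this, of "real t ^ 3"] show ?case by (simp add: g_def off_band_def)
    qed
  qed
qed

text \<open>The two regularity conditions act on disjoint ranges: near t / \<mu> the ratio of masses
  tends to 1 uniformly and the weights have bounded total; in the rest of the band the ratio is only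
  bounded, but the weights vanish in total.\<close>

lemma on_band_regular:
  assumes R1: "R1 p" and R2: "R2 p" and p: "\<And>n. p n \<ge> 0"
  shows "(\<lambda>t. on_band p t / p (nat \<lfloor>real t / \<mu>\<rfloor>)) \<longlonglongrightarrow> 1 / \<mu>"
proof -
  have pos: "p n > 0" if "n > 0" for n using R1_pos[OF R1 p that] .
  obtain \<kappa> where \<kappa>: "1/2 < \<kappa>" "\<kappa> < 1" and near: "\<And>e. e > 0 \<Longrightarrow> \<forall>\<^sub>F t in sequentially. \<forall>n.
    \<bar>real t - real n * \<mu>\<bar> \<le> real t powr \<kappa> \<longrightarrow> \<bar>p n - p (nat \<lfloor>real t / \<mu>\<rfloor>)\<bar> \<le> e * p (nat \<lfloor>real t / \<mu>\<rfloor>)"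
    using R2_ratio_near[OF R2 pos mean_pos] by blast
  obtain K where K: "K > 0" and band_le: "\<forall>\<^sub>F t in sequentially. \<forall>n. 1 / (2 * \<mu>) * real t \<le> real n \<longrightarrow> real n \<le> 2 / \<mu> * real t \<longrightarrow> p n \<le> K * p (nat \<lfloor>real t / \<mu>\<rfloor>)"
    using R1_floor_comparable[OF R1 p mean_pos, of "1 / (2 * \<mu>)" "2 / \<mu>"] mean_pos by auto
  define N where "N t = (\<Sum>n\<in>near \<kappa> t. pmf (walk F n) (int t))" for t
  define D where "D t = (\<Sum>n\<in>band t - near \<kappa> t. pmf (walk F n) (int t))" for t
  have fin: "\<forall>\<^sub>F t in sequentially. near \<kappa> t \<subseteq> band t" by (rule near_subset_band[OF \<kappa>(2)])
  have mpos: "\<forall>\<^sub>F t in sequentially. p (nat \<lfloor>real t / \<mu>\<rfloor>) > 0"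
  proof -
    have "\<forall>\<^sub>F t in sequentially. 1 \<le> real t / \<mu>" using mean_pos by real_asymp
    then show ?thesis by eventually_elim (auto intro!: pos simp: le_floor_iff)
  qed
  have "(\<lambda>t. on_band p t / p (nat \<lfloor>real t / \<mu>\<rfloor>) - N t) \<longlonglongrightarrow> 0"
  proof (rule tendstoI)
    fix e :: real assume e: "e > 0"
    \<comment> \<open>Leaves e / 2 for the rest of the band; the \<open>+ 1\<close> makes the
      denominator positive from nonnegativity alone.\<close>
    define e' where "e' = e / (2 * (renewal 0 + 1))"
    have e': "e' > 0" "e' * renewal 0 \<le> e / 2"
      using e renewal_nonneg[of 0] by (auto simp: e'_def field_simps intro!: mult_pos_pos divide_pos_pos)
    have "\<forall>\<^sub>F t in sequentially. K * D t < e / 2"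
      using tendsto_mult_left[OF renewal_far_in_band[OF \<kappa>], of K] e unfolding D_def
      by (intro order_tendstoD(2)[where y = "K * 0"]) auto
    then show "\<forall>\<^sub>F t in sequentially. dist (on_band p t / p (nat \<lfloor>real t / \<mu>\<rfloor>) - N t) 0 < e"
      using near[OF e'(1)] band_le fin mpos
    proof eventually_elim
      case (elim t)
      define m where "m = nat \<lfloor>real t / \<mu>\<rfloor>"
      define u where "u n = pmf (walk F n) (int t)" for n
      have pm: "p m > 0" using elim(5) by (simp add: m_def)
      have "on_band p t / p m - N t = (\<Sum>n\<in>near \<kappa> t. p n / p m * u n) + (\<Sum>n\<in>band t - near \<kappa> t. p n / p m * u n) - (\<Sum>n\<in>near \<kappa> t. u n)"
        using sum.subset_diff[OF elim(4) finite_band, of "\<lambda>n. p n / p m * u n"]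
        by (simp add: on_band_def N_def u_def sum_divide_distrib)
      also have "\<dots> = (\<Sum>n\<in>near \<kappa> t. (p n / p m - 1) * u n) + (\<Sum>n\<in>band t - near \<kappa> t. p n / p m * u n)"
        by (simp add: left_diff_distrib sum_subtractf)
      finally have eq: "on_band p t / p m - N t = \<dots>" .
      have "\<bar>\<Sum>n\<in>near \<kappa> t. (p n / p m - 1) * u n\<bar> \<le> (\<Sum>n\<in>near \<kappa> t. e' * u n)"
      proof (rule order_trans[OF sum_abs sum_mono])
        fix n assume "n \<in> near \<kappa> t"
        then have "\<bar>p n - p m\<bar> \<le> e' * p m" using elim(2) by (simp add: near_def m_def)
        moreover have "p n / p m - 1 = (p n - p m) / p m" using pm by (simp add: field_simps)
        ultimately have "\<bar>p n / p m - 1\<bar> \<le> e'" using pm by (simp add: field_simps)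
        then show "\<bar>(p n / p m - 1) * u n\<bar> \<le> e' * u n" by (simp add: abs_mult u_def mult_right_mono)
      qed
      also have "\<dots> \<le> e' * renewal 0" unfolding sum_distrib_left[symmetric] u_def
        by (intro mult_left_mono sum_pmf_walk_le_renewal finite_subset[OF elim(4) finite_band]) (use e' in simp)
      also have "\<dots> \<le> e / 2" using e'(2) .
      finally have 1: "\<bar>\<Sum>n\<in>near \<kappa> t. (p n / p m - 1) * u n\<bar> \<le> e / 2" .
      have "(\<Sum>n\<in>band t - near \<kappa> t. p n / p m * u n) \<le> (\<Sum>n\<in>band t - near \<kappa> t. K * u n)"
      proof (rule sum_mono)
        fix n assume "n \<in> band t - near \<kappa> t"
        then have "p n \<le> K * p m" using elim(3) by (simp add: band_def m_def less_imp_le)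
        then have "p n / p m \<le> K" using pm by (simp add: field_simps)
        then show "p n / p m * u n \<le> K * u n" by (rule mult_right_mono) (simp add: u_def)
      qed
      also have "\<dots> = K * D t" by (simp add: D_def u_def sum_distrib_left)
      finally have 2: "(\<Sum>n\<in>band t - near \<kappa> t. p n / p m * u n) < e / 2" using elim(1) by linarith
      have 3: "0 \<le> (\<Sum>n\<in>band t - near \<kappa> t. p n / p m * u n)"
        using pm p by (intro sum_nonneg mult_nonneg_nonneg divide_nonneg_pos) (auto simp: u_def)
      have "\<bar>on_band p t / p m - N t\<bar> < e" unfolding eq using 1 2 3 by linarith
      then show ?case by (simp add: m_def)
    qed
  qed
  from tendsto_add[OF this renewal_near[OF \<kappa>, folded N_def]] show ?thesis by simp
qed

text \<open>In the band t < 2 \<mu> n, so t^3 p(n) is at most a constant times n^3 p(n), which is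
  uniformly small there; the walk probabilities contribute a total of at most
  \<open>renewal 0\<close>.\<close>

lemma on_band_negligible:
  assumes p: "\<And>n. p n \<ge> 0" and small: "(\<lambda>t. real t ^ 3 * p t) \<longlonglongrightarrow> 0"
  shows "(\<lambda>t. real t ^ 3 * on_band p t) \<longlonglongrightarrow> 0"
proof (rule tendstoI)
  fix e :: real assume e: "e > 0"
  define B where "B = (2 * \<mu>) ^ 3 * renewal 0 + 1"
  have B: "B > 0" "(2 * \<mu>) ^ 3 * renewal 0 < B"
    using mean_pos renewal_nonneg[of 0] by (auto simp: B_def intro: add_nonneg_pos)
  define e' where "e' = e / B"
  have e': "e' > 0" using e B by (simp add: e'_def)
  have "\<forall>\<^sub>F t in sequentially. real t ^ 3 * p t < e'" using small by (rule order_tendstoD) (rule e')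
  then obtain t\<^sub>0 where t0: "\<And>t. t \<ge> t\<^sub>0 \<Longrightarrow> real t ^ 3 * p t < e'" by (auto simp: eventually_at_top_linorder)
  have "\<forall>\<^sub>F t in sequentially. real t\<^sub>0 \<le> real t / (2 * \<mu>)" using mean_pos by real_asymp
  then show "\<forall>\<^sub>F t in sequentially. dist (real t ^ 3 * on_band p t) 0 < e"
  proof eventually_elim
    case (elim t)
    have "real t ^ 3 * on_band p t = (\<Sum>n\<in>band t. real t ^ 3 * p n * pmf (walk F n) (int t))"
      by (simp add: on_band_def sum_distrib_left mult.assoc)
    also have "\<dots> \<le> (\<Sum>n\<in>band t. (2 * \<mu>) ^ 3 * e' * pmf (walk F n) (int t))"
    proof (rule sum_mono)
      fix n assume n: "n \<in> band t"
      then have "n \<ge> t\<^sub>0" using elim by (simp add: band_def)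
      have "real t \<le> 2 * \<mu> * real n" using n mean_pos by (simp add: band_def field_simps)
      then have "real t ^ 3 \<le> (2 * \<mu> * real n) ^ 3" by (intro power_mono) auto
      then have "real t ^ 3 * p n \<le> (2 * \<mu> * real n) ^ 3 * p n" by (rule mult_right_mono) (rule p)
      also have "\<dots> = (2 * \<mu>) ^ 3 * (real n ^ 3 * p n)" by (simp only: power_mult_distrib mult.assoc)
      also have "\<dots> \<le> (2 * \<mu>) ^ 3 * e'" using t0[OF \<open>n \<ge> t\<^sub>0\<close>] mean_pos by (intro mult_left_mono) auto
      finally show "real t ^ 3 * p n * pmf (walk F n) (int t) \<le> (2 * \<mu>) ^ 3 * e' * pmf (walk F n) (int t)"
        by (rule mult_right_mono) simp
    qed
    also have "\<dots> = (2 * \<mu>) ^ 3 * e' * (\<Sum>n\<in>band t. pmf (walk F n) (int t))" by (simp only: sum_distrib_left)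
    also have "\<dots> \<le> (2 * \<mu>) ^ 3 * e' * renewal 0"
      using mean_pos e' by (intro mult_left_mono sum_pmf_walk_le_renewal finite_band) auto
    also have "\<dots> = e' * ((2 * \<mu>) ^ 3 * renewal 0)" by (simp only: mult_ac)
    also have "\<dots> < e' * B" using B e' by (intro mult_strict_left_mono) auto
    also have "\<dots> = e" using B by (simp add: e'_def)
    finally have "real t ^ 3 * on_band p t < e" .
    moreover have "0 \<le> real t ^ 3 * on_band p t" unfolding on_band_def using p by (intro mult_nonneg_nonneg sum_nonneg) auto
    ultimately show ?case by simp
  qed
qed

lemma mass_floor_comparable:
  assumes "R1 p" "\<And>n. p n \<ge> 0"
  shows "\<exists>K>0. \<forall>\<^sub>F t in sequentially. p t \<le> K * p (nat \<lfloor>real t / \<mu>\<rfloor>)"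
proof -
  obtain K where "K > 0" "\<forall>\<^sub>F t in sequentially. \<forall>n. 1 * real t \<le> real n \<longrightarrow> real n \<le> 1 * real t \<longrightarrow> p n \<le> K * p (nat \<lfloor>real t / \<mu>\<rfloor>)"
    using R1_floor_comparable[OF assms mean_pos, of 1 1] by auto
  then show ?thesis by (intro exI[of _ K]) (auto elim: eventually_mono)
qed

text \<open>Replaces \<open>off_band_finite_mean\<close> when the mean is infinite: the Potter
  estimate bounds the whole off-band sum by p(t) times t^(-1/2), and \<open>R1\<close> moves from
  \<open>t\<close> to the integer part of t / \<mu>.\<close>

lemma off_band_regularly_varying:
  assumes R1: "R1 p" and p: "\<And>n. p n \<ge> 0" and sp: "summable p" and rv: "regularly_varying_mass p"
    and inf: "\<not> summable (\<lambda>n. real n * p n)"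
  shows "(\<lambda>t. off_band p t / p (nat \<lfloor>real t / \<mu>\<rfloor>)) \<longlonglongrightarrow> 0"
proof -
  obtain C where C: "C > 0" "\<forall>\<^sub>F t in sequentially. \<forall>n. n \<notin> band t \<longrightarrow> pmf (walk F n) (int t) \<le> C * real n / max (real t) (real n) ^ 3"
    using pmf_walk_off_band by blast
  obtain K where K: "K > 0" "\<forall>\<^sub>F t in sequentially. \<forall>n. p n * (real n / max (real t) (real n) ^ 3) \<le> K * p t * real t powr (-1/2) * real n powr (-3/2)"
    using regularly_varying_mass_weighted_le[OF R1 p rv inf] by blast
  obtain K' where K': "K' > 0" "\<forall>\<^sub>F t in sequentially. p t \<le> K' * p (nat \<lfloor>real t / \<mu>\<rfloor>)"
    using mass_floor_comparable[OF R1 p] by blast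
  define Z where "Z = (\<Sum>n. real n powr (-3/2))"
  have Z: "Z \<ge> 0" unfolding Z_def by (rule suminf_nonneg[OF summable_three_halves]) simp
  have mpos: "\<forall>\<^sub>F t in sequentially. p (nat \<lfloor>real t / \<mu>\<rfloor>) > 0"
  proof -
    have "\<forall>\<^sub>F t in sequentially. 1 \<le> real t / \<mu>" using mean_pos by real_asymp
    then show ?thesis by eventually_elim (auto intro!: R1_pos[OF R1 p] simp: le_floor_iff)
  qed
  have off0: "0 \<le> off_band p t" for t
    unfolding off_band_def
    by (rule suminf_nonneg[OF summable_zero_on[OF summable_mixture[OF sp p]]]) (use p in auto)
  have up: "\<forall>\<^sub>F t in sequentially. off_band p t / p (nat \<lfloor>real t / \<mu>\<rfloor>) \<le> C * K * K' * Z * real t powr (-1/2)"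
    using C(2) K(2) K'(2) mpos
  proof eventually_elim
    case (elim t)
    define c where "c = C * K * p t * real t powr (-1/2)"
    have "off_band p t \<le> (\<Sum>n. c * real n powr (-3/2))"
      unfolding off_band_def
    proof (rule suminf_le)
      fix n
      have "p n * pmf (walk F n) (int t) \<le> c * real n powr (-3/2)" if "n \<notin> band t"
      proof -
        have "p n * pmf (walk F n) (int t) \<le> p n * (C * real n / max (real t) (real n) ^ 3)"
          using elim(1) that p by (intro mult_left_mono) auto
        also have "\<dots> = C * (p n * (real n / max (real t) (real n) ^ 3))" by simp
        also have "\<dots> \<le> C * (K * p t * real t powr (-1/2) * real n powr (-3/2))"
          using elim(2) C by (intro mult_left_mono) auto
        finally show ?thesis by (simp only: c_def mult.assoc)
      qed
      moreover have "0 \<le> c * real n powr (-3/2)" using C K p by (simp add: c_def)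
      ultimately show "(if n \<in> band t then 0 else p n * pmf (walk F n) (int t)) \<le> c * real n powr (-3/2)" by simp
    next
      show "summable (\<lambda>n. c * real n powr (-3/2))" by (rule summable_mult[OF summable_three_halves])
      show "summable (\<lambda>n. if n \<in> band t then 0 else p n * pmf (walk F n) (int t))"
        by (rule summable_zero_on[OF summable_mixture[OF sp p]]) (use p in simp)
    qed
    also have "\<dots> = c * Z" unfolding Z_def by (rule suminf_mult[OF summable_three_halves])
    also have "\<dots> = C * K * Z * real t powr (-1/2) * p t" by (simp add: c_def)
    also have "\<dots> \<le> C * K * Z * real t powr (-1/2) * (K' * p (nat \<lfloor>real t / \<mu>\<rfloor>))"
      using elim(3) C K Z by (intro mult_left_mono) auto
    finally show ?case using elim(4) by (simp add: field_simps)
  qed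
  have lim: "(\<lambda>t. C * K * K' * Z * real t powr (-1/2)) \<longlonglongrightarrow> 0" by real_asymp
  have low: "\<forall>\<^sub>F t in sequentially. 0 \<le> off_band p t / p (nat \<lfloor>real t / \<mu>\<rfloor>)"
    using off0 p by (intro always_eventually allI divide_nonneg_nonneg) auto
  show ?thesis by (rule tendsto_sandwich[OF low up tendsto_const lim])
qed

end

section \<open>Assembly of the asymptotic formulas\<close>

text \<open>The filter of \<open>r\<close> is the neighbourhood of both infinities at once, so the
  O-bound makes \<open>r\<close> small in both tails; this gives the cubic bound on either side and
  the limit on the right.\<close>

lemma heavy_tailed_walkI:
  fixes F :: "int pmf" and r :: "int \<Rightarrow> real" and a b \<mu> \<epsilon> :: real
  assumes mean: "\<mu> = (\<integral>k. real_of_int k \<partial>F)" "\<mu> > 0" and ab: "a \<ge> 0" "b \<ge> 0" and \<epsilon>: "\<epsilon> > 0"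
    and right: "\<And>t. t > 0 \<Longrightarrow> pmf F (int t) = a * real t powr - 3 * (1 + r (int t))"
    and left: "\<And>t. t > 0 \<Longrightarrow> pmf F (- int t) = b * real t powr - 3 * (1 + r (- int t))"
    and r: "r \<in> O[filtercomap abs at_top](\<lambda>s. ln (ln \<bar>real_of_int s\<bar>) powr (- 1 - \<epsilon>))"
  shows "heavy_tailed_walk F a \<mu>"
proof
  define G :: "int filter" where "G = filtercomap abs at_top"
  have "((\<lambda>x. ln (ln x) powr (- 1 - \<epsilon>)) \<longlongrightarrow> 0) at_top" using \<epsilon> by real_asymp
  moreover have "filterlim (\<lambda>s. real_of_int \<bar>s\<bar>) at_top G"
    unfolding G_def by (rule filterlim_compose[OF filterlim_real_of_int_at_top filterlim_filtercomap])
  ultimately have g0: "((\<lambda>s. ln (ln \<bar>real_of_int s\<bar>) powr (- 1 - \<epsilon>)) \<longlongrightarrow> 0) G"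
    using filterlim_compose by fastforce
  obtain c where c: "\<forall>\<^sub>F s in G. norm (r s) \<le> c * norm (ln (ln \<bar>real_of_int s\<bar>) powr (- 1 - \<epsilon>))"
    using r unfolding G_def by (elim landau_o.bigE)
  have r0: "(r \<longlongrightarrow> 0) G"
    by (rule Lim_null_comparison[OF c]) (use tendsto_mult_left[OF tendsto_norm[OF g0], of c] in simp)
  have "filterlim int G sequentially"
    unfolding G_def filterlim_filtercomap_iff by (simp add: comp_def filterlim_int_sequentially)
  then have rt: "(\<lambda>t. r (int t)) \<longlonglongrightarrow> 0" by (rule filterlim_compose[OF r0])
  have "\<forall>\<^sub>F s in G. \<bar>r s\<bar> < 1" using tendsto_rabs[OF r0] by (rule order_tendstoD) simp
  then obtain Q where "eventually Q at_top" "\<And>s. Q \<bar>s\<bar> \<Longrightarrow> \<bar>r s\<bar> < 1"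
    unfolding G_def eventually_filtercomap by blast
  then obtain s\<^sub>0 where s0: "\<And>s. \<bar>s\<bar> \<ge> s\<^sub>0 \<Longrightarrow> \<bar>r s\<bar> < 1"
    by (auto simp: eventually_at_top_linorder)
  have cube: "real t powr - 3 * real t ^ 3 = 1" if "t > 0" for t :: nat
    using that by (simp add: powr_minus)
  show "\<exists>C. \<forall>k. pmf F k * \<bar>real_of_int k\<bar> ^ 3 \<le> C"
  \<comment> \<open>Beyond \<open>s\<^sub>0\<close> the factor 1 + r k is at most 2; for the
    finitely many smaller \<open>k\<close> the mass is at most 1.\<close>
  proof (intro exI[of _ "2 * (a + b) + \<bar>real_of_int s\<^sub>0\<bar> ^ 3"] allI)
    fix k :: int
    show "pmf F k * \<bar>real_of_int k\<bar> ^ 3 \<le> 2 * (a + b) + \<bar>real_of_int s\<^sub>0\<bar> ^ 3"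
    proof (cases "\<bar>k\<bar> < s\<^sub>0")
      case True
      then have "\<bar>real_of_int k\<bar> \<le> \<bar>real_of_int s\<^sub>0\<bar>" by linarith
      then have "pmf F k * \<bar>real_of_int k\<bar> ^ 3 \<le> 1 * \<bar>real_of_int s\<^sub>0\<bar> ^ 3"
        by (intro mult_mono power_mono) (auto simp: pmf_le_1)
      then show ?thesis using ab by simp
    next
      case False
      then have rk: "1 + r k \<le> 2" using s0[of k] by simp
      have s30: "0 \<le> \<bar>real_of_int s\<^sub>0\<bar> ^ 3" by simp
      consider "k = 0" | t where "t > 0" "k = int t" | t where "t > 0" "k = - int t"
        by (cases k rule: int_cases3) auto
      then have "pmf F k * \<bar>real_of_int k\<bar> ^ 3 \<le> 2 * (a + b)"
      proof cases
        case (2 t)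
        have "pmf F k * \<bar>real_of_int k\<bar> ^ 3 = a * (1 + r k) * (real t powr - 3 * real t ^ 3)"
          using right[OF 2(1)] by (simp add: 2(2))
        also have "\<dots> = a * (1 + r k)" using cube[OF 2(1)] by simp
        also have "\<dots> \<le> a * 2" using rk ab by (intro mult_left_mono) auto
        finally show ?thesis using ab by simp
      next
        case (3 t)
        have "pmf F k * \<bar>real_of_int k\<bar> ^ 3 = b * (1 + r k) * (real t powr - 3 * real t ^ 3)"
          using left[OF 3(1)] by (simp add: 3(2))
        also have "\<dots> = b * (1 + r k)" using cube[OF 3(1)] by simp
        also have "\<dots> \<le> b * 2" using rk ab by (intro mult_left_mono) auto
        finally show ?thesis using ab by simp
      qed (use ab in simp)
      then show ?thesis using s30 by linarith
    qed
  qed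
  show "(\<lambda>t. real t ^ 3 * pmf F (int t)) \<longlonglongrightarrow> a"
  proof (rule Lim_transform_eventually)
    show "(\<lambda>t. a * (1 + r (int t))) \<longlonglongrightarrow> a"
      using tendsto_mult_left[OF tendsto_add[OF tendsto_const[of 1] rt], of a] by simp
    show "\<forall>\<^sub>F t in sequentially. a * (1 + r (int t)) = real t ^ 3 * pmf F (int t)"
      using eventually_gt_at_top[of 0]
    proof eventually_elim
      case (elim t)
      have "real t ^ 3 * pmf F (int t) = a * (1 + r (int t)) * (real t powr - 3 * real t ^ 3)"
        using right[OF elim] by simp
      then show ?case using cube[OF elim] by simp
    qed
  qed
  show "a > 0"
  proof (rule ccontr)
    \<comment> \<open>With a = 0 the summand takes no positive value, which contradicts the positive
      mean.\<close>
    assume "\<not> a > 0"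
    with ab have "a = 0" by simp
    have "0 \<le> (\<integral>k. - real_of_int k \<partial>F)"
    proof (rule integral_nonneg_AE, subst AE_measure_pmf_iff, rule ballI)
      fix k assume "k \<in> set_pmf F"
      then have "\<not> k > 0" using right[of "nat k"] \<open>a = 0\<close> by (auto simp: set_pmf_eq)
      then show "0 \<le> - real_of_int k" by simp
    qed
    then show False using mean by simp
  qed
qed (rule mean)+

theorem proposition1:
  fixes M :: "'a measure" and X :: "nat \<Rightarrow> 'a \<Rightarrow> int" and N :: "'a \<Rightarrow> nat"
    and a b \<epsilon> \<mu> EN :: real and r :: "int \<Rightarrow> real"
  assumes "prob_space M"
    and "iid M X"
    and "indep_of_seq M N X"
    and "\<mu> = (\<integral>\<omega>. real_of_int (X 0 \<omega>) \<partial>M)"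
    and "EN = (\<integral>\<omega>. real (N \<omega>) \<partial>M)"
    and "\<mu> > 0"
    and "a \<ge> 0" and "b \<ge> 0" and "a + b > 0" and "\<epsilon> > 0"
    and "\<And>t::nat. t > 0 \<Longrightarrow> mass M (X 0) (int t) = a * real t powr - 3 * (1 + r (int t))"
    and "\<And>t::nat. t > 0 \<Longrightarrow> mass M (X 0) (- int t) = b * real t powr - 3 * (1 + r (- int t))"
    and "r \<in> O[filtercomap abs at_top](\<lambda>s. ln (ln \<bar>real_of_int s\<bar>) powr (- 1 - \<epsilon>))"
  shows
    "(R1 (mass M N) \<and> R2 (mass M N) \<longrightarrow>
        (integrable M (\<lambda>\<omega>. real (N \<omega>)) \<longrightarrow>
          (\<exists>\<delta>\<^sub>1 \<delta>\<^sub>2. \<delta>\<^sub>1 \<longlonglongrightarrow> 0 \<and> \<delta>\<^sub>2 \<longlonglongrightarrow> 0 \<and>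
            (\<forall>\<^sub>F t in sequentially.
              mass M (random_sum X N) (int t) =
                EN * mass M (X 0) (int t) * (1 + \<delta>\<^sub>1 t) +
                inverse \<mu> * mass M N (nat \<lfloor>real t / \<mu>\<rfloor>) * (1 + \<delta>\<^sub>2 t)))) \<and>
        ((\<lambda>t. mass M (X 0) (int t)) \<in> o(mass M N) \<longrightarrow>
          integrable M (\<lambda>\<omega>. real (N \<omega>)) \<or> regularly_varying_mass (mass M N) \<longrightarrow>
          (\<lambda>t::nat. mass M (random_sum X N) (int t))
            \<sim>[at_top] (\<lambda>t. inverse \<mu> * mass M N (nat \<lfloor>real t / \<mu>\<rfloor>))))
     \<and>
     (integrable M (\<lambda>\<omega>. real (N \<omega>)) \<longrightarrow>
        mass M N \<in> o(\<lambda>t. mass M (X 0) (int t)) \<longrightarrow>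
        (\<lambda>t::nat. mass M (random_sum X N) (int t))
          \<sim>[at_top] (\<lambda>t. EN * mass M (X 0) (int t)))"
proof -
  interpret prob_space M by fact
  have X: "X 0 \<in> measurable M (count_space UNIV)"
    using \<open>iid M X\<close> by (auto simp: iid_def indep_vars_def)
  have N: "N \<in> measurable M (count_space UNIV)"
    using \<open>indep_of_seq M N X\<close> by (simp add: indep_of_seq_def)
  obtain F where F: "distr M (count_space UNIV) (X 0) = measure_pmf F" "\<And>k. pmf F k = mass M (X 0) k"
    using distr_eq_measure_pmf[OF X] by blast
  define p where "p = mass M N"
  define f where "f t = mass M (X 0) (int t)" for t
  define Q where "Q t = mass M (random_sum X N) (int t)" for t
  define q where "q t = p (nat \<lfloor>real t / \<mu>\<rfloor>)" for t
  have "\<mu> = (\<integral>k. real_of_int k \<partial>F)"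
    using integral_distr[OF X, of real_of_int] F(1) \<open>\<mu> = _\<close> by simp
  then interpret heavy_tailed_walk F a \<mu>
    by (rule heavy_tailed_walkI[where b = b and \<epsilon> = \<epsilon> and r = r]) (use assms F(2) in auto)
  have p: "p n \<ge> 0" for n by (simp add: p_def mass_def)
  note Nexp = nat_expectation[OF N, folded p_def]
  have Q: "Q t = on_band p t + off_band p t" for t
    using mass_random_sum[OF \<open>iid M X\<close> \<open>indep_of_seq M N X\<close> F(1), of "int t"] mixture_split[OF Nexp(3) p, of t]
    by (simp add: Q_def p_def sums_iff)
  have f_lim: "(\<lambda>t. real t ^ 3 * f t) \<longlonglongrightarrow> a"
    using tail_limit by (simp add: f_def F(2))
  have f_pos: "\<forall>\<^sub>F t in sequentially. f t > 0"
    using order_tendstoD(1)[OF f_lim a_pos] by eventually_elim (simp add: zero_less_mult_iff)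
  have q_pos: "\<forall>\<^sub>F t in sequentially. q t > 0" if "R1 p"
  proof -
    have "\<forall>\<^sub>F t in sequentially. 1 \<le> real t / \<mu>" using mean_pos by real_asymp
    then show ?thesis unfolding q_def by eventually_elim (auto intro!: R1_pos[OF that p] simp: le_floor_iff)
  qed
  have EN: "EN = (\<Sum>n. real n * p n)" "summable (\<lambda>n. real n * p n)" if "integrable M (\<lambda>\<omega>. real (N \<omega>))"
    using that Nexp(1,2) \<open>EN = _\<close> by auto
  have off_f: "(\<lambda>t. off_band p t / f t) \<longlonglongrightarrow> EN" if int: "integrable M (\<lambda>\<omega>. real (N \<omega>))"
  proof (rule Lim_transform_eventually)
    show "(\<lambda>t. (real t ^ 3 * off_band p t) / (real t ^ 3 * f t)) \<longlonglongrightarrow> EN"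
      using tendsto_divide[OF off_band_finite_mean[OF p EN(2)[OF int]] f_lim] a_pos EN(1)[OF int] by simp
    show "\<forall>\<^sub>F t in sequentially. (real t ^ 3 * off_band p t) / (real t ^ 3 * f t) = off_band p t / f t"
      using eventually_gt_at_top[of 0] by eventually_elim simp
  qed
  have on_q: "(\<lambda>t. on_band p t / q t) \<longlonglongrightarrow> 1 / \<mu>" if "R1 p" "R2 p"
    unfolding q_def by (rule on_band_regular[OF that p])
  \<comment> \<open>\<open>R1\<close> makes N = 1 possible, so division by the mean is allowed when
    the relative error is defined.\<close>
  have EN_pos: "EN > 0" if "R1 p" and int: "integrable M (\<lambda>\<omega>. real (N \<omega>))"
  proof -
    have "0 < real 1 * p 1" using R1_pos[OF that(1) p, of 1] by simp
    then show ?thesis unfolding EN(1)[OF int]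
      by (intro suminf_pos2[OF EN(2)[OF int], of 1]) (use p in auto)
  qed

  have part1: "\<exists>\<delta>\<^sub>1 \<delta>\<^sub>2. \<delta>\<^sub>1 \<longlonglongrightarrow> 0 \<and> \<delta>\<^sub>2 \<longlonglongrightarrow> 0 \<and>
      (\<forall>\<^sub>F t in sequentially. Q t = EN * f t * (1 + \<delta>\<^sub>1 t) + inverse \<mu> * q t * (1 + \<delta>\<^sub>2 t))"
    if R: "R1 p" "R2 p" and int: "integrable M (\<lambda>\<omega>. real (N \<omega>))"
  proof (intro exI conjI)
    \<comment> \<open>The errors are obtained by solving for them: one is the relative error of the
      off-band sum, the other that of the on-band sum, so the formula holds identically wherever
      \<open>f\<close> and \<open>q\<close> are positive.\<close>
    define \<delta>\<^sub>1 where "\<delta>\<^sub>1 t = off_band p t / f t / EN - 1" for t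
    define \<delta>\<^sub>2 where "\<delta>\<^sub>2 t = on_band p t / q t * \<mu> - 1" for t
    have EN0: "EN > 0" by (rule EN_pos[OF R(1) int])
    show "\<delta>\<^sub>1 \<longlonglongrightarrow> 0"
      using tendsto_diff[OF tendsto_divide[OF off_f[OF int] tendsto_const[of EN]] tendsto_const[of 1]] EN0
      by (simp add: \<delta>\<^sub>1_def[abs_def])
    show "\<delta>\<^sub>2 \<longlonglongrightarrow> 0"
      using tendsto_diff[OF tendsto_mult[OF on_q[OF R] tendsto_const[of \<mu>]] tendsto_const[of 1]] mean_pos
      by (simp add: \<delta>\<^sub>2_def[abs_def])
    show "\<forall>\<^sub>F t in sequentially. Q t = EN * f t * (1 + \<delta>\<^sub>1 t) + inverse \<mu> * q t * (1 + \<delta>\<^sub>2 t)"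
      using f_pos q_pos[OF R(1)]
      by eventually_elim (use EN0 mean_pos in \<open>simp add: Q \<delta>\<^sub>1_def \<delta>\<^sub>2_def\<close>)
  qed

  have part2: "Q \<sim>[at_top] (\<lambda>t. inverse \<mu> * q t)"
    if R: "R1 p" "R2 p" and small: "f \<in> o(p)"
      and case_or: "integrable M (\<lambda>\<omega>. real (N \<omega>)) \<or> regularly_varying_mass p"
  proof -
    have off_q: "(\<lambda>t. off_band p t / q t) \<longlonglongrightarrow> 0"
    proof (cases "integrable M (\<lambda>\<omega>. real (N \<omega>))")
      case True
      obtain K where K: "K > 0" "\<forall>\<^sub>F t in sequentially. p t \<le> K * q t"
        using mass_floor_comparable[OF R(1) p] unfolding q_def by blast
      have fp: "(\<lambda>t. f t / p t) \<longlonglongrightarrow> 0" using small by (rule smalloD_tendsto)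
      \<comment> \<open>The assumption compares \<open>f\<close> with \<open>p\<close> at
        \<open>t\<close>, while the formula needs \<open>p\<close> at the integer part of t / \<mu>;
        comparability under \<open>R1\<close> bridges the two.\<close>
      have fq: "(\<lambda>t. f t / q t) \<longlonglongrightarrow> 0"
      proof (rule Lim_null_comparison)
        show "(\<lambda>t. K * norm (f t / p t)) \<longlonglongrightarrow> 0"
          using tendsto_mult_left[OF tendsto_norm[OF fp], of K] by simp
        show "\<forall>\<^sub>F t in sequentially. norm (f t / q t) \<le> K * norm (f t / p t)"
          using K(2) q_pos[OF R(1)] eventually_gt_at_top[of 0]
        proof eventually_elim
          case (elim t)
          have pt: "p t > 0" using R1_pos[OF R(1) p elim(3)] .
          have "1 / q t \<le> K / p t" using elim pt by (simp add: field_simps)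
          then have "\<bar>f t\<bar> * (1 / q t) \<le> \<bar>f t\<bar> * (K / p t)" by (intro mult_left_mono) auto
          then show ?case using elim pt by (simp add: abs_mult mult.commute)
        qed
      qed
      show ?thesis
      proof (rule Lim_transform_eventually)
        show "(\<lambda>t. off_band p t / f t * (f t / q t)) \<longlonglongrightarrow> 0"
          using tendsto_mult[OF off_f[OF True] fq] by simp
        show "\<forall>\<^sub>F t in sequentially. off_band p t / f t * (f t / q t) = off_band p t / q t"
          using f_pos by eventually_elim simp
      qed
    next
      case False
      then show ?thesis unfolding q_def
        using off_band_regularly_varying[OF R(1) p Nexp(3)] case_or Nexp(1) by blast
    qed
    show ?thesis
    proof (rule asymp_equivI')
      have "(\<lambda>t. (on_band p t / q t + off_band p t / q t) * \<mu>) \<longlonglongrightarrow> 1"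
        using tendsto_mult[OF tendsto_add[OF on_q[OF R] off_q] tendsto_const[of \<mu>]] mean_pos by simp
      moreover have "Q t / (inverse \<mu> * q t) = (on_band p t / q t + off_band p t / q t) * \<mu>" for t
        by (simp add: Q divide_inverse algebra_simps)
      ultimately show "(\<lambda>t. Q t / (inverse \<mu> * q t)) \<longlonglongrightarrow> 1" by simp
    qed
  qed

  have part3: "Q \<sim>[at_top] (\<lambda>t. EN * f t)"
    if int: "integrable M (\<lambda>\<omega>. real (N \<omega>))" and small: "p \<in> o(f)"
  proof (cases "EN = 0")
    case True
    have "real n * p n = 0" for n
      using suminf_eq_zero_iff[OF EN(2)[OF int]] p EN(1)[OF int] True by simp
    then have p0: "n = 0 \<or> p n = 0" for n by (metis mult_eq_0_iff of_nat_eq_0_iff)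
    have "\<forall>\<^sub>F t in sequentially. Q t = EN * f t"
      using eventually_gt_at_top[of 0]
    proof eventually_elim
      case (elim t)
      have "p n * pmf (walk F n) (int t) = 0" for n
        using p0[of n] elim by (auto simp: pmf_walk_0)
      then have "(\<Sum>n. p n * pmf (walk F n) (int t)) = 0" by (simp only: suminf_zero)
      then show ?case using mixture_split[OF Nexp(3) p, of t] True by (simp add: Q)
    qed
    then show ?thesis by (rule asymp_equiv_refl_ev)
  next
    case False
    have fp: "(\<lambda>t. p t / f t) \<longlonglongrightarrow> 0" using small by (rule smalloD_tendsto)
    have "(\<lambda>t. real t ^ 3 * p t) \<longlonglongrightarrow> 0"
    proof (rule Lim_transform_eventually)
      show "(\<lambda>t. real t ^ 3 * f t * (p t / f t)) \<longlonglongrightarrow> 0" using tendsto_mult[OF f_lim fp] by simp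
      show "\<forall>\<^sub>F t in sequentially. real t ^ 3 * f t * (p t / f t) = real t ^ 3 * p t"
        using f_pos by eventually_elim simp
    qed
    then have on3: "(\<lambda>t. real t ^ 3 * on_band p t) \<longlonglongrightarrow> 0" by (rule on_band_negligible[OF p])
    have on_f: "(\<lambda>t. on_band p t / f t) \<longlonglongrightarrow> 0"
    proof (rule Lim_transform_eventually)
      show "(\<lambda>t. (real t ^ 3 * on_band p t) / (real t ^ 3 * f t)) \<longlonglongrightarrow> 0"
        using tendsto_divide[OF on3 f_lim] a_pos by simp
      show "\<forall>\<^sub>F t in sequentially. (real t ^ 3 * on_band p t) / (real t ^ 3 * f t) = on_band p t / f t"
        using eventually_gt_at_top[of 0] by eventually_elim simp
    qed
    show ?thesis
    proof (rule asymp_equivI')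
      have "(\<lambda>t. (on_band p t / f t + off_band p t / f t) / EN) \<longlonglongrightarrow> 1"
        using tendsto_divide[OF tendsto_add[OF on_f off_f[OF int]] tendsto_const[of EN]] False by simp
      then show "(\<lambda>t. Q t / (EN * f t)) \<longlonglongrightarrow> 1"
        by (simp add: Q add_divide_distrib mult.commute)
    qed
  qed

  show ?thesis
    using part1 part2 part3
    unfolding Q_def[abs_def] f_def[abs_def] q_def[abs_def] p_def by blast
qed

end
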